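(* For a bounded domain $\Omega\subseteq\mathbb{R}^n$ let $u$ denote the unique function in $W^{1,2}_0(\Omega)$ with $\Delta u=-1$ in $\Omega$. (i) If $\Omega\subseteq\mathbb{R}^n$ is a bounded domain whose boundary has a finite upper $\gamma$-dimensional Minkowski content (with respect to $\Omega$), where $\gamma<n$, then $\int_\Omega u(x)^{-\beta}\,dx\le C(\Omega,\beta)<+\infty$ for any $\beta\in(0,(n-\gamma)/2)$. (ii) If $\Omega\subseteq\mathbb{R}^n$ is a bounded domain whose boundary is Ahlfors regular, then $\int_\Omega u(x)^{-\beta}\,dx\le C(\Omega,\beta)<+\infty$ for any $\beta\in(0,1/2)$ and moreover $$\int_\Omega u(x)^{-\beta}\,dx\le C\,\bigl[\mathcal{L}^n(\Omega)\bigr]^{1-2\beta}\bigl[\mathcal{H}^{n-1}(\partial\Omega)\bigr]^{2\beta}\le C\,\mathrm{diam}(\Omega)^{n-2\beta}\quad\text{if }\beta<1/2,$$ where $C$ depends only on the Ahlfors character of $\partial\Omega$, $n$ and $\beta$. (iii) As far as the displayed estimate in (ii) is concerned, the critical value $\beta=1/2$ is in the nature of best possible in the sense that for every $\beta\in(1/2,1)$ there exists a bounded domain $\Omega_\beta\subseteq\mathbb{R}^2$ which is regular for the Dirichlet problem and has an Ahlfors regular boundary, and with the property that if $u$ is the unique function in $W^{1,2}_0(\Omega_\beta)$ with $\Delta u=-1$ in $\Omega_\beta$, then $$\int_{\Omega_\beta}u(x)^{-\beta}\,dx=+\infty.$$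
   Context: $\mathcal{L}^n$ is Lebesgue measure, $\mathcal{H}^{n-1}$ is Hausdorff measure, $\delta_\Omega(x)=\mathrm{dist}(x,\partial\Omega)$. The same letter $C$ may denote constants with different values at different occurrences. The upper $\gamma$-dimensional Minkowski content of $\partial\Omega$ with respect to $\Omega$ is $M^*_\gamma(\partial\Omega):=\limsup_{r\to0^+}\frac{|\{x\in\Omega:\delta_\Omega(x)<r\}|}{r^{n-\gamma}}$. A set $\Sigma\subseteq\mathbb{R}^n$ is Ahlfors regular if there exist finite constants $C_0,C_1>0$ as well as a number $R>0$ such that $C_0r^{n-1}\le\mathcal{H}^{n-1}(B(x,r)\cap\Sigma)\le C_1r^{n-1}$ for all $x\in\Sigma$ and $r\in(0,R)$. The triplet $C_0,C_1,R$ makes up the Ahlfors character of $\Sigma$. $\Omega$ is regular for the Dirichlet problem if the classical Dirichlet problem for the Laplacian is well-posed in the class of continuous functions.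
   Formalization: In (ii) the constants C depend on C0, C1, n, β and an upper bound K for diam(Ω)/R; with C0, C1, R alone the estimate fails for n ≥ 2 (a large ball with unit balls at lattice points removed). *)

theory Defs
  imports "HOL-Analysis.Analysis"
begin

definition bounded_domain :: "'a::euclidean_space set \<Rightarrow> bool" where
  "bounded_domain \<Omega> \<longleftrightarrow> open \<Omega> \<and> connected \<Omega> \<and> bounded \<Omega> \<and> \<Omega> \<noteq> {}"

definition boundary_dist :: "'a::euclidean_space set \<Rightarrow> 'a \<Rightarrow> real" where
  "boundary_dist \<Omega> x = infdist x (frontier \<Omega>)"

definition partial :: "'a::euclidean_space \<Rightarrow> ('a \<Rightarrow> real) \<Rightarrow> 'a \<Rightarrow> real" where
  "partial b f x = frechet_derivative f (at x) b"

(* Only meant for open S. A list bs of basis vectors encodes the iterated partial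
   derivative foldr partial bs f, of order length bs. *)
definition C_k_on :: "nat \<Rightarrow> ('a::euclidean_space \<Rightarrow> real) \<Rightarrow> 'a set \<Rightarrow> bool" where
  "C_k_on k f S \<longleftrightarrow>
     (\<forall>bs. set bs \<subseteq> Basis \<and> length bs \<le> k \<longrightarrow>
        continuous_on S (foldr partial bs f) \<and>
        (length bs < k \<longrightarrow> (\<forall>x\<in>S. foldr partial bs f differentiable (at x))))"

definition gradient :: "('a::euclidean_space \<Rightarrow> real) \<Rightarrow> 'a \<Rightarrow> 'a" where
  "gradient f x = (\<Sum>b\<in>Basis. partial b f x *\<^sub>R b)"

definition laplacian :: "('a::euclidean_space \<Rightarrow> real) \<Rightarrow> 'a \<Rightarrow> real" where
  "laplacian f x = (\<Sum>b\<in>Basis. partial b (partial b f) x)"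

definition harmonic_on :: "('a::euclidean_space \<Rightarrow> real) \<Rightarrow> 'a set \<Rightarrow> bool" where
  "harmonic_on f \<Omega> \<longleftrightarrow> C_k_on 2 f \<Omega> \<and> (\<forall>x\<in>\<Omega>. laplacian f x = 0)"

definition solves_dirichlet ::
  "'a::euclidean_space set \<Rightarrow> ('a \<Rightarrow> real) \<Rightarrow> ('a \<Rightarrow> real) \<Rightarrow> bool" where
  "solves_dirichlet \<Omega> f v \<longleftrightarrow>
     continuous_on (closure \<Omega>) v \<and> harmonic_on v \<Omega> \<and> (\<forall>x\<in>frontier \<Omega>. v x = f x)"

definition dirichlet_regular :: "'a::euclidean_space set \<Rightarrow> bool" where
  "dirichlet_regular \<Omega> \<longleftrightarrow>
     (\<forall>f. continuous_on (frontier \<Omega>) f \<longrightarrow>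
        (\<exists>v. solves_dirichlet \<Omega> f v \<and>
             (\<forall>w. solves_dirichlet \<Omega> f w \<longrightarrow> (\<forall>x\<in>closure \<Omega>. w x = v x))))"

definition test_function :: "'a::euclidean_space set \<Rightarrow> ('a \<Rightarrow> real) \<Rightarrow> bool" where
  "test_function \<Omega> \<phi> \<longleftrightarrow>
     (\<forall>k. C_k_on k \<phi> UNIV) \<and> compact (closure {x. \<phi> x \<noteq> 0}) \<and> closure {x. \<phi> x \<noteq> 0} \<subseteq> \<Omega>"

definition square_integrable_on ::
  "'a::euclidean_space set \<Rightarrow> ('a \<Rightarrow> 'b::euclidean_space) \<Rightarrow> bool" where
  "square_integrable_on \<Omega> f \<longleftrightarrow>
     f \<in> borel_measurable (lebesgue_on \<Omega>) \<and> integrable (lebesgue_on \<Omega>) (\<lambda>x. (norm (f x))\<^sup>2)"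

definition has_weak_gradient ::
  "'a::euclidean_space set \<Rightarrow> ('a \<Rightarrow> real) \<Rightarrow> ('a \<Rightarrow> 'a) \<Rightarrow> bool" where
  "has_weak_gradient \<Omega> u g \<longleftrightarrow>
     (\<forall>\<phi>. test_function \<Omega> \<phi> \<longrightarrow>
        (\<forall>b\<in>Basis. (LINT x|lebesgue_on \<Omega>. u x * partial b \<phi> x)
                   = - (LINT x|lebesgue_on \<Omega>. (g x \<bullet> b) * \<phi> x)))"

(* The closure of the test functions in W^{1,2}(\<Omega>); elements are represented by functions on the
   whole space of which only the values a.e. in \<Omega> matter. *)
definition sobolev_W12_0 :: "'a::euclidean_space set \<Rightarrow> ('a \<Rightarrow> real) \<Rightarrow> bool" where
  "sobolev_W12_0 \<Omega> u \<longleftrightarrow>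
     (\<exists>g. square_integrable_on \<Omega> u \<and> square_integrable_on \<Omega> g \<and> has_weak_gradient \<Omega> u g \<and>
        (\<exists>\<phi>. (\<forall>k::nat. test_function \<Omega> (\<phi> k)) \<and>
             (\<lambda>k. LINT x|lebesgue_on \<Omega>. (\<phi> k x - u x)\<^sup>2) \<longlonglongrightarrow> 0 \<and>
             (\<lambda>k. LINT x|lebesgue_on \<Omega>. (norm (gradient (\<phi> k) x - g x))\<^sup>2) \<longlonglongrightarrow> 0))"

(* u lies in W_0^{1,2}(\<Omega>), and its Laplacian in the sense of distributions is -1 in \<Omega> *)
definition torsion_function :: "'a::euclidean_space set \<Rightarrow> ('a \<Rightarrow> real) \<Rightarrow> bool" where
  "torsion_function \<Omega> u \<longleftrightarrow>
     sobolev_W12_0 \<Omega> u \<and>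
     (\<forall>\<phi>. test_function \<Omega> \<phi> \<longrightarrow>
        (LINT x|lebesgue_on \<Omega>. u x * laplacian \<phi> x) = (LINT x|lebesgue_on \<Omega>. - \<phi> x))"

(* The integral of u^{-\<beta>} over \<Omega> for \<beta> > 0. In Isabelle 0 powr (-\<beta>) = 0, so the value \<infinity> of
   u^{-\<beta>} at zeros of u has to be given explicitly. *)
definition neg_power_integral :: "'a::euclidean_space set \<Rightarrow> ('a \<Rightarrow> real) \<Rightarrow> real \<Rightarrow> ennreal" where
  "neg_power_integral \<Omega> u \<beta> =
     (\<integral>\<^sup>+x. (if 0 < u x then ennreal (u x powr (- \<beta>)) else \<infinity>) \<partial>lebesgue_on \<Omega>)"

definition upper_minkowski_content :: "real \<Rightarrow> 'a::euclidean_space set \<Rightarrow> ennreal" where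
  "upper_minkowski_content \<gamma> \<Omega> =
     Limsup (at_right 0)
       (\<lambda>r. emeasure lebesgue {x\<in>\<Omega>. boundary_dist \<Omega> x < r} / ennreal (r powr (real DIM('a) - \<gamma>)))"

(* The k-dimensional Hausdorff measure, normalised so that it agrees with Lebesgue measure for
   k = DIM('a). A nonempty set contributes (diam/2)^k, which is 1 for k = 0; the empty set
   contributes 0 for every k. Boundedness is required since diameter is
   unspecified on unbounded sets. *)
definition hausdorff_premeasure ::
  "nat \<Rightarrow> real \<Rightarrow> 'a::euclidean_space set \<Rightarrow> ennreal" where
  "hausdorff_premeasure k \<epsilon> E =
     (INF U \<in> {U :: nat \<Rightarrow> 'a set. E \<subseteq> (\<Union>i. U i) \<and> (\<forall>i. bounded (U i) \<and> diameter (U i) \<le> \<epsilon>)}.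
        (\<Sum>i. if U i = {} then 0
              else ennreal (unit_ball_vol (real k) * (diameter (U i) / 2) ^ k)))"

definition hausdorff_measure :: "nat \<Rightarrow> 'a::euclidean_space set \<Rightarrow> ennreal" where
  "hausdorff_measure k E = (SUP \<epsilon> \<in> {0<..}. hausdorff_premeasure k \<epsilon> E)"

(* "C depends only on the Ahlfors character of the boundary" has to be read scale-invariantly: C
   depends on C0, C1 and an upper bound K for diam \<Omega> / R. With no bound on diam \<Omega> / R no such C
   exists in dimension at least 2: take a large ball from which unit balls centred at the points
   of a lattice are removed. The bound K imposes nothing on an individual domain. If R \<ge> diam \<Omega>,
   then K = 1 will do and C depends on C0, C1 (and the dimension and exponent) alone. *)
definition has_ahlfors_character ::
  "real \<Rightarrow> real \<Rightarrow> real \<Rightarrow> 'a::euclidean_space set \<Rightarrow> bool" where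
  "has_ahlfors_character C0 C1 R \<Sigma> \<longleftrightarrow>
     C0 > 0 \<and> C1 > 0 \<and> R > 0 \<and>
     (\<forall>x\<in>\<Sigma>. \<forall>r\<in>{0<..<R}.
        ennreal (C0 * r ^ (DIM('a) - 1)) \<le> hausdorff_measure (DIM('a) - 1) (ball x r \<inter> \<Sigma>) \<and>
        hausdorff_measure (DIM('a) - 1) (ball x r \<inter> \<Sigma>) \<le> ennreal (C1 * r ^ (DIM('a) - 1)))"

definition ahlfors_regular :: "'a::euclidean_space set \<Rightarrow> bool" where
  "ahlfors_regular \<Sigma> \<longleftrightarrow> (\<exists>C0 C1 R. has_ahlfors_character C0 C1 R \<Sigma>)"

end

theory Submission
  imports Defs
begin

text \<open>
  The function \<open>u\<close> is obtained by minimising the Dirichlet energy over test functions; the infimum is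
  attained in the limit by the Poincare inequality and the completeness of \<open>L\<^sup>2\<close>. All comparisons rest
  on testing the equation with a smooth truncation of \<open>\<phi> - W\<close>, where the test functions \<open>\<phi>\<close>
  approximate \<open>u\<close> and \<open>W\<close> is smooth with \<open>\<Delta>W \<le> -1\<close>. Comparing with paraboloids
  in balls gives \<open>u \<ge> \<delta>\<^sup>2 / (16 n)\<close> for the distance \<open>\<delta>\<close> to the boundary, so that (i) and (ii) reduce to
  bounds on the measure of the layers \<open>{\<delta> < r}\<close>. These are the hypothesis in (i), and for an Ahlfors
  regular boundary they follow by counting the points of a maximal \<open>r\<close>-separated subset of the boundary.

  For (iii), consider the cusp \<open>0 < x < 1\<close>, \<open>0 < y < g(x)\<close> with \<open>g(x) = x\<^sup>l (1 - x) / l\<^sup>2\<close>. The polynomial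
  \<open>W = y (g(x) - y)\<close> vanishes on the boundary and satisfies \<open>\<Delta>W \<le> -1\<close>. Hence \<open>u \<le> W \<le> g\<^sup>2\<close>, and the integral of
  \<open>u\<close> to the power \<open>-\<beta>\<close> is at least that of \<open>g\<close> to the power \<open>1 - 2 \<beta>\<close>, which diverges for large \<open>l\<close>.
  The same \<open>W\<close> is a barrier at every boundary point: for polynomial boundary data \<open>f\<close> the weak solution of
  \<open>\<Delta>z = - \<Delta>f\<close> is bounded by a multiple of \<open>W\<close>, so \<open>f + z\<close>, which is smooth by Weyl's lemma, solves
  the Dirichlet problem. Continuous data are approximated uniformly by polynomials, and the maximum
  principle carries the approximation over to the solutions.
\<close>

subsection \<open>Smooth functions\<close>

text \<open>The boundary is an arbitrary compact set, so \<open>u\<close> has no pointwise boundary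
  values; all that is known is that test functions approximate \<open>u\<close>. Hence the
  comparison principle is proved for the test functions and passed to the limit, and it yields
  inequalities almost everywhere only. The exponents come from two facts: \<open>u\<close> is at
  least a multiple of \<delta>^2, and {\<delta> < r} has measure at most a multiple of r^(n -
  \<gamma>), with \<gamma> = n - 1 in the Ahlfors case; so \<delta>^(-2 \<beta>) is integrable for 2
  \<beta> < n - \<gamma>. In (ii) the dyadic sum starts at the scale |\<Omega>| / H, where H is the
  measure of the boundary; this balances both contributions and produces the product in the
  estimate. In (iii) the integral of x^(l (1 - 2 \<beta>)) near 0 diverges once l (2 \<beta> - 1)
  \<ge> 1, which dictates \<open>l\<close>. Weyl's lemma is proved without spherical means: the
  derivative of a suitable mollifier in its scale is the Laplacian of a compactly supported
  function, so mollifying a weakly harmonic function gives values that do not depend on the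
  scale.\<close>

lemma partial_eqI:
  assumes "(f has_derivative f') (at x)"
  shows "partial b f x = f' b"
  using frechet_derivative_at[OF assms] by (simp add: partial_def)

text \<open>\<open>frechet_derivative\<close> is chosen from the relation
  \<open>has_derivative\<close>. At a point of an open set this relation is the same for both
  functions, so the chosen values agree even where no derivative exists.\<close>

lemma partial_cong:
  fixes f g :: "'a::euclidean_space \<Rightarrow> real"
  assumes "open S" "\<And>x. x \<in> S \<Longrightarrow> f x = g x" "x \<in> S"
  shows "partial b f x = partial b g x"
proof -
  have "(f has_derivative D) (at x) \<longleftrightarrow> (g has_derivative D) (at x)" for D
    using assms by (metis has_derivative_transform_within_open)
  then show ?thesis
    by (simp add: partial_def frechet_derivative_def)
qed

lemma differentiable_cong_open:
  fixes f g :: "'a::euclidean_space \<Rightarrow> real"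
  assumes "open S" "\<And>x. x \<in> S \<Longrightarrow> f x = g x" "x \<in> S" "g differentiable (at x)"
  shows "f differentiable (at x)"
  using assms unfolding differentiable_def by (metis has_derivative_transform_within_open)

lemma foldr_partial_cong:
  fixes f g :: "'a::euclidean_space \<Rightarrow> real"
  assumes "open S" "\<And>x. x \<in> S \<Longrightarrow> f x = g x" "x \<in> S"
  shows "foldr partial bs f x = foldr partial bs g x"
  using assms(3)
proof (induction bs arbitrary: x)
  case Nil
  then show ?case using assms by simp
next
  case (Cons b bs)
  show ?case
    using partial_cong[OF assms(1) Cons.IH Cons.prems] by simp
qed

lemma C_k_on_0: "C_k_on 0 f S \<longleftrightarrow> continuous_on S f"
  by (auto simp: C_k_on_def)

lemma C_k_on_Suc:
  "C_k_on (Suc k) f S \<longleftrightarrow>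
     continuous_on S f \<and> (\<forall>x\<in>S. f differentiable (at x)) \<and> (\<forall>b\<in>Basis. C_k_on k (partial b f) S)"
proof safe
  assume L: "C_k_on (Suc k) f S"
  show "continuous_on S f"
    using L[unfolded C_k_on_def, rule_format, of "[]"] by auto
  show "f differentiable (at x)" if "x \<in> S" for x
    using L[unfolded C_k_on_def, rule_format, of "[]"] that by auto
  show "C_k_on k (partial b f) S" if "b \<in> Basis" for b
    unfolding C_k_on_def
  proof (intro allI impI)
    fix bs :: "'a list" assume "set bs \<subseteq> Basis \<and> length bs \<le> k"
    then show "continuous_on S (foldr partial bs (partial b f)) \<and>
            (length bs < k \<longrightarrow> (\<forall>x\<in>S. foldr partial bs (partial b f) differentiable at x))"
      using L[unfolded C_k_on_def, rule_format, of "bs @ [b]"] that by auto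
  qed
next
  assume A: "continuous_on S f" "\<forall>x\<in>S. f differentiable (at x)" "\<forall>b\<in>Basis. C_k_on k (partial b f) S"
  show "C_k_on (Suc k) f S"
    unfolding C_k_on_def
  proof (intro allI impI)
    fix bs :: "'a list" assume B: "set bs \<subseteq> Basis \<and> length bs \<le> Suc k"
    show "continuous_on S (foldr partial bs f) \<and>
            (length bs < Suc k \<longrightarrow> (\<forall>x\<in>S. foldr partial bs f differentiable at x))"
    \<comment> \<open>\<open>foldr partial bs f\<close> differentiates first in the direction of the
      last element, so the innermost derivative of \<open>f\<close> is split off at the end of the
      list.\<close>
    proof (cases bs rule: rev_cases)
      case Nil
      then show ?thesis using A by auto
    next
      case (snoc cs b)
      then show ?thesis
        using A(3)[rule_format, of b, unfolded C_k_on_def, rule_format, of cs] B by auto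
    qed
  qed
qed

lemma C_k_on_cong:
  fixes f g :: "'a::euclidean_space \<Rightarrow> real"
  assumes "open S" "\<And>x. x \<in> S \<Longrightarrow> f x = g x" "C_k_on k g S"
  shows "C_k_on k f S"
  unfolding C_k_on_def
proof (intro allI impI conjI ballI)
  fix bs :: "'a list" assume B: "set bs \<subseteq> Basis \<and> length bs \<le> k"
  have eq: "foldr partial bs f x = foldr partial bs g x" if "x \<in> S" for x
    using foldr_partial_cong[OF assms(1,2) that] .
  show "continuous_on S (foldr partial bs f)"
    using assms(3)[unfolded C_k_on_def, rule_format, OF B] eq by (simp cong: continuous_on_cong)
  show "foldr partial bs f differentiable at x" if "length bs < k" "x \<in> S" for x
    using assms(3)[unfolded C_k_on_def, rule_format, OF B] that
      differentiable_cong_open[OF assms(1) eq that(2)] by auto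
qed

lemma C_k_on_mono_order: "C_k_on k f S \<Longrightarrow> j \<le> k \<Longrightarrow> C_k_on j f S"
  unfolding C_k_on_def by force

lemma C_k_on_subset: "C_k_on k f S \<Longrightarrow> T \<subseteq> S \<Longrightarrow> C_k_on k f T"
  unfolding C_k_on_def by (meson continuous_on_subset subsetD)

lemma partial_add:
  assumes "f differentiable (at x)" "g differentiable (at x)"
  shows "partial b (\<lambda>x. f x + g x) x = partial b f x + partial b g x"
  using partial_eqI[OF has_derivative_add[OF assms[unfolded frechet_derivative_works]]]
  by (simp add: partial_def)

lemma partial_mult:
  fixes f g :: "'a::euclidean_space \<Rightarrow> real"
  assumes "f differentiable (at x)" "g differentiable (at x)"
  shows "partial b (\<lambda>x. f x * g x) x = f x * partial b g x + partial b f x * g x"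
  using partial_eqI[OF has_derivative_mult[OF assms[unfolded frechet_derivative_works]]]
  by (simp add: partial_def)

lemma partial_const [simp]: "partial b (\<lambda>x. c) = (\<lambda>x. 0)"
  using partial_eqI[OF has_derivative_const] by fastforce

lemma partial_inner [simp]: "partial b (\<lambda>x. x \<bullet> c) = (\<lambda>x. b \<bullet> c)"
proof
  fix x show "partial b (\<lambda>x. x \<bullet> c) x = b \<bullet> c"
    by (rule partial_eqI) (auto intro!: derivative_eq_intros)
qed

lemma has_derivative_compose_real:
  fixes f :: "'a::euclidean_space \<Rightarrow> real"
  assumes "f differentiable (at x)" "(h has_real_derivative d) (at (f x))"
  shows "((\<lambda>x. h (f x)) has_derivative (\<lambda>y. d * frechet_derivative f (at x) y)) (at x)"
  using has_derivative_compose[OF assms(1)[unfolded frechet_derivative_works]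
     assms(2)[unfolded has_field_derivative_def]] .

lemma partial_compose:
  fixes f :: "'a::euclidean_space \<Rightarrow> real"
  assumes "f differentiable (at x)" "(h has_real_derivative d) (at (f x))"
  shows "partial b (\<lambda>x. h (f x)) x = d * partial b f x"
  using partial_eqI[OF has_derivative_compose_real[OF assms]] by (simp add: partial_def)

lemma C_k_on_add:
  assumes "open S" "C_k_on k f S" "C_k_on k g S"
  shows "C_k_on k (\<lambda>x. f x + g x) S"
  using assms(2,3)
proof (induction k arbitrary: f g)
  case 0
  then show ?case by (simp add: C_k_on_0 continuous_on_add)
next
  case (Suc k)
  have "C_k_on k (partial b (\<lambda>x. f x + g x)) S" if "b \<in> Basis" for b
  proof (rule C_k_on_cong[OF assms(1)])
    show "C_k_on k (\<lambda>x. partial b f x + partial b g x) S"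
      using Suc that by (auto simp: C_k_on_Suc)
  qed (use Suc.prems in \<open>auto simp: C_k_on_Suc intro!: partial_add\<close>)
  then show ?case
    using Suc.prems by (auto simp: C_k_on_Suc intro: continuous_on_add)
qed

lemma C_k_on_mult:
  fixes f g :: "'a::euclidean_space \<Rightarrow> real"
  assumes "open S" "C_k_on k f S" "C_k_on k g S"
  shows "C_k_on k (\<lambda>x. f x * g x) S"
  using assms(2,3)
proof (induction k arbitrary: f g)
  case 0
  then show ?case by (simp add: C_k_on_0 continuous_on_mult)
next
  case (Suc k)
  have "C_k_on k f S" "C_k_on k g S"
    using Suc.prems C_k_on_mono_order by (metis lessI less_imp_le)+
  then have "C_k_on k (\<lambda>x. f x * partial b g x + partial b f x * g x) S" if "b \<in> Basis" for b
    using Suc that by (auto simp: C_k_on_Suc intro!: C_k_on_add[OF assms(1)])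
  then have "C_k_on k (partial b (\<lambda>x. f x * g x)) S" if "b \<in> Basis" for b
    using that Suc.prems by (intro C_k_on_cong[OF assms(1) partial_mult]) (auto simp: C_k_on_Suc)
  then show ?case
    using Suc.prems by (auto simp: C_k_on_Suc intro: continuous_on_mult)
qed

text \<open>The sequence \<open>h\<close> lists a function together with all its derivatives. The
  chain rule replaces \<open>h j\<close> by \<open>h (Suc j)\<close>, so the induction over
  \<open>k\<close> has to leave \<open>j\<close> free.\<close>

lemma C_k_on_compose:
  fixes f :: "'a::euclidean_space \<Rightarrow> real" and h :: "nat \<Rightarrow> real \<Rightarrow> real"
  assumes "open S" "C_k_on k f S" "\<And>j t. (h j has_real_derivative h (Suc j) t) (at t)"
  shows "C_k_on k (\<lambda>x. h j (f x)) S"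
  using assms(2)
proof (induction k arbitrary: f j)
  case 0
  have "continuous_on UNIV (h j)"
    using assms(3) DERIV_isCont continuous_at_imp_continuous_on by blast
  then show ?case using 0
    by (auto simp: C_k_on_0 intro!: continuous_on_compose2[of UNIV "h j"])
next
  case (Suc k)
  have f: "C_k_on k f S"
    using Suc.prems C_k_on_mono_order by (metis lessI less_imp_le)
  have fd: "\<And>x. x \<in> S \<Longrightarrow> f differentiable (at x)"
    using Suc.prems by (simp add: C_k_on_Suc)
  have "continuous_on UNIV (h j)"
    using assms(3) DERIV_isCont continuous_at_imp_continuous_on by blast
  then have 1: "continuous_on S (\<lambda>x. h j (f x))"
    using Suc.prems by (auto simp: C_k_on_Suc intro!: continuous_on_compose2[of UNIV "h j"])
  have 2: "(\<lambda>x. h j (f x)) differentiable (at x)" if "x \<in> S" for x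
    using has_derivative_compose_real[OF fd[OF that] assms(3)] differentiableI by blast
  have "C_k_on k (partial b (\<lambda>x. h j (f x))) S" if "b \<in> Basis" for b
  proof (rule C_k_on_cong[OF assms(1)])
    show "partial b (\<lambda>x. h j (f x)) x = h (Suc j) (f x) * partial b f x" if "x \<in> S" for x
      using partial_compose[OF fd[OF that] assms(3)] .
    show "C_k_on k (\<lambda>x. h (Suc j) (f x) * partial b f x) S"
      using Suc that f by (auto simp: C_k_on_Suc intro!: C_k_on_mult[OF assms(1)])
  qed
  then show ?case using 1 2 by (simp add: C_k_on_Suc)
qed

lemma differentiable_at_imp_continuous_on_UNIV:
  fixes f :: "'a::euclidean_space \<Rightarrow> real"
  assumes "\<And>x. f differentiable (at x)"
  shows "continuous_on UNIV f"
  using assms by (intro differentiable_imp_continuous_on) (auto simp: differentiable_on_def)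

definition smooth :: "('a::euclidean_space \<Rightarrow> real) \<Rightarrow> bool" where
  "smooth f \<longleftrightarrow> (\<forall>k. C_k_on k f UNIV)"

text \<open>Induction on the order of differentiation never leaves the class \<open>P\<close>. This
  serves for families given by a formula, such as linear forms, reflections and
  convolutions.\<close>

lemma smooth_coinduct:
  assumes "P f"
    and "\<And>f x. P f \<Longrightarrow> f differentiable (at x)" "\<And>f b. P f \<Longrightarrow> b \<in> Basis \<Longrightarrow> P (partial b f)"
  shows "smooth f"
proof -
  have "C_k_on k f UNIV" if "P f" for k f
    using that
  proof (induction k arbitrary: f)
    case 0
    then show ?case using assms(2)
      by (auto simp: C_k_on_0 intro: differentiable_at_imp_continuous_on_UNIV)
  next
    case (Suc k)
    then show ?case using assms(2,3)
      by (auto simp: C_k_on_Suc intro: differentiable_at_imp_continuous_on_UNIV)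
  qed
  then show ?thesis using assms(1) by (simp add: smooth_def)
qed

lemma smooth_imp:
  assumes "smooth f"
  shows smooth_differentiable: "f differentiable (at x)"
    and smooth_partial: "b \<in> Basis \<Longrightarrow> smooth (partial b f)"
    and smooth_continuous: "continuous_on S f"
  using assms C_k_on_Suc unfolding smooth_def by (blast intro: continuous_on_subset)+

lemma smooth_const [simp]: "smooth (\<lambda>x. c)"
  by (rule smooth_coinduct[where P="\<lambda>f. \<exists>c. f = (\<lambda>x. c)"]) auto

lemma smooth_inner: "smooth (\<lambda>x. x \<bullet> c)"
  by (rule smooth_coinduct[where P="\<lambda>f. (\<exists>c. f = (\<lambda>x. c)) \<or> (\<exists>c. f = (\<lambda>x. x \<bullet> c))"])
     (auto intro: derivative_intros bounded_linear_imp_differentiable bounded_linear_inner_left)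

lemma smooth_add: "smooth f \<Longrightarrow> smooth g \<Longrightarrow> smooth (\<lambda>x. f x + g x)"
  by (simp add: smooth_def C_k_on_add)

lemma smooth_mult: "smooth f \<Longrightarrow> smooth g \<Longrightarrow> smooth (\<lambda>x. f x * g x)"
  by (simp add: smooth_def C_k_on_mult)

lemma smooth_cmult: "smooth f \<Longrightarrow> smooth (\<lambda>x. c * f x)"
  by (simp add: smooth_mult)

lemma smooth_diff: "smooth f \<Longrightarrow> smooth g \<Longrightarrow> smooth (\<lambda>x. f x - g x)"
  using smooth_add[of f "\<lambda>x. -1 * g x"] smooth_cmult[of g "-1"] by simp

lemma smooth_minus: "smooth f \<Longrightarrow> smooth (\<lambda>x. - f x)"
  using smooth_cmult[of f "-1"] by simp

lemma smooth_sum: "(\<And>i. i \<in> I \<Longrightarrow> smooth (f i)) \<Longrightarrow> smooth (\<lambda>x. \<Sum>i\<in>I. f i x)"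
  by (induction I rule: infinite_finite_induct) (auto intro: smooth_add)

lemma smooth_power: "smooth f \<Longrightarrow> smooth (\<lambda>x. f x ^ n)"
  by (induction n) (auto intro: smooth_mult)

lemma smooth_compose:
  assumes "smooth f" "\<And>j t. (h j has_real_derivative h (Suc j) t) (at t)"
  shows "smooth (\<lambda>x. h j (f x))"
  using assms by (simp add: smooth_def C_k_on_compose)

text \<open>Meant for functions defined by cases, such as the truncation in
  \<open>comparison\<close>, which is extended by zero across the boundary.\<close>

lemma smooth_local:
  fixes f :: "'a::euclidean_space \<Rightarrow> real"
  assumes "\<And>x. \<exists>U g. open U \<and> x \<in> U \<and> smooth g \<and> (\<forall>y\<in>U. f y = g y)"
  shows "smooth f"
proof -
  define P where "P f \<longleftrightarrow> (\<forall>x. \<exists>U g. open U \<and> x \<in> U \<and> smooth g \<and> (\<forall>y\<in>U. f y = g y))"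
    for f :: "'a \<Rightarrow> real"
  have "P f" using assms by (simp add: P_def)
  then show ?thesis
  proof (rule smooth_coinduct[of P])
    fix f :: "'a \<Rightarrow> real" and x
    assume "P f"
    then obtain U g where "open U" "x \<in> U" "smooth g" "\<forall>y\<in>U. f y = g y"
      unfolding P_def by blast
    then show "f differentiable (at x)"
      using differentiable_cong_open[of U f g x] smooth_differentiable by blast
  next
    fix f :: "'a \<Rightarrow> real" and b :: 'a
    assume "P f" "b \<in> Basis"
    show "P (partial b f)"
      unfolding P_def
    proof
      fix x
      obtain U g where U: "open U" "x \<in> U" "smooth g" "\<forall>y\<in>U. f y = g y"
        using \<open>P f\<close> unfolding P_def by blast
      then have "\<forall>y\<in>U. partial b f y = partial b g y"
        using partial_cong[of U f g] by blast
      then show "\<exists>U g. open U \<and> x \<in> U \<and> smooth g \<and> (\<forall>y\<in>U. partial b f y = g y)"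
        using U smooth_partial[OF U(3) \<open>b \<in> Basis\<close>] by blast
    qed
  qed
qed

subsection \<open>A smooth truncation\<close>

text \<open>All derivatives of exp(-1/t) on t > 0 are of this form; the polynomial factor closes the
  family under differentiation.\<close>

definition flat :: "real poly \<Rightarrow> real \<Rightarrow> real" where
  "flat p t = (if 0 < t then poly p (1/t) * exp (- 1/t) else 0)"

lemma poly_exp_tendsto_0: "((\<lambda>s. poly p s * exp (- s)) \<longlongrightarrow> (0::real)) at_top"
proof -
  have "((\<lambda>s. \<Sum>i\<le>degree p. coeff p i * (s ^ i / exp s)) \<longlongrightarrow> (\<Sum>i\<le>degree p. coeff p i * 0)) at_top"
    by (intro tendsto_sum tendsto_mult tendsto_const tendsto_power_div_exp_0)
  moreover have "(\<Sum>i\<le>degree p. coeff p i * (s ^ i / exp s)) = poly p s * exp (- s)" for s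
    by (simp add: poly_altdef sum_distrib_right exp_minus divide_inverse mult.assoc)
  ultimately show ?thesis by simp
qed

lemma flat_tendsto_0: "(flat p \<longlongrightarrow> 0) (at 0)"
proof -
  have "((\<lambda>t. poly p (inverse t) * exp (- inverse t)) \<longlongrightarrow> 0) (at_right (0::real))"
    using filterlim_compose[OF poly_exp_tendsto_0 filterlim_inverse_at_top_right] .
  then have 1: "(flat p \<longlongrightarrow> 0) (at_right 0)"
    by (rule Lim_transform_eventually) (auto simp: eventually_at_filter flat_def divide_inverse)
  have 2: "(flat p \<longlongrightarrow> 0) (at_left 0)"
    by (rule Lim_transform_eventually[OF tendsto_const]) (auto simp: eventually_at_filter flat_def)
  show ?thesis using 1 2 by (simp add: filterlim_at_split)
qed

text \<open>With s = 1/t one has ds/dt = -s^2, so the derivative of p(s) exp(-s) is s^2 (p - p')(s)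
  exp(-s); the factor \<open>[:0,0,1:]\<close> is s^2.\<close>

lemma flat_has_derivative:
  "(flat p has_real_derivative flat ([:0,0,1:] * (p - pderiv p)) t) (at t)"
proof -
  consider "t < 0" | "t > 0" | "t = 0" by linarith
  then show ?thesis
  proof cases
    case 1
    have "((\<lambda>t. 0) has_real_derivative 0) (at t)" by simp
    then have "(flat p has_real_derivative 0) (at t)"
      by (rule has_field_derivative_transform_within_open[of _ _ _ "{..<0}"])
         (use 1 in \<open>auto simp: flat_def\<close>)
    then show ?thesis using 1 by (simp add: flat_def)
  next
    case 2
    have "((\<lambda>t. poly p (1/t) * exp (- 1/t)) has_real_derivative
        flat ([:0,0,1:] * (p - pderiv p)) t) (at t)"
      using 2 unfolding flat_def
      by (auto intro!: derivative_eq_intros simp: field_simps power2_eq_square)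
    then show ?thesis
      by (rule has_field_derivative_transform_within_open[of _ _ _ "{0<..}"])
         (use 2 in \<open>auto simp: flat_def\<close>)
  next
    case 3
    \<comment> \<open>At 0 the difference quotient is again a flat function: division by h
      multiplies the polynomial in 1/h by its variable. Its limit is 0.\<close>
    have "(\<lambda>h. (flat p (0 + h) - flat p 0) / h) = flat ([:0,1:] * p)"
      by (auto simp: flat_def fun_eq_iff)
    then show ?thesis
      using flat_tendsto_0[of "[:0,1:] * p"] 3 by (simp add: DERIV_def flat_def)
  qed
qed

text \<open>\<open>hk j\<close> is the j-th derivative of the function that equals exp(-1/t) for t >
  0 and 0 otherwise. The whole sequence is kept because \<open>smooth_compose\<close> asks for
  it.\<close>

definition hk :: "nat \<Rightarrow> real \<Rightarrow> real" where
  "hk j = flat (((\<lambda>p. [:0,0,1:] * (p - pderiv p)) ^^ j) 1)"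

lemma hk_deriv: "(hk j has_real_derivative hk (Suc j) t) (at t)"
  using flat_has_derivative by (simp add: hk_def)

lemma hk_0: "hk 0 t = (if 0 < t then exp (- 1/t) else 0)"
  by (simp add: hk_def flat_def)

lemma hk_1: "hk (Suc 0) t = (if 0 < t then exp (- 1/t) / t\<^sup>2 else 0)"
  by (simp add: hk_def flat_def power2_eq_square)

lemma hk_nonpos [simp]: "t \<le> 0 \<Longrightarrow> hk j t = 0"
  by (simp add: hk_def flat_def)

lemma hk_0_eq_0_iff: "hk 0 t = 0 \<longleftrightarrow> t \<le> 0"
  by (simp add: hk_0)

lemma hk_0_nonneg: "0 \<le> hk 0 t"
  by (simp add: hk_0)

lemma hk_1_nonneg: "0 \<le> hk (Suc 0) t"
  by (simp add: hk_1)

text \<open>With s = 1/t the claim is s^2 \<le> 2 exp s, which the quadratic Taylor polynomial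
  gives. This 2 is the Lipschitz constant of the truncation and the factor 2 in the energy estimate
  of \<open>comparison\<close>.\<close>

lemma hk_1_le: "hk (Suc 0) t \<le> 2"
proof (cases "0 < t")
  case True
  have "1 + 1/t + (1/t)\<^sup>2/2 \<le> exp (1/t)"
    using True by (intro exp_lower_Taylor_quadratic) auto
  moreover have "0 < 1/t" using True by simp
  ultimately have "(1/t)\<^sup>2 \<le> 2 * exp (1/t)" by linarith
  then have "(1/t)\<^sup>2 * exp (- 1/t) \<le> 2 * exp (1/t) * exp (-1/t)"
    by (intro mult_right_mono) auto
  also have "\<dots> = 2" by (simp add: exp_minus)
  finally show ?thesis using True by (simp add: hk_1 field_simps)
qed (simp add: hk_1)

lemma hk_0_lipschitz: "\<bar>hk 0 s - hk 0 t\<bar> \<le> 2 * \<bar>s - t\<bar>"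
proof -
  have "norm (hk 0 s - hk 0 t) \<le> 2 * norm (s - t)"
  proof (rule differentiable_bound[of UNIV])
    show "(hk 0 has_derivative (\<lambda>x. hk (Suc 0) t * x)) (at t within UNIV)" for t
      using hk_deriv[of 0 t] by (simp add: has_field_derivative_def)
    show "onorm (\<lambda>x. hk (Suc 0) t * x) \<le> 2" for t
      by (rule onorm_bound) (use hk_1_nonneg[of t] hk_1_le[of t] in \<open>auto simp: abs_mult mult_right_mono\<close>)
  qed auto
  then show ?thesis by simp
qed

lemma smooth_hk: "smooth f \<Longrightarrow> smooth (\<lambda>x. hk j (f x))"
  by (rule smooth_compose[where h=hk]) (auto intro: hk_deriv)

subsection \<open>Square integrable functions\<close>

text \<open>Values lie in any Euclidean space, so that the same facts serve a function and its
  gradient.\<close>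

definition sqi :: "'a measure \<Rightarrow> ('a \<Rightarrow> 'b::euclidean_space) \<Rightarrow> bool" where
  "sqi M f \<longleftrightarrow> f \<in> borel_measurable M \<and> integrable M (\<lambda>x. (norm (f x))\<^sup>2)"

definition l2 :: "'a measure \<Rightarrow> ('a \<Rightarrow> 'b::euclidean_space) \<Rightarrow> real" where
  "l2 M f = sqrt (LINT x|M. (norm (f x))\<^sup>2)"

lemma sqi_borel: "sqi M f \<Longrightarrow> f \<in> borel_measurable M"
  by (simp add: sqi_def)

lemma l2_nonneg [simp]: "0 \<le> l2 M f"
  by (simp add: l2_def)

lemma l2_power2: "(l2 M f)\<^sup>2 = (LINT x|M. (norm (f x))\<^sup>2)"
  by (simp add: l2_def)

lemma sqi_integrable_inner:
  assumes f: "sqi M f" and g: "sqi M g"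
  shows "integrable M (\<lambda>x. f x \<bullet> g x)"
proof (rule Bochner_Integration.integrable_bound)
  show "integrable M (\<lambda>x. (norm (f x))\<^sup>2 + (norm (g x))\<^sup>2)"
    using f g by (simp add: sqi_def)
  show "(\<lambda>x. f x \<bullet> g x) \<in> borel_measurable M"
    using f[THEN sqi_borel] g[THEN sqi_borel] by simp
  have "\<bar>f x \<bullet> g x\<bar> \<le> (norm (f x))\<^sup>2 + (norm (g x))\<^sup>2" for x
    using Cauchy_Schwarz_ineq2[of "f x" "g x"] sum_squares_bound[of "norm (f x)" "norm (g x)"]
      mult_nonneg_nonneg[of "norm (f x)" "norm (g x)"] by simp
  then show "AE x in M. norm (f x \<bullet> g x) \<le> norm ((norm (f x))\<^sup>2 + (norm (g x))\<^sup>2)"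
    by simp
qed

lemma norm_add_power2: "(norm (a + b :: 'b::euclidean_space))\<^sup>2 = (norm a)\<^sup>2 + 2 * (a \<bullet> b) + (norm b)\<^sup>2"
  by (simp add: power2_norm_eq_inner inner_add inner_commute)

lemma sqi_add:
  assumes f: "sqi M f" and g: "sqi M g"
  shows "sqi M (\<lambda>x. f x + g x)"
  unfolding sqi_def norm_add_power2
  using sqi_integrable_inner[OF f g] f g by (auto simp: sqi_def)

lemma sqi_minus: "sqi M f \<Longrightarrow> sqi M (\<lambda>x. - f x)"
  by (auto simp: sqi_def)

lemma sqi_diff:
  assumes f: "sqi M f" and g: "sqi M g"
  shows "sqi M (\<lambda>x. f x - g x)"
  using sqi_add[OF f sqi_minus[OF g]] by simp

lemma l2_minus [simp]: "l2 M (\<lambda>x. - f x) = l2 M f"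
  by (simp add: l2_def)

lemma l2_commute: "l2 M (\<lambda>x. f x - g x) = l2 M (\<lambda>x. g x - f x)"
  by (simp add: l2_def norm_minus_commute)

text \<open>The discriminant criterion. It yields the Cauchy-Schwarz inequality and, with
  \<open>A = 0\<close>, the vanishing of the first variation at a minimum.\<close>

lemma quadratic_nonneg_imp:
  fixes A B P :: real
  assumes "0 \<le> B" "\<And>t. 0 \<le> A + 2 * t * P + t\<^sup>2 * B"
  shows "P\<^sup>2 \<le> A * B"
proof (cases "B = 0")
  case True
  have "P = 0"
  proof (rule ccontr)
    assume "P \<noteq> 0"
    then show False
      \<comment> \<open>For this t the value A + 2 t P is -1.\<close>
      using assms(2)[of "- (A + 1) / (2 * P)"] True by (simp add: field_simps)
  qed
  then show ?thesis using True by simp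
next
  case False
  then have "B > 0" using assms(1) by simp
  then show ?thesis
    \<comment> \<open>The minimum of the quadratic polynomial is attained at t = -P / B.\<close>
    using assms(2)[of "- P / B"] by (simp add: field_simps power2_eq_square)
qed

lemma l2_expand:
  assumes "sqi M f" "sqi M g"
  shows "(l2 M (\<lambda>x. f x + t *\<^sub>R g x))\<^sup>2 = (l2 M f)\<^sup>2 + 2 * t * (LINT x|M. f x \<bullet> g x) + t\<^sup>2 * (l2 M g)\<^sup>2"
proof -
  have "(l2 M (\<lambda>x. f x + t *\<^sub>R g x))\<^sup>2 = (LINT x|M. (norm (f x))\<^sup>2 + 2 * t * (f x \<bullet> g x) + t\<^sup>2 * (norm (g x))\<^sup>2)"
    unfolding l2_power2 norm_add_power2 by (simp add: power_mult_distrib mult.assoc)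
  also have "\<dots> = (l2 M f)\<^sup>2 + 2 * t * (LINT x|M. f x \<bullet> g x) + t\<^sup>2 * (l2 M g)\<^sup>2"
    using assms sqi_integrable_inner[OF assms] by (simp add: l2_power2 sqi_def)
  finally show ?thesis .
qed

lemma l2_Cauchy_Schwarz:
  assumes f: "sqi M f" and g: "sqi M g"
  shows "\<bar>LINT x|M. f x \<bullet> g x\<bar> \<le> l2 M f * l2 M g"
proof -
  have "(LINT x|M. f x \<bullet> g x)\<^sup>2 \<le> (l2 M f)\<^sup>2 * (l2 M g)\<^sup>2"
  proof (rule quadratic_nonneg_imp)
    fix t :: real
    show "0 \<le> (l2 M f)\<^sup>2 + 2 * t * (LINT x|M. f x \<bullet> g x) + t\<^sup>2 * (l2 M g)\<^sup>2"
      using l2_expand[OF f g, of t] by (metis zero_le_power2)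
  qed simp
  then have "\<bar>LINT x|M. f x \<bullet> g x\<bar>\<^sup>2 \<le> (l2 M f * l2 M g)\<^sup>2"
    by (simp add: power_mult_distrib)
  then show ?thesis
    by (rule power2_le_imp_le) simp
qed

lemma l2_triangle:
  assumes f: "sqi M f" and g: "sqi M g"
  shows "l2 M (\<lambda>x. f x + g x) \<le> l2 M f + l2 M g"
proof (rule power2_le_imp_le)
  have "(l2 M (\<lambda>x. f x + g x))\<^sup>2 = (l2 M f)\<^sup>2 + 2 * (LINT x|M. f x \<bullet> g x) + (l2 M g)\<^sup>2"
    using f g sqi_integrable_inner[OF f g] by (simp add: l2_power2 sqi_def norm_add_power2)
  also have "\<dots> \<le> (l2 M f + l2 M g)\<^sup>2"
    using l2_Cauchy_Schwarz[OF f g] by (simp add: power2_sum)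
  finally show "(l2 M (\<lambda>x. f x + g x))\<^sup>2 \<le> (l2 M f + l2 M g)\<^sup>2" .
qed simp

lemma l2_triangle_le:
  assumes "sqi M f" "sqi M g"
  shows "l2 M f \<le> l2 M g + l2 M (\<lambda>x. f x - g x)"
  using l2_triangle[OF assms(2) sqi_diff[OF assms]] by simp

lemma l2_mono:
  assumes "sqi M g" "f \<in> borel_measurable M" "0 \<le> c"
    and "\<And>x. x \<in> space M \<Longrightarrow> norm (f x) \<le> c * norm (g x)"
  shows "sqi M f" "l2 M f \<le> c * l2 M g"
proof -
  have le: "(norm (f x))\<^sup>2 \<le> c\<^sup>2 * (norm (g x))\<^sup>2" if "x \<in> space M" for x
    using power_mono[OF assms(4)[OF that], of 2] by (simp add: power_mult_distrib)
  have g: "integrable M (\<lambda>x. c\<^sup>2 * (norm (g x))\<^sup>2)"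
    using assms(1) by (auto simp: sqi_def)
  have f: "integrable M (\<lambda>x. (norm (f x))\<^sup>2)"
    by (rule Bochner_Integration.integrable_bound[OF g]) (use assms(2) le in \<open>auto intro!: AE_I2\<close>)
  then show "sqi M f" using assms(2) by (simp add: sqi_def)
  have "(LINT x|M. (norm (f x))\<^sup>2) \<le> (LINT x|M. c\<^sup>2 * (norm (g x))\<^sup>2)"
    by (rule integral_mono[OF f g le])
  then have "(l2 M f)\<^sup>2 \<le> (c * l2 M g)\<^sup>2"
    by (simp add: l2_power2 power_mult_distrib)
  then show "l2 M f \<le> c * l2 M g"
    by (rule power2_le_imp_le) (simp add: assms)
qed

lemma l2_eq_0_iff:
  assumes "sqi M f"
  shows "l2 M f = 0 \<longleftrightarrow> (AE x in M. f x = 0)"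
  using assms integral_nonneg_eq_0_iff_AE[of M "\<lambda>x. (norm (f x))\<^sup>2"] by (simp add: l2_def sqi_def)

lemma l2_tendsto_iff:
  "((\<lambda>k. LINT x|M. (norm (f k x))\<^sup>2) \<longlongrightarrow> 0) F \<longleftrightarrow> ((\<lambda>k. l2 M (f k)) \<longlongrightarrow> 0) F"
proof
  assume "((\<lambda>k. LINT x|M. (norm (f k x))\<^sup>2) \<longlongrightarrow> 0) F"
  from tendsto_real_sqrt[OF this] show "((\<lambda>k. l2 M (f k)) \<longlongrightarrow> 0) F"
    by (simp add: l2_def)
next
  assume "((\<lambda>k. l2 M (f k)) \<longlongrightarrow> 0) F"
  from tendsto_power[OF this, of 2] show "((\<lambda>k. LINT x|M. (norm (f k x))\<^sup>2) \<longlongrightarrow> 0) F"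
    by (simp add: l2_power2)
qed

lemma l2_inner_tendsto:
  assumes f: "\<And>k. sqi M (f k)" "sqi M g" "(\<lambda>k. l2 M (\<lambda>x. f k x - g x)) \<longlonglongrightarrow> 0" and h: "sqi M h"
  shows "(\<lambda>k. LINT x|M. f k x \<bullet> h x) \<longlonglongrightarrow> (LINT x|M. g x \<bullet> h x)"
proof -
  have "(\<lambda>k. (LINT x|M. f k x \<bullet> h x) - (LINT x|M. g x \<bullet> h x)) \<longlonglongrightarrow> 0"
  proof (rule Lim_null_comparison)
    show "(\<lambda>k. l2 M (\<lambda>x. f k x - g x) * l2 M h) \<longlonglongrightarrow> 0"
      using tendsto_mult_right[OF f(3)] by simp
    have "(LINT x|M. f k x \<bullet> h x) - (LINT x|M. g x \<bullet> h x) = (LINT x|M. (f k x - g x) \<bullet> h x)" for k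
      using f h by (simp add: inner_diff_left sqi_integrable_inner)
    then show "\<forall>\<^sub>F k in sequentially. norm ((LINT x|M. f k x \<bullet> h x) - (LINT x|M. g x \<bullet> h x))
        \<le> l2 M (\<lambda>x. f k x - g x) * l2 M h"
      using l2_Cauchy_Schwarz[OF sqi_diff[OF f(1) f(2)] h] by simp
  qed
  then show ?thesis by (simp add: LIM_zero_iff)
qed

text \<open>Cauchy-Schwarz against the constant 1. On a finite measure space convergence in L^2
  therefore implies convergence in L^1.\<close>

lemma (in finite_measure) sqi_integrable:
  fixes f :: "'a \<Rightarrow> 'b::euclidean_space"
  assumes "sqi M f"
  shows "integrable M f" "(LINT x|M. norm (f x)) \<le> l2 M f * sqrt (measure M (space M))"
proof -
  have n: "sqi M (\<lambda>x. norm (f x))" "sqi M (\<lambda>x. 1::real)"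
    using assms by (auto simp: sqi_def)
  show "integrable M f"
    using sqi_integrable_inner[OF n] assms by (simp add: sqi_borel flip: integrable_norm_iff)
  show "(LINT x|M. norm (f x)) \<le> l2 M f * sqrt (measure M (space M))"
    using l2_Cauchy_Schwarz[OF n] by (simp add: l2_def)
qed

text \<open>The Riesz-Fischer theorem. Along a subsequence whose increments are below (1/2)^k in
  L^2, finiteness of the measure makes their L^1 norms summable, so the subsequence converges almost
  everywhere. Fatou's lemma shows that the pointwise limit is also the L^2 limit.\<close>

lemma (in finite_measure) l2_complete:
  fixes f :: "nat \<Rightarrow> 'a \<Rightarrow> 'b::euclidean_space"
  assumes f: "\<And>k. sqi M (f k)"
    and cauchy: "\<And>e. e > 0 \<Longrightarrow> \<exists>N. \<forall>m\<ge>N. \<forall>n\<ge>N. l2 M (\<lambda>x. f m x - f n x) < e"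
  shows "\<exists>g. sqi M g \<and> (\<lambda>k. l2 M (\<lambda>x. f k x - g x)) \<longlonglongrightarrow> 0"
proof -
  have [measurable]: "f k \<in> borel_measurable M" for k
    using f by (simp add: sqi_def)
  obtain N where N: "\<And>k m n. m \<ge> N k \<Longrightarrow> n \<ge> N k \<Longrightarrow> l2 M (\<lambda>x. f m x - f n x) < (1/2)^k"
    using cauchy[of "(1/2)^_"] by (metis zero_less_power half_gt_zero zero_less_one)
  \<comment> \<open>The sum dominates every \<open>N i\<close> with i \<le> k, so \<open>r\<close>
    passes all thresholds without a recursive choice of indices.\<close>
  define r where "r k = k + (\<Sum>i\<le>k. N i)" for k
  have r: "r (Suc k) \<ge> N k" "r k \<ge> N k" "r k \<ge> k" for k
    using member_le_sum[of k "{..k}" N] by (auto simp: r_def)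
  define d where "d k x = f (r (Suc k)) x - f (r k) x" for k x
  have sd: "sqi M (d k)" for k
    unfolding d_def by (intro sqi_diff f)
  then have [measurable]: "d k \<in> borel_measurable M" for k
    by (simp add: sqi_def)
  define c where "c = sqrt (measure M (space M))"
  have "0 \<le> c" by (simp add: c_def)
  have L1: "(LINT x|M. norm (d k x)) \<le> (1/2)^k * c" for k
  proof -
    have "(LINT x|M. norm (d k x)) \<le> l2 M (d k) * c"
      using sqi_integrable(2)[OF sd] by (simp add: c_def)
    also have "\<dots> \<le> (1/2)^k * c"
      unfolding d_def using N[of k "r (Suc k)" "r k"] r \<open>0 \<le> c\<close> by (intro mult_right_mono) (auto intro: less_imp_le)
    finally show ?thesis .
  qed
  have "(\<integral>\<^sup>+x. (\<Sum>k. ennreal (norm (d k x))) \<partial>M) = (\<Sum>k. \<integral>\<^sup>+x. ennreal (norm (d k x)) \<partial>M)"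
    by (rule nn_integral_suminf) simp
  also have "\<dots> = (\<Sum>k. ennreal (LINT x|M. norm (d k x)))"
    by (intro suminf_cong nn_integral_eq_integral) (auto intro: sqi_integrable(1)[OF sd])
  also have "\<dots> \<le> (\<Sum>k. ennreal ((1/2)^k * c))"
    by (intro suminf_le ennreal_leI L1) auto
  also have "\<dots> < \<infinity>"
    using \<open>0 \<le> c\<close> by (simp add: suminf_ennreal2 summable_mult2 ennreal_less_top)
  finally have "AE x in M. (\<Sum>k. ennreal (norm (d k x))) \<noteq> \<infinity>"
    by (intro nn_integral_PInf_AE) auto
  then have conv: "AE x in M. convergent (\<lambda>k. f (r k) x)"
  proof eventually_elim
    case (elim x)
    then have "summable (\<lambda>k. norm (d k x))"
      by (intro summable_suminf_not_top) auto
    then have "summable (\<lambda>k. d k x)"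
      by (rule summable_norm_cancel)
    then have "convergent (\<lambda>n. \<Sum>k<n. d k x)"
      by (simp add: summable_iff_convergent)
    moreover have "(\<Sum>k<n. d k x) = f (r n) x - f (r 0) x" for n
      unfolding d_def by (rule sum_lessThan_telescope)
    ultimately have "convergent (\<lambda>n. f (r n) x - f (r 0) x)" by simp
    from convergent_add[OF this convergent_const[of "f (r 0) x"]] show ?case by simp
  qed
  define g where "g x = lim (\<lambda>k. f (r k) x)" for x
  have [measurable]: "g \<in> borel_measurable M"
    unfolding g_def by measurable
  have lim: "AE x in M. (\<lambda>k. f (r k) x) \<longlonglongrightarrow> g x"
    using conv by eventually_elim (simp add: g_def convergent_LIMSEQ_iff)
  \<comment> \<open>Fatou's lemma along the subsequence: the distance from \<open>f m\<close> to the
    limit is at most the Cauchy bound for the tail.\<close>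
  have bound: "(\<integral>\<^sup>+x. ennreal ((norm (f m x - g x))\<^sup>2) \<partial>M) \<le> ennreal (e\<^sup>2)"
    if e: "e > 0" "\<forall>n\<ge>K. \<forall>m\<ge>K. l2 M (\<lambda>x. f n x - f m x) < e" "m \<ge> K" for m K e
  proof -
    have "(\<integral>\<^sup>+x. ennreal ((norm (f m x - g x))\<^sup>2) \<partial>M)
        = (\<integral>\<^sup>+x. liminf (\<lambda>k. ennreal ((norm (f m x - f (r k) x))\<^sup>2)) \<partial>M)"
    proof (rule nn_integral_cong_AE, use lim in eventually_elim)
      case (elim x)
      then have "(\<lambda>k. ennreal ((norm (f m x - f (r k) x))\<^sup>2)) \<longlonglongrightarrow> ennreal ((norm (f m x - g x))\<^sup>2)"
        by (intro tendsto_intros)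
      then show ?case by (metis lim_imp_Liminf sequentially_bot)
    qed
    also have "\<dots> \<le> liminf (\<lambda>k. \<integral>\<^sup>+x. ennreal ((norm (f m x - f (r k) x))\<^sup>2) \<partial>M)"
      by (rule nn_integral_liminf) measurable
    also have "\<dots> \<le> ennreal (e\<^sup>2)"
    proof (rule Liminf_le)
      show "\<forall>\<^sub>F k in sequentially. (\<integral>\<^sup>+x. ennreal ((norm (f m x - f (r k) x))\<^sup>2) \<partial>M) \<le> ennreal (e\<^sup>2)"
        using eventually_ge_at_top[of K]
      proof eventually_elim
        case (elim k)
        then have "l2 M (\<lambda>x. f m x - f (r k) x) < e"
          using e r(3)[of k] by auto
        then have "(l2 M (\<lambda>x. f m x - f (r k) x))\<^sup>2 \<le> e\<^sup>2"
          by (intro power_mono) auto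
        moreover have "integrable M (\<lambda>x. (norm (f m x - f (r k) x))\<^sup>2)"
          using sqi_diff[OF f f] by (auto simp: sqi_def)
        ultimately show ?case
          by (subst nn_integral_eq_integral) (auto simp: l2_power2 intro!: ennreal_leI)
      qed
    qed simp
    finally show ?thesis .
  qed
  have diff: "sqi M (\<lambda>x. f m x - g x)" "l2 M (\<lambda>x. f m x - g x) \<le> e"
    if e: "e > 0" "\<forall>n\<ge>K. \<forall>m\<ge>K. l2 M (\<lambda>x. f n x - f m x) < e" "m \<ge> K" for m K e
  proof -
    have i: "integrable M (\<lambda>x. (norm (f m x - g x))\<^sup>2)"
      using le_less_trans[OF bound[OF that] ennreal_less_top] by (intro integrableI_bounded) auto
    then show "sqi M (\<lambda>x. f m x - g x)" by (simp add: sqi_def)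
    have "ennreal ((l2 M (\<lambda>x. f m x - g x))\<^sup>2) \<le> ennreal (e\<^sup>2)"
      using bound[OF that] nn_integral_eq_integral[OF i] by (simp add: l2_power2)
    then have "(l2 M (\<lambda>x. f m x - g x))\<^sup>2 \<le> e\<^sup>2" by (simp add: ennreal_le_iff)
    then show "l2 M (\<lambda>x. f m x - g x) \<le> e"
      by (rule power2_le_imp_le) (use e(1) in simp)
  qed
  obtain K where "\<forall>n\<ge>K. \<forall>m\<ge>K. l2 M (\<lambda>x. f n x - f m x) < 1"
    using cauchy[of 1] by auto
  then have "sqi M (\<lambda>x. f K x - g x)"
    using diff(1)[of 1 K K] by simp
  then have "sqi M g"
    using sqi_diff[OF f[of K]] by fastforce
  moreover have "(\<lambda>k. l2 M (\<lambda>x. f k x - g x)) \<longlonglongrightarrow> 0"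
  proof (rule LIMSEQ_I)
    fix e :: real assume "0 < e"
    then obtain K where "\<forall>n\<ge>K. \<forall>m\<ge>K. l2 M (\<lambda>x. f n x - f m x) < e/2"
      using cauchy[of "e/2"] by auto
    then have "l2 M (\<lambda>x. f m x - g x) \<le> e/2" if "m \<ge> K" for m
      using diff(2)[of "e/2" K m] that \<open>0 < e\<close> by simp
    then show "\<exists>K. \<forall>m\<ge>K. norm (l2 M (\<lambda>x. f m x - g x) - 0) < e"
      using \<open>0 < e\<close> by (intro exI[of _ K]) force
  qed
  ultimately show ?thesis by blast
qed

subsection \<open>Differentiation under the integral sign\<close>

lemma integrable_mult_compact_support:
  fixes v :: "'a::euclidean_space \<Rightarrow> real" and k :: "'a \<Rightarrow> 'b::euclidean_space"
  assumes v: "integrable lborel v" and k: "continuous_on UNIV k" "compact C" "\<And>y. y \<notin> C \<Longrightarrow> k y = 0"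
  shows "integrable lborel (\<lambda>y. v y *\<^sub>R k y)"
proof -
  have "compact (k ` C)"
    using k by (intro compact_continuous_image) (auto intro: continuous_on_subset)
  then obtain B where B: "\<And>y. y \<in> C \<Longrightarrow> norm (k y) \<le> B"
    by (meson bounded_iff compact_imp_bounded imageI)
  have nb: "norm (k y) \<le> \<bar>B\<bar>" for y
    using B[of y] k(3)[of y] by (cases "y \<in> C") auto
  have [measurable]: "k \<in> borel_measurable borel"
    using k(1) by (rule borel_measurable_continuous_onI)
  have [measurable]: "v \<in> borel_measurable borel"
    using v by auto
  show ?thesis
  proof (rule Bochner_Integration.integrable_bound)
    show "integrable lborel (\<lambda>y. \<bar>B\<bar> * v y)" using v by simp
    show "AE y in lborel. norm (v y *\<^sub>R k y) \<le> norm (\<bar>B\<bar> * v y)"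
      using mult_right_mono[OF nb, of "\<bar>v _\<bar>"] by (simp add: abs_mult mult.commute)
  qed simp
qed

text \<open>\<open>D\<close> is uniformly continuous on a compact ball times \<open>C\<close> and
  vanishes off \<open>C\<close>. So the error of the linearisation in p is at most e' |p - p0| for
  all y at once, and it can be integrated against |v|. The parameter space is left general: p is
  later a shift along a basis vector, the centre of a convolution, and the scale of a
  mollifier.\<close>

lemma has_derivative_integral_kernel:
  fixes v :: "'a::euclidean_space \<Rightarrow> real" and K :: "'p::euclidean_space \<Rightarrow> 'a \<Rightarrow> real"
    and D :: "'p \<Rightarrow> 'a \<Rightarrow> 'p"
  assumes v: "integrable lborel v" and S: "open S" "p0 \<in> S"
    and der: "\<And>p y. p \<in> S \<Longrightarrow> ((\<lambda>p. K p y) has_derivative (\<lambda>h. D p y \<bullet> h)) (at p)"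
    and cont: "continuous_on (S \<times> UNIV) (\<lambda>(p,y). D p y)" "\<And>p. p \<in> S \<Longrightarrow> continuous_on UNIV (K p)"
    and C: "compact C" "\<And>p y. p \<in> S \<Longrightarrow> y \<notin> C \<Longrightarrow> K p y = 0" "\<And>p y. p \<in> S \<Longrightarrow> y \<notin> C \<Longrightarrow> D p y = 0"
  shows "((\<lambda>p. LINT y|lborel. v y * K p y) has_derivative (\<lambda>h. (LINT y|lborel. v y *\<^sub>R D p0 y) \<bullet> h)) (at p0)"
proof -
  obtain r where r: "r > 0" "cball p0 r \<subseteq> S"
    using S open_contains_cball by metis
  have contD: "continuous_on UNIV (D p)" if "p \<in> S" for p
  proof -
    have "continuous_on UNIV (\<lambda>y::'a. (p, y))" by (intro continuous_intros)
    then show ?thesis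
      using continuous_on_compose2[OF cont(1), of UNIV "\<lambda>y. (p, y)"] that by auto
  qed
  have iK: "integrable lborel (\<lambda>y. v y * K p y)" if "p \<in> S" for p
    using integrable_mult_compact_support[OF v cont(2)[OF that] C(1)] C(2) that by simp
  have iD: "integrable lborel (\<lambda>y. v y *\<^sub>R D p0 y)"
    using integrable_mult_compact_support[OF v contD C(1)] C(3) S by simp
  have "bounded_linear (\<lambda>h. (LINT y|lborel. v y *\<^sub>R D p0 y) \<bullet> h)"
    by (rule bounded_linear_inner_right)
  moreover have "\<exists>d>0. \<forall>p. norm (p - p0) < d \<longrightarrow>
     norm ((LINT y|lborel. v y * K p y) - (LINT y|lborel. v y * K p0 y) - (LINT y|lborel. v y *\<^sub>R D p0 y) \<bullet> (p - p0))
      \<le> e * norm (p - p0)" if "e > 0" for e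
  proof -
    define I where "I = (LINT y|lborel. \<bar>v y\<bar>)"
    have "I \<ge> 0" by (simp add: I_def)
    \<comment> \<open>Dividing by I + 1 covers the case that \<open>v\<close> vanishes almost
      everywhere.\<close>
    define e' where "e' = e / (I + 1)"
    have e': "e' > 0" "e' * I \<le> e"
      using \<open>e > 0\<close> \<open>I \<ge> 0\<close> by (auto simp: e'_def field_simps)
    have "uniformly_continuous_on (cball p0 r \<times> C) (\<lambda>(p,y). D p y)"
      using r C(1) by (intro compact_uniformly_continuous compact_Times compact_cball continuous_on_subset[OF cont(1)]) auto
    then obtain d where d: "d > 0"
      "\<And>z z'. z \<in> cball p0 r \<times> C \<Longrightarrow> z' \<in> cball p0 r \<times> C \<Longrightarrow> dist z' z < d \<Longrightarrow>
          dist ((\<lambda>(p,y). D p y) z') ((\<lambda>(p,y). D p y) z) < e'"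
      using e'(1) unfolding uniformly_continuous_on_def by metis
    define \<delta> where "\<delta> = min d r"
    have "\<delta> > 0" using d r by (simp add: \<delta>_def)
    have inS: "p \<in> S" if "p \<in> ball p0 \<delta>" for p
      using that r by (auto simp: \<delta>_def subset_iff)
    have near: "norm (D p y - D p0 y) \<le> e'" if "p \<in> ball p0 \<delta>" for p y
    proof (cases "y \<in> C")
      case True
      then show ?thesis
        using d(2)[of "(p0,y)" "(p,y)"] that r(1) by (auto simp: \<delta>_def dist_Pair_Pair dist_norm norm_minus_commute)
    next
      case False
      then show ?thesis using C(3) inS[OF that] S e' by simp
    qed
    have lin: "\<bar>K p y - K p0 y - D p0 y \<bullet> (p - p0)\<bar> \<le> norm (p - p0) * e'" if p: "p \<in> ball p0 \<delta>" for p y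
    proof -
      have "norm (K p y - K p0 y - D p0 y \<bullet> (p - p0)) \<le> norm (p - p0) * e'"
      proof (rule differentiable_bound_linearization[where S="ball p0 \<delta>" and f="\<lambda>p. K p y" and f'="\<lambda>p h. D p y \<bullet> h"])
        show "p0 + t *\<^sub>R (p - p0) \<in> ball p0 \<delta>" if "t \<in> {0..1}" for t
        proof -
          have "norm (t *\<^sub>R (p - p0)) \<le> 1 * norm (p - p0)"
            using that unfolding norm_scaleR by (intro mult_right_mono) auto
          then show ?thesis using p by (auto simp: dist_norm norm_minus_commute)
        qed
        show "((\<lambda>p. K p y) has_derivative (\<lambda>h. D x y \<bullet> h)) (at x within ball p0 \<delta>)" if "x \<in> ball p0 \<delta>" for x
          using der[OF inS[OF that]] by (rule has_derivative_at_withinI)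
        show "onorm ((\<lambda>h. D x y \<bullet> h) - (\<lambda>h. D p0 y \<bullet> h)) \<le> e'" if "x \<in> ball p0 \<delta>" for x
        proof (rule onorm_bound)
          fix h
          have "\<bar>(D x y - D p0 y) \<bullet> h\<bar> \<le> e' * norm h"
            using Cauchy_Schwarz_ineq2[of "D x y - D p0 y" h] mult_right_mono[OF near[OF that], of "norm h" y] by simp
          then show "norm (((\<lambda>h. D x y \<bullet> h) - (\<lambda>h. D p0 y \<bullet> h)) h) \<le> e' * norm h"
            by (simp add: inner_diff_left)
        qed (use e' in simp)
        show "p0 \<in> ball p0 \<delta>" using \<open>\<delta> > 0\<close> by simp
      qed
      then show ?thesis by simp
    qed
    show ?thesis
    proof (intro exI[of _ \<delta>] conjI allI impI)
      fix p assume "norm (p - p0) < \<delta>"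
      then have p: "p \<in> ball p0 \<delta>" by (simp add: dist_norm norm_minus_commute)
      have iDi: "integrable lborel (\<lambda>y. v y * (D p0 y \<bullet> (p - p0)))"
        using integrable_inner_left[of "p - p0", OF iD] by simp
      have "(LINT y|lborel. v y * K p y) - (LINT y|lborel. v y * K p0 y) - (LINT y|lborel. v y *\<^sub>R D p0 y) \<bullet> (p - p0)
        = (LINT y|lborel. v y * K p y) - (LINT y|lborel. v y * K p0 y) - (LINT y|lborel. v y * (D p0 y \<bullet> (p - p0)))"
        using integral_inner_left[of "p - p0", OF iD] by simp
      also have "\<dots> = (LINT y|lborel. v y * K p y - v y * K p0 y - v y * (D p0 y \<bullet> (p - p0)))"
        using iK[OF inS[OF p]] iK[OF S(2)] iDi by simp
      also have "norm \<dots> \<le> (LINT y|lborel. norm (v y * K p y - v y * K p0 y - v y * (D p0 y \<bullet> (p - p0))))"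
        by (rule integral_norm_bound)
      also have "\<dots> \<le> (LINT y|lborel. \<bar>v y\<bar> * (norm (p - p0) * e'))"
      proof (rule integral_mono)
        show "integrable lborel (\<lambda>y. norm (v y * K p y - v y * K p0 y - v y * (D p0 y \<bullet> (p - p0))))"
          using iK[OF inS[OF p]] iK[OF S(2)] iDi by simp
        show "integrable lborel (\<lambda>y. \<bar>v y\<bar> * (norm (p - p0) * e'))" using v by simp
        fix y
        have "norm (v y * K p y - v y * K p0 y - v y * (D p0 y \<bullet> (p - p0)))
            = \<bar>v y\<bar> * \<bar>K p y - K p0 y - D p0 y \<bullet> (p - p0)\<bar>"
          by (simp add: right_diff_distrib flip: abs_mult)
        also have "\<dots> \<le> \<bar>v y\<bar> * (norm (p - p0) * e')"
          by (intro mult_left_mono lin p) simp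
        finally show "norm (v y * K p y - v y * K p0 y - v y * (D p0 y \<bullet> (p - p0))) \<le> \<bar>v y\<bar> * (norm (p - p0) * e')" .
      qed
      also have "\<dots> = norm (p - p0) * (e' * I)"
        by (simp add: I_def)
      also have "\<dots> \<le> e * norm (p - p0)"
        using mult_right_mono[OF e'(2), of "norm (p - p0)"] by (simp add: mult.commute)
      finally show "norm ((LINT y|lborel. v y * K p y) - (LINT y|lborel. v y * K p0 y)
        - (LINT y|lborel. v y *\<^sub>R D p0 y) \<bullet> (p - p0)) \<le> e * norm (p - p0)" .
    qed (use \<open>\<delta> > 0\<close> in simp)
  qed
  ultimately show ?thesis
    unfolding has_derivative_at_alt by blast
qed

lemma gradient_inner: "b \<in> Basis \<Longrightarrow> gradient f x \<bullet> b = partial b f x"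
  by (simp add: gradient_def inner_sum_left inner_Basis if_distrib cong: if_cong)

lemma has_derivative_gradient:
  assumes "f differentiable (at x)"
  shows "(f has_derivative (\<lambda>h. gradient f x \<bullet> h)) (at x)"
proof -
  have D: "(f has_derivative frechet_derivative f (at x)) (at x)"
    using assms by (simp add: frechet_derivative_works)
  have "frechet_derivative f (at x) h = gradient f x \<bullet> h" for h
  proof -
    have "frechet_derivative f (at x) h = frechet_derivative f (at x) (\<Sum>b\<in>Basis. (h \<bullet> b) *\<^sub>R b)"
      by (simp add: euclidean_representation)
    also have "\<dots> = (\<Sum>b\<in>Basis. (h \<bullet> b) * partial b f x)"
      using has_derivative_linear[OF D] by (simp add: linear_sum linear_scale partial_def o_def)
    also have "\<dots> = gradient f x \<bullet> h"
      by (simp add: gradient_def inner_sum_left inner_sum_right inner_commute mult.commute)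
    finally show ?thesis .
  qed
  then have "frechet_derivative f (at x) = (\<lambda>h. gradient f x \<bullet> h)" by (rule ext)
  then show ?thesis using D by simp
qed

lemma continuous_on_gradient: "smooth f \<Longrightarrow> continuous_on S (gradient f)"
  unfolding gradient_def by (intro continuous_intros smooth_continuous smooth_partial)

lemma partial_zero_outside:
  assumes "closed C" "\<And>x. x \<notin> C \<Longrightarrow> f x = 0" "x \<notin> C"
  shows "partial b f x = 0"
  using partial_cong[of "- C" f "\<lambda>x. 0" x b] assms by auto

text \<open>The integral of the translate f(y + t b) does not depend on t. Its derivative at t = 0
  is the integral of the partial derivative, which is therefore 0.\<close>

lemma integral_partial_eq_0:
  fixes f :: "'a::euclidean_space \<Rightarrow> real"
  assumes f: "smooth f" "compact C" "\<And>x. x \<notin> C \<Longrightarrow> f x = 0" and b: "b \<in> Basis"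
  shows "(LINT x|lborel. partial b f x) = 0"
proof -
  have pb: "partial b f y = 0" if "y \<notin> C" for y
    using partial_zero_outside f that compact_imp_closed by blast
  \<comment> \<open>All points that some shift with |t| \<le> 1 carries into \<open>C\<close>. The
    indicator of this compact set is the integrable weight demanded by
    \<open>has_derivative_integral_kernel\<close>.\<close>
  define C' where "C' = (\<lambda>(y, t). y - t *\<^sub>R b) ` (C \<times> {-1..1::real})"
  have "compact C'"
    unfolding C'_def using f(2)
    by (intro compact_continuous_image compact_Times) (auto simp: case_prod_beta intro!: continuous_intros)
  have C': "y + t *\<^sub>R b \<notin> C" if "y \<notin> C'" "t \<in> {-1..1}" for y t
  proof
    assume "y + t *\<^sub>R b \<in> C"
    then have "(\<lambda>(y, t). y - t *\<^sub>R b) (y + t *\<^sub>R b, t) \<in> C'"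
      unfolding C'_def using that by blast
    then show False using that by simp
  qed
  have v: "integrable lborel (indicator C' :: 'a \<Rightarrow> real)"
    using \<open>compact C'\<close> emeasure_compact_finite[of C']
    by (intro integrable_real_indicator) (auto simp: compact_imp_closed)
  have D: "((\<lambda>t. LINT y|lborel. indicator C' y * f (y + t *\<^sub>R b)) has_derivative
      (\<lambda>h. (LINT y|lborel. indicator C' y *\<^sub>R partial b f (y + 0 *\<^sub>R b)) \<bullet> h)) (at 0)"
  proof (rule has_derivative_integral_kernel[OF v, of "{-1<..<1::real}"])
    show "((\<lambda>t. f (y + t *\<^sub>R b)) has_derivative (\<lambda>h. partial b f (y + t *\<^sub>R b) \<bullet> h)) (at t)" for t y
    proof -
      have "((\<lambda>t. f (y + t *\<^sub>R b)) has_derivative (\<lambda>h. gradient f (y + t *\<^sub>R b) \<bullet> (h *\<^sub>R b))) (at t)"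
        by (rule has_derivative_compose[where g=f and f="\<lambda>t. y + t *\<^sub>R b", OF _ has_derivative_gradient])
           (auto intro!: derivative_eq_intros smooth_differentiable f)
      then show ?thesis by (simp add: gradient_inner b mult.commute)
    qed
    show "continuous_on ({- 1<..<1} \<times> UNIV) (\<lambda>(t, y). partial b f (y + t *\<^sub>R b))"
      unfolding case_prod_beta
      by (rule continuous_on_compose2[OF smooth_continuous[OF smooth_partial[OF f(1) b], of UNIV]])
         (auto intro!: continuous_intros)
    show "continuous_on UNIV (\<lambda>y. f (y + t *\<^sub>R b))" for t
      by (rule continuous_on_compose2[OF smooth_continuous[OF f(1), of UNIV]])
         (auto intro!: continuous_intros)
  qed (use \<open>compact C'\<close> C' f(3) pb in auto)
  have eq: "(LINT y|lborel. indicator C' y * f (y + t *\<^sub>R b)) = (LINT y|lborel. f y)" if "t \<in> {-1<..<1}" for t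
  proof -
    have [measurable]: "f \<in> borel_measurable borel"
      using smooth_continuous[OF f(1)] by (rule borel_measurable_continuous_onI)
    have "indicator C' y * f (y + t *\<^sub>R b) = f (t *\<^sub>R b + y)" for y
      using C'[of y t] f(3) that by (auto simp: indicator_def add.commute)
    then have "(LINT y|lborel. indicator C' y * f (y + t *\<^sub>R b)) = (LINT y|lborel. f (t *\<^sub>R b + y))"
      by simp
    also have "\<dots> = (LINT y|distr lborel borel ((+) (t *\<^sub>R b)). f y)"
      by (rule integral_distr[symmetric]) auto
    finally show ?thesis by (simp add: lborel_distr_plus)
  qed
  have "((\<lambda>t. LINT y|lborel. f y) has_derivative
      (\<lambda>h. (LINT y|lborel. indicator C' y *\<^sub>R partial b f (y + 0 *\<^sub>R b)) \<bullet> h)) (at (0::real))"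
    by (rule has_derivative_transform_within_open[OF D, of "{-1<..<1}"]) (use eq in \<open>simp_all\<close>)
  from has_derivative_unique[OF this has_derivative_const]
  have "(LINT y|lborel. indicator C' y *\<^sub>R partial b f (y + 0 *\<^sub>R b)) \<bullet> 1 = (0::real)"
    by metis
  moreover have "(LINT y|lborel. indicator C' y *\<^sub>R partial b f (y + 0 *\<^sub>R b)) = (LINT y|lborel. partial b f y)"
    using C'[of _ 0] pb by (intro Bochner_Integration.integral_cong) (auto simp: indicator_def)
  ultimately show ?thesis by (metis inner_real_def mult.right_neutral)
qed

subsection \<open>Test functions\<close>

text \<open>Any compact subset of \<Omega> off which the function vanishes may replace the closed
  support; this avoids the computation of closures.\<close>

lemma test_function_alt:
  "test_function \<Omega> \<phi> \<longleftrightarrow> smooth \<phi> \<and> (\<exists>C. compact C \<and> C \<subseteq> \<Omega> \<and> (\<forall>x. x \<notin> C \<longrightarrow> \<phi> x = 0))"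
proof
  assume "test_function \<Omega> \<phi>"
  then show "smooth \<phi> \<and> (\<exists>C. compact C \<and> C \<subseteq> \<Omega> \<and> (\<forall>x. x \<notin> C \<longrightarrow> \<phi> x = 0))"
    unfolding test_function_def smooth_def using closure_subset[of "{x. \<phi> x \<noteq> 0}"] by blast
next
  assume R: "smooth \<phi> \<and> (\<exists>C. compact C \<and> C \<subseteq> \<Omega> \<and> (\<forall>x. x \<notin> C \<longrightarrow> \<phi> x = 0))"
  then obtain C where C: "compact C" "C \<subseteq> \<Omega>" "{x. \<phi> x \<noteq> 0} \<subseteq> C" by blast
  then have "closure {x. \<phi> x \<noteq> 0} \<subseteq> C"
    by (simp add: closure_minimal compact_imp_closed)
  then show "test_function \<Omega> \<phi>"
    using R C unfolding test_function_def smooth_def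
    by (metis closed_closure compact_Int_closed inf.absorb_iff2 subset_trans)
qed

lemma test_functionE:
  assumes "test_function \<Omega> \<phi>"
  obtains C where "compact C" "C \<subseteq> \<Omega>" "\<And>x. x \<notin> C \<Longrightarrow> \<phi> x = 0" "smooth \<phi>"
  using assms unfolding test_function_alt by blast

lemma test_function_smooth: "test_function \<Omega> \<phi> \<Longrightarrow> smooth \<phi>"
  by (simp add: test_function_alt)

lemma test_function_outside: "test_function \<Omega> \<phi> \<Longrightarrow> x \<notin> \<Omega> \<Longrightarrow> \<phi> x = 0"
  by (auto simp: test_function_alt)

lemma test_function_0: "test_function \<Omega> (\<lambda>x. 0)"
  by (auto simp: test_function_alt intro: exI[of _ "{}"])

lemma test_function_add:
  assumes "test_function \<Omega> \<phi>" "test_function \<Omega> \<psi>"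
  shows "test_function \<Omega> (\<lambda>x. \<phi> x + \<psi> x)"
proof -
  obtain A where "compact A" "A \<subseteq> \<Omega>" "\<And>x. x \<notin> A \<Longrightarrow> \<phi> x = 0" "smooth \<phi>"
    using test_functionE[OF assms(1)] by blast
  moreover obtain B where "compact B" "B \<subseteq> \<Omega>" "\<And>x. x \<notin> B \<Longrightarrow> \<psi> x = 0" "smooth \<psi>"
    using test_functionE[OF assms(2)] by blast
  ultimately show ?thesis
    unfolding test_function_alt by (intro conjI smooth_add exI[of _ "A \<union> B"]) auto
qed

lemma test_function_mult:
  assumes "test_function \<Omega> \<phi>" "smooth f"
  shows "test_function \<Omega> (\<lambda>x. \<phi> x * f x)"
  using assms unfolding test_function_alt by (auto intro: smooth_mult)

lemma test_function_cmult: "test_function \<Omega> \<phi> \<Longrightarrow> test_function \<Omega> (\<lambda>x. c * \<phi> x)"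
  using test_function_mult[of \<Omega> \<phi> "\<lambda>x. c"] by (simp add: mult.commute)

lemma test_function_diff:
  assumes "test_function \<Omega> \<phi>" "test_function \<Omega> \<psi>"
  shows "test_function \<Omega> (\<lambda>x. \<phi> x - \<psi> x)"
  using test_function_add[OF assms(1) test_function_cmult[OF assms(2), of "-1"]] by simp

lemma test_function_partial:
  assumes "test_function \<Omega> \<phi>" "b \<in> Basis"
  shows "test_function \<Omega> (partial b \<phi>)"
  using assms unfolding test_function_alt
  by (metis partial_zero_outside smooth_partial compact_imp_closed)

lemma gradient_add: "smooth f \<Longrightarrow> smooth g \<Longrightarrow> gradient (\<lambda>x. f x + g x) x = gradient f x + gradient g x"
  by (simp add: gradient_def partial_add smooth_differentiable scaleR_add_left sum.distrib)

lemma partial_cmult: "smooth f \<Longrightarrow> partial b (\<lambda>x. c * f x) x = c * partial b f x"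
  by (subst partial_mult) (auto simp: smooth_differentiable)

lemma gradient_cmult: "smooth f \<Longrightarrow> gradient (\<lambda>x. c * f x) x = c *\<^sub>R gradient f x"
  by (simp add: gradient_def partial_cmult scaleR_sum_right)

lemma gradient_diff: "smooth f \<Longrightarrow> smooth g \<Longrightarrow> gradient (\<lambda>x. f x - g x) x = gradient f x - gradient g x"
  using gradient_add[of f "\<lambda>x. -1 * g x" x] gradient_cmult[of g "-1" x] smooth_cmult[of g "-1"] by simp

lemma inner_gradient:
  "gradient f x \<bullet> gradient g x = (\<Sum>b\<in>Basis. partial b f x * partial b g x)"
  by (subst euclidean_inner) (simp add: gradient_inner)

section \<open>Integration by parts and the Poincare inequality on a bounded open set\<close>

locale bounded_open =
  fixes \<Omega> :: "'a::euclidean_space set"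
  assumes open_domain: "open \<Omega>" and bounded_domain: "bounded \<Omega>"
begin

abbreviation "\<mu> \<equiv> lebesgue_on \<Omega>"

lemma lmeasurable_domain: "\<Omega> \<in> lmeasurable"
  using open_domain bounded_domain by (simp add: lmeasurable_open)

sublocale finite_measure \<mu>
  using lmeasurable_domain by (rule finite_measure_lebesgue_on)

lemma continuous_borel_measurable: "continuous_on UNIV f \<Longrightarrow> f \<in> borel_measurable \<mu>"
  for f :: "'a \<Rightarrow> 'b::euclidean_space"
  using borel_measurable_continuous_onI[of f]
  by (intro measurable_restrict_space1) (simp add: measurable_completion)

lemma continuous_bounded_on:
  fixes f :: "'a \<Rightarrow> 'b::euclidean_space"
  assumes "continuous_on UNIV f"
  obtains B where "0 \<le> B" "\<And>x. x \<in> \<Omega> \<Longrightarrow> norm (f x) \<le> B"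
proof -
  have "compact (f ` closure \<Omega>)"
    using bounded_domain assms by (intro compact_continuous_image) (auto intro: continuous_on_subset)
  then obtain B where "\<And>x. x \<in> closure \<Omega> \<Longrightarrow> norm (f x) \<le> B"
    by (meson bounded_iff compact_imp_bounded imageI)
  then have "\<And>x. x \<in> \<Omega> \<Longrightarrow> norm (f x) \<le> \<bar>B\<bar>"
    using closure_subset[of \<Omega>] by force
  then show ?thesis by (intro that[of "\<bar>B\<bar>"]) auto
qed

lemma space_mu [simp]: "space \<mu> = \<Omega>"
  by (simp add: space_restrict_space)

lemma continuous_sqi:
  fixes f :: "'a \<Rightarrow> 'b::euclidean_space"
  assumes "continuous_on UNIV f"
  shows "sqi \<mu> f"
proof -
  obtain B where B: "0 \<le> B" "\<And>x. x \<in> \<Omega> \<Longrightarrow> norm (f x) \<le> B"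
    using continuous_bounded_on[OF assms] by blast
  have "sqi \<mu> (\<lambda>x. 1::real)"
    by (simp add: sqi_def)
  from l2_mono(1)[OF this continuous_borel_measurable[OF assms] B(1)] B(2) show ?thesis by simp
qed

lemma smooth_sqi: "smooth f \<Longrightarrow> sqi \<mu> f" and smooth_gradient_sqi: "smooth f \<Longrightarrow> sqi \<mu> (gradient f)"
  by (auto intro: continuous_sqi smooth_continuous continuous_on_gradient)

lemma smooth_integrable: "smooth f \<Longrightarrow> integrable \<mu> f"
  by (intro sqi_integrable smooth_sqi)

lemma integral_mu_eq_lborel:
  fixes f :: "'a \<Rightarrow> real"
  assumes "f \<in> borel_measurable borel" "\<And>x. x \<notin> \<Omega> \<Longrightarrow> f x = 0"
  shows "integral\<^sup>L \<mu> f = integral\<^sup>L lborel f"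
proof -
  have "integral\<^sup>L \<mu> f = (LINT x|lebesgue. indicator \<Omega> x *\<^sub>R f x)"
    using lmeasurable_domain by (subst integral_restrict_space) (auto simp: fmeasurable_def)
  also have "\<dots> = integral\<^sup>L lebesgue f"
    using assms(2) by (intro Bochner_Integration.integral_cong) (auto simp: indicator_def)
  also have "\<dots> = integral\<^sup>L lborel f"
    using assms(1) by (intro integral_completion) auto
  finally show ?thesis .
qed

lemma integral_partial_test:
  assumes "test_function \<Omega> \<phi>" "b \<in> Basis"
  shows "(LINT x|\<mu>. partial b \<phi> x) = 0"
proof -
  obtain C where "compact C" "C \<subseteq> \<Omega>" "\<And>x. x \<notin> C \<Longrightarrow> \<phi> x = 0" "smooth \<phi>"
    using test_functionE[OF assms(1)] by blast
  note * = integral_partial_eq_0[OF this(4,1,3) assms(2)]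
  have "(LINT x|\<mu>. partial b \<phi> x) = (LINT x|lborel. partial b \<phi> x)"
  proof (rule integral_mu_eq_lborel)
    show "partial b \<phi> \<in> borel_measurable borel"
      using smooth_continuous[OF smooth_partial[OF \<open>smooth \<phi>\<close> assms(2)]] by (rule borel_measurable_continuous_onI)
  qed (use test_function_partial[OF assms] test_function_outside in blast)
  then show ?thesis using * by simp
qed

lemma integral_by_parts:
  assumes \<phi>: "test_function \<Omega> \<phi>" and f: "smooth f" and b: "b \<in> Basis"
  shows "(LINT x|\<mu>. f x * partial b \<phi> x) = - (LINT x|\<mu>. partial b f x * \<phi> x)"
proof -
  have s: "smooth \<phi>" using \<phi> by (rule test_function_smooth)
  have "0 = (LINT x|\<mu>. partial b (\<lambda>x. \<phi> x * f x) x)"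
    using integral_partial_test[OF test_function_mult[OF \<phi> f] b] by simp
  also have "\<dots> = (LINT x|\<mu>. \<phi> x * partial b f x + partial b \<phi> x * f x)"
    by (simp add: partial_mult s f smooth_differentiable)
  also have "\<dots> = (LINT x|\<mu>. \<phi> x * partial b f x) + (LINT x|\<mu>. partial b \<phi> x * f x)"
    by (intro Bochner_Integration.integral_add smooth_integrable smooth_mult smooth_partial s f b)
  finally show ?thesis by (simp add: mult.commute)
qed

lemma smooth_laplacian: "smooth f \<Longrightarrow> smooth (laplacian f)"
  unfolding laplacian_def[abs_def] by (intro smooth_sum smooth_partial)

lemma integral_gradient_laplacian:
  assumes \<phi>: "test_function \<Omega> \<phi>" and f: "smooth f"
  shows "(LINT x|\<mu>. gradient f x \<bullet> gradient \<phi> x) = - (LINT x|\<mu>. laplacian f x * \<phi> x)"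
    and "(LINT x|\<mu>. gradient f x \<bullet> gradient \<phi> x) = - (LINT x|\<mu>. f x * laplacian \<phi> x)"
proof -
  have s: "smooth \<phi>" using \<phi> by (rule test_function_smooth)
  have "(LINT x|\<mu>. gradient f x \<bullet> gradient \<phi> x) = (\<Sum>b\<in>Basis. LINT x|\<mu>. partial b f x * partial b \<phi> x)"
    unfolding inner_gradient
    by (intro Bochner_Integration.integral_sum smooth_integrable smooth_mult smooth_partial s f)
  also have "\<dots> = (\<Sum>b\<in>Basis. - (LINT x|\<mu>. partial b (partial b f) x * \<phi> x))"
    by (intro sum.cong refl integral_by_parts \<phi> smooth_partial f)
  also have "\<dots> = - (\<Sum>b\<in>Basis. LINT x|\<mu>. partial b (partial b f) x * \<phi> x)"
    by (simp add: sum_negf)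
  also have "(\<Sum>b\<in>Basis. LINT x|\<mu>. partial b (partial b f) x * \<phi> x) = (LINT x|\<mu>. laplacian f x * \<phi> x)"
    unfolding laplacian_def sum_distrib_right
    by (intro Bochner_Integration.integral_sum[symmetric] smooth_integrable smooth_mult smooth_partial s f)
  finally show "(LINT x|\<mu>. gradient f x \<bullet> gradient \<phi> x) = - (LINT x|\<mu>. laplacian f x * \<phi> x)" .
  have "(LINT x|\<mu>. gradient f x \<bullet> gradient \<phi> x) = (\<Sum>b\<in>Basis. LINT x|\<mu>. partial b f x * partial b \<phi> x)"
    unfolding inner_gradient
    by (intro Bochner_Integration.integral_sum smooth_integrable smooth_mult smooth_partial s f)
  also have "\<dots> = (\<Sum>b\<in>Basis. - (LINT x|\<mu>. f x * partial b (partial b \<phi>) x))"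
    using integral_by_parts[OF test_function_partial[OF \<phi>] f] by (intro sum.cong refl) simp
  also have "\<dots> = - (\<Sum>b\<in>Basis. LINT x|\<mu>. f x * partial b (partial b \<phi>) x)"
    by (simp add: sum_negf)
  also have "(\<Sum>b\<in>Basis. LINT x|\<mu>. f x * partial b (partial b \<phi>) x) = (LINT x|\<mu>. f x * laplacian \<phi> x)"
    unfolding laplacian_def sum_distrib_left
    by (intro Bochner_Integration.integral_sum[symmetric] smooth_integrable smooth_mult smooth_partial s f)
  finally show "(LINT x|\<mu>. gradient f x \<bullet> gradient \<phi> x) = - (LINT x|\<mu>. f x * laplacian \<phi> x)" .
qed

text \<open>Write 1 as the derivative of the coordinate x \<bullet> b. Integration by parts turns
  the integral of \<phi>^2 into that of -2 (x \<bullet> b) \<phi> times the partial derivative of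
  \<phi>. The coordinate is bounded by \<open>B\<close> on \<Omega>, and Cauchy-Schwarz gives the
  constant 2 B after cancelling one norm of \<phi>.\<close>

lemma poincare: "\<exists>c\<ge>0. \<forall>\<phi>. test_function \<Omega> \<phi> \<longrightarrow> l2 \<mu> \<phi> \<le> c * l2 \<mu> (gradient \<phi>)"
proof -
  obtain b :: 'a where b: "b \<in> Basis" using nonempty_Basis by blast
  have "continuous_on UNIV (\<lambda>x. x \<bullet> b)" by (intro continuous_intros)
  then obtain B where B: "0 \<le> B" "\<And>x. x \<in> \<Omega> \<Longrightarrow> norm (x \<bullet> b) \<le> B"
    using continuous_bounded_on[of "\<lambda>x. x \<bullet> b"] by blast
  have "l2 \<mu> \<phi> \<le> (2 * B) * l2 \<mu> (gradient \<phi>)" if \<phi>: "test_function \<Omega> \<phi>" for \<phi>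
  proof -
    have s: "smooth \<phi>" using \<phi> by (rule test_function_smooth)
    have "(l2 \<mu> \<phi>)\<^sup>2 = (LINT x|\<mu>. partial b (\<lambda>x. x \<bullet> b) x * (\<phi> x * \<phi> x))"
      unfolding l2_power2 using b by (simp add: power2_eq_square)
    also have "\<dots> = - (LINT x|\<mu>. (x \<bullet> b) * partial b (\<lambda>x. \<phi> x * \<phi> x) x)"
      using integral_by_parts[OF test_function_mult[OF \<phi> s] smooth_inner b] by simp
    also have "(LINT x|\<mu>. (x \<bullet> b) * partial b (\<lambda>x. \<phi> x * \<phi> x) x)
      = (LINT x|\<mu>. \<phi> x * ((2 * (x \<bullet> b)) * partial b \<phi> x))"
      by (simp add: partial_mult smooth_differentiable s algebra_simps)
    also have "- \<dots> \<le> \<bar>LINT x|\<mu>. \<phi> x \<bullet> ((2 * (x \<bullet> b)) * partial b \<phi> x)\<bar>"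
      by simp
    also have "\<dots> \<le> l2 \<mu> \<phi> * l2 \<mu> (\<lambda>x. (2 * (x \<bullet> b)) * partial b \<phi> x)"
      by (intro l2_Cauchy_Schwarz smooth_sqi smooth_mult smooth_partial smooth_inner s b smooth_const)
    also have "\<dots> \<le> l2 \<mu> \<phi> * ((2 * B) * l2 \<mu> (gradient \<phi>))"
    proof (rule mult_left_mono[OF l2_mono(2)])
      fix x assume "x \<in> space \<mu>"
      then have "\<bar>x \<bullet> b\<bar> \<le> B" using B(2) by simp
      moreover have "\<bar>partial b \<phi> x\<bar> \<le> norm (gradient \<phi> x)"
        using Basis_le_norm[OF b, of "gradient \<phi> x"] by (simp add: gradient_inner b)
      ultimately show "norm (2 * (x \<bullet> b) * partial b \<phi> x) \<le> 2 * B * norm (gradient \<phi> x)"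
        using B(1) by (auto simp: abs_mult intro!: mult_mono)
    qed (use B(1) in \<open>auto intro!: smooth_gradient_sqi s sqi_borel smooth_sqi smooth_mult smooth_partial smooth_inner b\<close>)
    finally have "l2 \<mu> \<phi> * l2 \<mu> \<phi> \<le> l2 \<mu> \<phi> * ((2 * B) * l2 \<mu> (gradient \<phi>))"
      by (simp add: power2_eq_square)
    then show ?thesis
      using B(1) by (cases "l2 \<mu> \<phi> = 0") (auto simp: mult_le_cancel_left less_le)
  qed
  then show ?thesis using B(1) by (intro exI[of _ "2 * B"]) auto
qed

end

subsection \<open>The weak Poisson equation with zero boundary values\<close>

lemma l2_null_comparison:
  assumes "\<And>k::nat. l2 M (f k) \<le> a k" "a \<longlonglongrightarrow> 0"
  shows "(\<lambda>k. l2 M (f k)) \<longlonglongrightarrow> 0"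
  by (rule Lim_null_comparison[OF always_eventually assms(2)]) (simp add: assms(1))

lemma inner_basis_sum: "v \<bullet> gradient f x = (\<Sum>b\<in>Basis. (v \<bullet> b) * partial b f x)"
  by (subst euclidean_inner) (simp add: gradient_inner)

context bounded_open
begin

text \<open>The weak form of -\<Delta>u = F with zero boundary values. The gradient and the
  approximating test functions are arguments rather than bound variables, since all later limit
  passages work with them.\<close>

definition poisson :: "('a \<Rightarrow> real) \<Rightarrow> ('a \<Rightarrow> real) \<Rightarrow> ('a \<Rightarrow> 'a) \<Rightarrow> (nat \<Rightarrow> 'a \<Rightarrow> real) \<Rightarrow> bool" where
  "poisson F u g \<phi> \<longleftrightarrow> sqi \<mu> u \<and> sqi \<mu> g \<and> (\<forall>k. test_function \<Omega> (\<phi> k)) \<and>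
     (\<lambda>k. l2 \<mu> (\<lambda>x. \<phi> k x - u x)) \<longlonglongrightarrow> 0 \<and> (\<lambda>k. l2 \<mu> (\<lambda>x. gradient (\<phi> k) x - g x)) \<longlonglongrightarrow> 0 \<and>
     (\<forall>\<psi>. test_function \<Omega> \<psi> \<longrightarrow> (LINT x|\<mu>. g x \<bullet> gradient \<psi> x) = (LINT x|\<mu>. F x * \<psi> x))"

lemma poissonD:
  assumes "poisson F u g \<phi>"
  shows "sqi \<mu> u" "sqi \<mu> g" "test_function \<Omega> (\<phi> k)" "smooth (\<phi> k)"
    "(\<lambda>k. l2 \<mu> (\<lambda>x. \<phi> k x - u x)) \<longlonglongrightarrow> 0" "(\<lambda>k. l2 \<mu> (\<lambda>x. gradient (\<phi> k) x - g x)) \<longlonglongrightarrow> 0"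
    "test_function \<Omega> \<psi> \<Longrightarrow> (LINT x|\<mu>. g x \<bullet> gradient \<psi> x) = (LINT x|\<mu>. F x * \<psi> x)"
  using assms unfolding poisson_def by (auto intro: test_function_smooth)

text \<open>A torsion function is tested with Laplacians, a solution of \<open>poisson\<close> with
  gradients. One derivative is moved by testing the weak gradient with the partial derivatives of
  \<psi>, which are test functions themselves.\<close>

lemma torsion_imp_poisson:
  assumes "torsion_function \<Omega> u"
  obtains g \<phi> where "poisson (\<lambda>x. 1) u g \<phi>"
proof -
  obtain g \<phi> where u: "square_integrable_on \<Omega> u" and g: "square_integrable_on \<Omega> g"
    and wg: "has_weak_gradient \<Omega> u g" and test: "\<And>k. test_function \<Omega> (\<phi> k)"
    and lim: "(\<lambda>k. LINT x|\<mu>. (\<phi> k x - u x)\<^sup>2) \<longlonglongrightarrow> 0" "(\<lambda>k. LINT x|\<mu>. (norm (gradient (\<phi> k) x - g x))\<^sup>2) \<longlonglongrightarrow> 0"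
    using assms unfolding torsion_function_def sobolev_W12_0_def by blast
  have su: "sqi \<mu> u" and sg: "sqi \<mu> g"
    using u g by (auto simp: sqi_def square_integrable_on_def)
  have "(LINT x|\<mu>. g x \<bullet> gradient \<psi> x) = (LINT x|\<mu>. 1 * \<psi> x)" if \<psi>: "test_function \<Omega> \<psi>" for \<psi>
  proof -
    have s: "smooth \<psi>" using \<psi> by (rule test_function_smooth)
    have i: "integrable \<mu> (\<lambda>x. (g x \<bullet> b) * f x)" if "b \<in> Basis" "smooth f" for b f
    proof -
      have "sqi \<mu> (\<lambda>x. f x *\<^sub>R b)"
        by (intro continuous_sqi continuous_intros smooth_continuous that)
      from sqi_integrable_inner[OF sg this] show ?thesis by (simp add: mult.commute)
    qed
    have iu: "integrable \<mu> (\<lambda>x. u x * f x)" if "smooth f" for f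
      using sqi_integrable_inner[OF su smooth_sqi[OF that]] by simp
    have "(LINT x|\<mu>. g x \<bullet> gradient \<psi> x) = (\<Sum>b\<in>Basis. LINT x|\<mu>. (g x \<bullet> b) * partial b \<psi> x)"
      unfolding inner_basis_sum by (intro Bochner_Integration.integral_sum i smooth_partial s)
    also have "\<dots> = (\<Sum>b\<in>Basis. - (LINT x|\<mu>. u x * partial b (partial b \<psi>) x))"
      using wg test_function_partial[OF \<psi>] by (intro sum.cong refl) (auto simp: has_weak_gradient_def)
    also have "\<dots> = - (\<Sum>b\<in>Basis. LINT x|\<mu>. u x * partial b (partial b \<psi>) x)"
      by (simp add: sum_negf)
    also have "(\<Sum>b\<in>Basis. LINT x|\<mu>. u x * partial b (partial b \<psi>) x) = (LINT x|\<mu>. u x * laplacian \<psi> x)"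
      unfolding laplacian_def sum_distrib_left
      by (intro Bochner_Integration.integral_sum[symmetric] iu smooth_partial s)
    also have "\<dots> = - (LINT x|\<mu>. \<psi> x)"
      using assms \<psi> by (simp add: torsion_function_def)
    finally show ?thesis by simp
  qed
  then have "poisson (\<lambda>x. 1) u g \<phi>"
    unfolding poisson_def l2_tendsto_iff[symmetric] using su sg test lim by simp
  then show ?thesis by (rule that)
qed

text \<open>Integration by parts holds for each \<open>\<phi> k\<close>, and both sides converge by
  \<open>l2_inner_tendsto\<close>. The next lemma is obtained in the same way.\<close>

lemma poisson_weak_gradient:
  assumes P: "poisson F u g \<phi>"
  shows "has_weak_gradient \<Omega> u g"
  unfolding has_weak_gradient_def
proof (intro allI impI ballI)
  fix \<psi> and b :: 'a assume \<psi>: "test_function \<Omega> \<psi>" and b: "b \<in> Basis"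
  have s: "smooth \<psi>" using \<psi> by (rule test_function_smooth)
  have s\<phi>: "smooth (\<phi> k)" for k using poissonD(4)[OF P] .
  have sb: "sqi \<mu> (\<lambda>x. \<psi> x *\<^sub>R b)"
    by (intro continuous_sqi continuous_intros smooth_continuous s)
  have 1: "(\<lambda>k. LINT x|\<mu>. \<phi> k x \<bullet> partial b \<psi> x) \<longlonglongrightarrow> (LINT x|\<mu>. u x \<bullet> partial b \<psi> x)"
    by (intro l2_inner_tendsto smooth_sqi s\<phi> poissonD[OF P] smooth_partial s b)
  have 2: "(\<lambda>k. LINT x|\<mu>. gradient (\<phi> k) x \<bullet> (\<psi> x *\<^sub>R b)) \<longlonglongrightarrow> (LINT x|\<mu>. g x \<bullet> (\<psi> x *\<^sub>R b))"
    by (intro l2_inner_tendsto smooth_gradient_sqi s\<phi> poissonD[OF P] sb)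
  have "(LINT x|\<mu>. \<phi> k x \<bullet> partial b \<psi> x) = - (LINT x|\<mu>. gradient (\<phi> k) x \<bullet> (\<psi> x *\<^sub>R b))" for k
    using integral_by_parts[OF \<psi> s\<phi> b] b by (simp add: gradient_inner mult.commute)
  then have "(LINT x|\<mu>. u x \<bullet> partial b \<psi> x) = - (LINT x|\<mu>. g x \<bullet> (\<psi> x *\<^sub>R b))"
    using LIMSEQ_unique[OF 1] tendsto_minus[OF 2] by simp
  then show "(LINT x|\<mu>. u x * partial b \<psi> x) = - (LINT x|\<mu>. (g x \<bullet> b) * \<psi> x)"
    by (simp add: mult.commute)
qed

lemma poisson_laplacian:
  assumes P: "poisson F u g \<phi>" and \<psi>: "test_function \<Omega> \<psi>"
  shows "(LINT x|\<mu>. u x * laplacian \<psi> x) = - (LINT x|\<mu>. F x * \<psi> x)"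
proof -
  have s: "smooth \<psi>" using \<psi> by (rule test_function_smooth)
  have s\<phi>: "smooth (\<phi> k)" for k using poissonD(4)[OF P] .
  have 1: "(\<lambda>k. LINT x|\<mu>. \<phi> k x \<bullet> laplacian \<psi> x) \<longlonglongrightarrow> (LINT x|\<mu>. u x \<bullet> laplacian \<psi> x)"
    by (intro l2_inner_tendsto smooth_sqi s\<phi> poissonD[OF P] smooth_laplacian s)
  have 2: "(\<lambda>k. LINT x|\<mu>. gradient (\<phi> k) x \<bullet> gradient \<psi> x) \<longlonglongrightarrow> (LINT x|\<mu>. g x \<bullet> gradient \<psi> x)"
    by (intro l2_inner_tendsto smooth_gradient_sqi s\<phi> poissonD[OF P] s)
  have "(LINT x|\<mu>. \<phi> k x \<bullet> laplacian \<psi> x) = - (LINT x|\<mu>. gradient (\<phi> k) x \<bullet> gradient \<psi> x)" for k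
    using integral_gradient_laplacian(2)[OF \<psi> s\<phi>] by simp
  then have "(LINT x|\<mu>. u x \<bullet> laplacian \<psi> x) = - (LINT x|\<mu>. g x \<bullet> gradient \<psi> x)"
    using LIMSEQ_unique[OF 1] tendsto_minus[OF 2] by simp
  then show ?thesis using poissonD(7)[OF P \<psi>] by simp
qed

lemma poisson_imp_torsion:
  assumes P: "poisson (\<lambda>x. 1) u g \<phi>"
  shows "torsion_function \<Omega> u"
proof -
  have "sobolev_W12_0 \<Omega> u"
    unfolding sobolev_W12_0_def
  proof (intro exI conjI)
    show "square_integrable_on \<Omega> u" "square_integrable_on \<Omega> g"
      using poissonD[OF P] by (auto simp: sqi_def square_integrable_on_def)
    show "has_weak_gradient \<Omega> u g" by (rule poisson_weak_gradient[OF P])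
    show "\<forall>k. test_function \<Omega> (\<phi> k)" using poissonD(3)[OF P] by blast
    show "(\<lambda>k. LINT x|\<mu>. (\<phi> k x - u x)\<^sup>2) \<longlonglongrightarrow> 0" "(\<lambda>k. LINT x|\<mu>. (norm (gradient (\<phi> k) x - g x))\<^sup>2) \<longlonglongrightarrow> 0"
      using poissonD(5,6)[OF P] unfolding l2_tendsto_iff[symmetric] by simp_all
  qed
  then show ?thesis
    unfolding torsion_function_def using poisson_laplacian[OF P] by simp
qed

lemma poisson_diff:
  assumes P: "poisson F u g \<phi>" and P': "poisson F' u' g' \<phi>'"
    and F: "continuous_on UNIV F" "continuous_on UNIV F'"
  shows "poisson (\<lambda>x. F x - F' x) (\<lambda>x. u x - u' x) (\<lambda>x. g x - g' x) (\<lambda>k x. \<phi> k x - \<phi>' k x)"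
  unfolding poisson_def
proof (intro conjI allI impI)
  note p = poissonD[OF P] and p' = poissonD[OF P']
  have s\<phi>: "smooth (\<phi> k)" "smooth (\<phi>' k)" for k using p(4) p'(4) by auto
  show "sqi \<mu> (\<lambda>x. u x - u' x)" "sqi \<mu> (\<lambda>x. g x - g' x)"
    by (intro sqi_diff p p')+
  show "test_function \<Omega> (\<lambda>x. \<phi> k x - \<phi>' k x)" for k
    by (intro test_function_diff p p')
  have "l2 \<mu> (\<lambda>x. \<phi> k x - \<phi>' k x - (u x - u' x)) \<le> l2 \<mu> (\<lambda>x. \<phi> k x - u x) + l2 \<mu> (\<lambda>x. \<phi>' k x - u' x)" for k
    using l2_triangle[OF sqi_diff[OF smooth_sqi[OF s\<phi>(1)] p(1)] sqi_minus[OF sqi_diff[OF smooth_sqi[OF s\<phi>(2)] p'(1)]], of k k]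
      l2_minus[of \<mu> "\<lambda>x. \<phi>' k x - u' x"]
    by (simp add: algebra_simps)
  then show "(\<lambda>k. l2 \<mu> (\<lambda>x. \<phi> k x - \<phi>' k x - (u x - u' x))) \<longlonglongrightarrow> 0"
    by (rule l2_null_comparison) (rule tendsto_add_zero[OF p(5) p'(5)])
  have "l2 \<mu> (\<lambda>x. gradient (\<phi> k) x - gradient (\<phi>' k) x - (g x - g' x))
      \<le> l2 \<mu> (\<lambda>x. gradient (\<phi> k) x - g x) + l2 \<mu> (\<lambda>x. gradient (\<phi>' k) x - g' x)" for k
    using l2_triangle[OF sqi_diff[OF smooth_gradient_sqi[OF s\<phi>(1)] p(2)] sqi_minus[OF sqi_diff[OF smooth_gradient_sqi[OF s\<phi>(2)] p'(2)]], of k k]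
      l2_minus[of \<mu> "\<lambda>x. gradient (\<phi>' k) x - g' x"]
    by (simp add: algebra_simps)
  then have "l2 \<mu> (\<lambda>x. gradient (\<lambda>x. \<phi> k x - \<phi>' k x) x - (g x - g' x))
      \<le> l2 \<mu> (\<lambda>x. gradient (\<phi> k) x - g x) + l2 \<mu> (\<lambda>x. gradient (\<phi>' k) x - g' x)" for k
    by (simp add: gradient_diff s\<phi>)
  then show "(\<lambda>k. l2 \<mu> (\<lambda>x. gradient (\<lambda>x. \<phi> k x - \<phi>' k x) x - (g x - g' x))) \<longlonglongrightarrow> 0"
    by (rule l2_null_comparison) (rule tendsto_add_zero[OF p(6) p'(6)])
  fix \<psi> assume \<psi>: "test_function \<Omega> \<psi>"
  have s: "smooth \<psi>" using \<psi> by (rule test_function_smooth)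
  have i: "integrable \<mu> (\<lambda>x. F x * \<psi> x)" "integrable \<mu> (\<lambda>x. F' x * \<psi> x)"
    using sqi_integrable_inner[OF continuous_sqi[OF F(1)] smooth_sqi[OF s]]
      sqi_integrable_inner[OF continuous_sqi[OF F(2)] smooth_sqi[OF s]] by auto
  show "(LINT x|\<mu>. (g x - g' x) \<bullet> gradient \<psi> x) = (LINT x|\<mu>. (F x - F' x) * \<psi> x)"
    using p(7)[OF \<psi>] p'(7)[OF \<psi>] i sqi_integrable_inner[OF p(2) smooth_gradient_sqi[OF s]]
      sqi_integrable_inner[OF p'(2) smooth_gradient_sqi[OF s]]
    by (simp add: inner_diff_left left_diff_distrib)
qed

lemma poisson_0: "poisson (\<lambda>x. 0) (\<lambda>x. 0) (\<lambda>x. 0) (\<lambda>k x. 0)"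
  unfolding poisson_def
  by (auto simp: sqi_def l2_def gradient_def test_function_0)

lemma poisson_uminus:
  assumes "poisson F u g \<phi>" "continuous_on UNIV F"
  shows "poisson (\<lambda>x. - F x) (\<lambda>x. - u x) (\<lambda>x. - g x) (\<lambda>k x. - \<phi> k x)"
  using poisson_diff[OF poisson_0 assms(1) _ assms(2)] by simp

text \<open>The function \<open>hk 0 (\<phi> k - W)\<close> is a smooth substitute for the positive part of
  \<open>\<phi> k - W\<close>.\<close>

lemma comparison:
  assumes P: "poisson F u g \<phi>" and F: "continuous_on UNIV F" and W: "smooth W"
    and sup: "\<And>x. x \<in> \<Omega> \<Longrightarrow> laplacian W x + F x \<le> 0"
    and K: "compact K" "K \<subseteq> \<Omega>" "\<And>x. x \<in> \<Omega> \<Longrightarrow> x \<notin> K \<Longrightarrow> 0 \<le> W x"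
  shows "AE x in \<mu>. u x \<le> W x"
proof -
  note p = poissonD[OF P]
  obtain c where c: "c \<ge> 0" "\<And>\<phi>. test_function \<Omega> \<phi> \<Longrightarrow> l2 \<mu> \<phi> \<le> c * l2 \<mu> (gradient \<phi>)"
    using poincare by blast
  \<comment> \<open>Off \<open>C \<union> K\<close> but inside \<Omega>, \<open>\<phi> k\<close>
    vanishes and \<open>W\<close> is nonnegative, so the truncation is zero. Outside \<Omega>
    nothing is known about the sign of \<open>W\<close>, hence the case distinction.\<close>
  define \<psi> where "\<psi> k x = (if x \<in> \<Omega> then hk 0 (\<phi> k x - W x) else 0)" for k x
  have sm: "smooth (\<lambda>x. hk j (\<phi> k x - W x))" for j k
    by (rule smooth_hk[OF smooth_diff[OF p(4) W]])
  have \<psi>: "test_function \<Omega> (\<psi> k)" for k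
  proof -
    obtain C where C: "compact C" "C \<subseteq> \<Omega>" "\<And>x. x \<notin> C \<Longrightarrow> \<phi> k x = 0"
      using p(3)[of k] unfolding test_function_alt by blast
    have 0: "\<psi> k x = 0" if "x \<notin> C \<union> K" for x
      using that C(3) K(3) by (auto simp: \<psi>_def)
    have cl: "compact (C \<union> K)" using C K by blast
    have "smooth (\<psi> k)"
    proof (rule smooth_local)
      fix x
      show "\<exists>U g. open U \<and> x \<in> U \<and> smooth g \<and> (\<forall>y\<in>U. \<psi> k y = g y)"
      proof (cases "x \<in> \<Omega>")
        case True
        then show ?thesis
          using open_domain sm[of 0 k] by (intro exI[of _ \<Omega>] exI[of _ "\<lambda>x. hk 0 (\<phi> k x - W x)"]) (auto simp: \<psi>_def)
      next
        case False
        show ?thesis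
        proof (intro exI conjI)
          show "open (- (C \<union> K))" using cl compact_imp_closed by blast
          show "x \<in> - (C \<union> K)" using False C K by blast
        qed (use 0 in auto)
      qed
    qed
    then show ?thesis
      unfolding test_function_alt using cl C(2) K(2) 0 by (intro conjI exI[of _ "C \<union> K"]) blast+
  qed
  have s\<psi>: "smooth (\<psi> k)" for k using \<psi> by (rule test_function_smooth)
  have \<psi>0: "0 \<le> \<psi> k x" for k x by (simp add: \<psi>_def hk_0_nonneg)
  have grad: "gradient (\<psi> k) x = hk (Suc 0) (\<phi> k x - W x) *\<^sub>R (gradient (\<phi> k) x - gradient W x)" if "x \<in> \<Omega>" for k x
  proof -
    have "partial b (\<psi> k) x = hk (Suc 0) (\<phi> k x - W x) * partial b (\<lambda>x. \<phi> k x - W x) x" for b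
      using partial_cong[OF open_domain, of "\<psi> k" "\<lambda>x. hk 0 (\<phi> k x - W x)"] that
        partial_compose[OF smooth_differentiable[OF smooth_diff[OF p(4)[of k] W]] hk_deriv]
      by (simp add: \<psi>_def)
    then have "gradient (\<psi> k) x = hk (Suc 0) (\<phi> k x - W x) *\<^sub>R gradient (\<lambda>x. \<phi> k x - W x) x"
      by (simp add: gradient_def scaleR_sum_right)
    then show ?thesis by (simp add: gradient_diff p(4) W)
  qed
  have sgW: "sqi \<mu> (gradient W)" by (rule smooth_gradient_sqi[OF W])
  have sg\<phi>: "sqi \<mu> (gradient (\<phi> k))" for k by (rule smooth_gradient_sqi[OF p(4)])
  have sg\<psi>: "sqi \<mu> (gradient (\<psi> k))" for k by (rule smooth_gradient_sqi[OF s\<psi>])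
  \<comment> \<open>With d the gradient of \<phi> k - W and h the value of \<open>hk (Suc 0)\<close>
    there, 0 \<le> h \<le> 2 gives h^2 |d|^2 \<le> 2 h |d|^2. The right side is twice d paired with
    the gradient of \<psi> k. Replacing the gradient of \<open>\<phi> k\<close> by \<open>g\<close>
    costs the L^2 error, and what remains is nonpositive by the equation and the supersolution
    property.\<close>
  have est: "l2 \<mu> (gradient (\<psi> k)) \<le> 2 * l2 \<mu> (\<lambda>x. gradient (\<phi> k) x - g x)" for k
  proof -
    have i1: "integrable \<mu> (\<lambda>x. F x * \<psi> k x)" "integrable \<mu> (\<lambda>x. laplacian W x * \<psi> k x)"
      using sqi_integrable_inner[OF continuous_sqi[OF F] smooth_sqi[OF s\<psi>]]
        smooth_integrable[OF smooth_mult[OF smooth_laplacian[OF W] s\<psi>]] by auto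
    have "(LINT x|\<mu>. g x \<bullet> gradient (\<psi> k) x) - (LINT x|\<mu>. gradient W x \<bullet> gradient (\<psi> k) x)
       = (LINT x|\<mu>. F x * \<psi> k x) + (LINT x|\<mu>. laplacian W x * \<psi> k x)"
      using p(7)[OF \<psi>] integral_gradient_laplacian(1)[OF \<psi> W] by simp
    also have "\<dots> = (LINT x|\<mu>. (laplacian W x + F x) * \<psi> k x)"
      using i1 by (simp add: distrib_right)
    also have "\<dots> \<le> 0"
    proof -
      have "0 \<le> (LINT x|\<mu>. - ((laplacian W x + F x) * \<psi> k x))"
        using sup \<psi>0 by (intro integral_nonneg_AE AE_I2) (auto simp: mult_nonpos_nonneg)
      then show ?thesis by simp
    qed
    finally have key: "(LINT x|\<mu>. g x \<bullet> gradient (\<psi> k) x) - (LINT x|\<mu>. gradient W x \<bullet> gradient (\<psi> k) x) \<le> 0" .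
    have "(l2 \<mu> (gradient (\<psi> k)))\<^sup>2 \<le> (LINT x|\<mu>. 2 * ((gradient (\<phi> k) x - gradient W x) \<bullet> gradient (\<psi> k) x))"
      unfolding l2_power2
    proof (rule integral_mono)
      show "integrable \<mu> (\<lambda>x. (norm (gradient (\<psi> k) x))\<^sup>2)" using sg\<psi> by (simp add: sqi_def)
      show "integrable \<mu> (\<lambda>x. 2 * ((gradient (\<phi> k) x - gradient W x) \<bullet> gradient (\<psi> k) x))"
        using sqi_integrable_inner[OF sqi_diff[OF sg\<phi> sgW] sg\<psi>] by simp
      fix x assume "x \<in> space \<mu>"
      then have x: "x \<in> \<Omega>" by simp
      define h d where "h = hk (Suc 0) (\<phi> k x - W x)" and "d = gradient (\<phi> k) x - gradient W x"
      have "0 \<le> h" "h \<le> 2" by (auto simp: h_def hk_1_nonneg hk_1_le)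
      then have "h * (h * (d \<bullet> d)) \<le> 2 * (h * (d \<bullet> d))"
        by (intro mult_right_mono) auto
      then show "(norm (gradient (\<psi> k) x))\<^sup>2 \<le> 2 * ((gradient (\<phi> k) x - gradient W x) \<bullet> gradient (\<psi> k) x)"
        unfolding grad[OF x] h_def[symmetric] d_def[symmetric] power2_norm_eq_inner by simp
    qed
    also have "\<dots> = 2 * (LINT x|\<mu>. (gradient (\<phi> k) x - g x) \<bullet> gradient (\<psi> k) x) +
       2 * ((LINT x|\<mu>. g x \<bullet> gradient (\<psi> k) x) - (LINT x|\<mu>. gradient W x \<bullet> gradient (\<psi> k) x))"
      using sqi_integrable_inner[OF sg\<phi>[of k] sg\<psi>[of k]] sqi_integrable_inner[OF sgW sg\<psi>[of k]]
        sqi_integrable_inner[OF p(2) sg\<psi>[of k]]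
      by (simp add: inner_diff_left)
    also have "\<dots> \<le> 2 * (LINT x|\<mu>. (gradient (\<phi> k) x - g x) \<bullet> gradient (\<psi> k) x)"
      using key by simp
    also have "\<dots> \<le> 2 * (l2 \<mu> (\<lambda>x. gradient (\<phi> k) x - g x) * l2 \<mu> (gradient (\<psi> k)))"
      using l2_Cauchy_Schwarz[OF sqi_diff[OF sg\<phi> p(2)] sg\<psi>, of k k] by simp
    finally have "l2 \<mu> (gradient (\<psi> k)) * l2 \<mu> (gradient (\<psi> k))
        \<le> (2 * l2 \<mu> (\<lambda>x. gradient (\<phi> k) x - g x)) * l2 \<mu> (gradient (\<psi> k))"
      by (simp add: power2_eq_square)
    then show ?thesis
      by (cases "l2 \<mu> (gradient (\<psi> k)) = 0") (auto simp: mult_le_cancel_right less_le)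
  qed
  \<comment> \<open>The L^2 limit of the truncations, because \<open>hk 0\<close> is Lipschitz. By
    Poincare and \<open>est\<close> their norms tend to 0, so \<open>w\<close> vanishes almost
    everywhere, and \<open>hk 0\<close> is zero only on nonpositive arguments.\<close>
  define w where "w x = hk 0 (u x - W x)" for x
  have suW: "sqi \<mu> (\<lambda>x. u x - W x)" by (intro sqi_diff p smooth_sqi W)
  have "continuous_on UNIV (hk 0)"
    using hk_deriv DERIV_isCont continuous_at_imp_continuous_on by blast
  then have [measurable]: "hk 0 \<in> borel_measurable borel" by (rule borel_measurable_continuous_onI)
  have [measurable]: "w \<in> borel_measurable \<mu>"
    unfolding w_def using sqi_borel[OF suW] by measurable
  have sw: "sqi \<mu> w"
    by (rule l2_mono(1)[OF suW, of _ 2]) (use hk_0_lipschitz[of _ 0] in \<open>auto simp: w_def\<close>)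
  have diff: "l2 \<mu> (\<lambda>x. \<psi> k x - w x) \<le> 2 * l2 \<mu> (\<lambda>x. \<phi> k x - u x)" for k
  proof (rule l2_mono(2))
    show "(\<lambda>x. \<psi> k x - w x) \<in> borel_measurable \<mu>"
      using sqi_borel[OF smooth_sqi[OF s\<psi>]] by measurable
    show "norm (\<psi> k x - w x) \<le> 2 * norm (\<phi> k x - u x)" if "x \<in> space \<mu>" for x
      using hk_0_lipschitz[of "\<phi> k x - W x" "u x - W x"] that by (simp add: \<psi>_def w_def)
  qed (auto intro: sqi_diff smooth_sqi p)
  have "l2 \<mu> w \<le> c * (2 * l2 \<mu> (\<lambda>x. gradient (\<phi> k) x - g x)) + 2 * l2 \<mu> (\<lambda>x. \<phi> k x - u x)" for k
  proof -
    have "l2 \<mu> w \<le> l2 \<mu> (\<psi> k) + l2 \<mu> (\<lambda>x. w x - \<psi> k x)"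
      by (rule l2_triangle_le[OF sw smooth_sqi[OF s\<psi>]])
    moreover have "l2 \<mu> (\<psi> k) \<le> c * (2 * l2 \<mu> (\<lambda>x. gradient (\<phi> k) x - g x))"
      using c(2)[OF \<psi>] mult_left_mono[OF est c(1)] order.trans by blast
    ultimately show ?thesis using diff[of k] by (simp add: l2_commute[of \<mu> w])
  qed
  moreover have "(\<lambda>k. c * (2 * l2 \<mu> (\<lambda>x. gradient (\<phi> k) x - g x)) + 2 * l2 \<mu> (\<lambda>x. \<phi> k x - u x)) \<longlonglongrightarrow> c * (2 * 0) + 2 * 0"
    by (intro tendsto_intros p)
  ultimately have "l2 \<mu> w \<le> 0"
    by (intro LIMSEQ_le_const[of _ _ "l2 \<mu> w"]) auto
  then have "l2 \<mu> w = 0" using l2_nonneg[of \<mu> w] by linarith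
  then have "AE x in \<mu>. w x = 0" using l2_eq_0_iff[OF sw] by blast
  then show ?thesis by eventually_elim (simp add: w_def hk_0_eq_0_iff)
qed

lemma laplacian_0 [simp]: "laplacian (\<lambda>x. 0) x = 0"
  by (simp add: laplacian_def)

text \<open>The difference solves the equation with right-hand side 0, for which the zero function
  is a supersolution.\<close>

lemma poisson_unique:
  assumes P: "poisson F u g \<phi>" and P': "poisson F u' g' \<phi>'" and F: "continuous_on UNIV F"
  shows "AE x in \<mu>. u x = u' x"
proof -
  have "AE x in \<mu>. u x - u' x \<le> 0"
    by (rule comparison[OF poisson_diff[OF P P' F F], of _ "{}"]) auto
  moreover have "AE x in \<mu>. u' x - u x \<le> 0"
    by (rule comparison[OF poisson_diff[OF P' P F F], of _ "{}"]) auto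
  ultimately show ?thesis by eventually_elim simp
qed

text \<open>Dirichlet's principle. \<open>J\<close> is quadratic, so the parallelogram identity
  makes the gradients of a minimising sequence Cauchy, and Poincare carries this over to the
  functions. The weak equation says that the first variation of \<open>J\<close> vanishes in the
  limit.\<close>

lemma poisson_exists:
  assumes F: "continuous_on UNIV F"
  shows "\<exists>u g \<phi>. poisson F u g \<phi>"
proof -
  obtain c where c: "c \<ge> 0" "\<And>\<phi>. test_function \<Omega> \<phi> \<Longrightarrow> l2 \<mu> \<phi> \<le> c * l2 \<mu> (gradient \<phi>)"
    using poincare by blast
  have sF: "sqi \<mu> F" by (rule continuous_sqi[OF F])
  define J where "J \<phi> = (l2 \<mu> (gradient \<phi>))\<^sup>2 - 2 * (LINT x|\<mu>. F x * \<phi> x)" for \<phi>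
  have J: "J (\<lambda>x. \<phi> x + t * \<psi> x) = J \<phi> + 2 * t * ((LINT x|\<mu>. gradient \<phi> x \<bullet> gradient \<psi> x) - (LINT x|\<mu>. F x * \<psi> x))
      + t\<^sup>2 * (l2 \<mu> (gradient \<psi>))\<^sup>2" if s: "smooth \<phi>" "smooth \<psi>" for \<phi> \<psi> t
  proof -
    have "integrable \<mu> (\<lambda>x. F x * \<phi> x)" "integrable \<mu> (\<lambda>x. F x * \<psi> x)"
      using sqi_integrable_inner[OF sF smooth_sqi[OF s(1)]] sqi_integrable_inner[OF sF smooth_sqi[OF s(2)]] by auto
    then have "(LINT x|\<mu>. F x * (\<phi> x + t * \<psi> x)) = (LINT x|\<mu>. F x * \<phi> x) + t * (LINT x|\<mu>. F x * \<psi> x)"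
      by (simp add: distrib_left mult.left_commute)
    moreover have "gradient (\<lambda>x. \<phi> x + t * \<psi> x) = (\<lambda>x. gradient \<phi> x + t *\<^sub>R gradient \<psi> x)"
      by (simp add: fun_eq_iff gradient_add gradient_cmult s smooth_cmult)
    ultimately show ?thesis
      using l2_expand[OF smooth_gradient_sqi[OF s(1)] smooth_gradient_sqi[OF s(2)], of t]
      by (simp add: J_def algebra_simps)
  qed
  define T where "T = Collect (test_function \<Omega>)"
  \<comment> \<open>With X the norm of the gradient and a = |F| c, \<open>J \<phi>\<close> is at
    least X^2 - 2 a X, hence at least -a^2.\<close>
  have "J \<phi> \<ge> - (l2 \<mu> F * c)\<^sup>2" if "\<phi> \<in> T" for \<phi>
  proof -
    have \<phi>: "test_function \<Omega> \<phi>" "smooth \<phi>" using that by (auto simp: T_def test_function_smooth)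
    have "(LINT x|\<mu>. F x * \<phi> x) \<le> l2 \<mu> F * l2 \<mu> \<phi>"
      using l2_Cauchy_Schwarz[OF sF smooth_sqi[OF \<phi>(2)]] by simp
    also have "\<dots> \<le> l2 \<mu> F * (c * l2 \<mu> (gradient \<phi>))"
      by (intro mult_left_mono c(2) \<phi>) simp
    finally show ?thesis
      using zero_le_power2[of "l2 \<mu> (gradient \<phi>) - l2 \<mu> F * c"]
      unfolding J_def by (simp add: power2_diff algebra_simps)
  qed
  then have bdd: "bdd_below (J ` T)" by (auto intro!: bdd_belowI[of _ "- (l2 \<mu> F * c)\<^sup>2"])
  define m where "m = Inf (J ` T)"
  have m: "m \<le> J \<phi>" if "test_function \<Omega> \<phi>" for \<phi>
    unfolding m_def using bdd that by (intro cInf_lower) (auto simp: T_def)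
  have "\<exists>\<phi>. test_function \<Omega> \<phi> \<and> J \<phi> < m + 1 / Suc k" for k
  proof -
    have "J ` T \<noteq> {}" using test_function_0 by (auto simp: T_def)
    then have "\<exists>y\<in>J ` T. y < m + 1 / Suc k"
      using cInf_lessD[of "J ` T" "m + 1 / Suc k"] by (auto simp: m_def)
    then show ?thesis by (auto simp: T_def)
  qed
  then obtain \<phi> where \<phi>: "\<And>k. test_function \<Omega> (\<phi> k)" "\<And>k. J (\<phi> k) < m + 1 / Suc k" by metis
  have s\<phi>: "smooth (\<phi> k)" for k using \<phi>(1) by (rule test_function_smooth)
  have sd: "smooth (\<lambda>x. \<phi> i x - \<phi> j x)" for i j by (intro smooth_diff s\<phi>)
  \<comment> \<open>At the midpoint \<open>J\<close> is at least \<open>m\<close>. A quarter of the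
    squared distance of the gradients is the mean of the two values of \<open>J\<close> minus the
    value at the midpoint.\<close>
  have dist: "(l2 \<mu> (gradient (\<lambda>x. \<phi> i x - \<phi> j x)))\<^sup>2 \<le> 2 * (1 / Suc i + 1 / Suc j)" for i j
  proof -
    have "J (\<phi> i) = J (\<lambda>x. \<phi> j x + 1 * (\<phi> i x - \<phi> j x))" by simp
    note 1 = this[unfolded J[OF s\<phi>[of j] sd[of i j]]]
    note 2 = J[OF s\<phi>[of j] sd[of i j], of "1/2"]
    have "m \<le> J (\<lambda>x. \<phi> j x + 1/2 * (\<phi> i x - \<phi> j x))"
      by (intro m test_function_add test_function_cmult test_function_diff \<phi>)
    then show ?thesis using 1 2 \<phi>(2)[of i] \<phi>(2)[of j] by (simp add: power2_eq_square)
  qed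
  have cauchy: "\<exists>N. \<forall>i\<ge>N. \<forall>j\<ge>N. l2 \<mu> (gradient (\<lambda>x. \<phi> i x - \<phi> j x)) < e" if "e > 0" for e
  proof -
    obtain N where N: "1 / real (Suc N) < e\<^sup>2 / 4"
      using reals_Archimedean[of "e\<^sup>2 / 4"] \<open>e > 0\<close> by (auto simp: inverse_eq_divide)
    have "l2 \<mu> (gradient (\<lambda>x. \<phi> i x - \<phi> j x)) < e" if "i \<ge> N" "j \<ge> N" for i j
    proof -
      have "1 / Suc i \<le> 1 / Suc N" "1 / Suc j \<le> 1 / Suc N" using that by (auto simp: field_simps)
      then have "(l2 \<mu> (gradient (\<lambda>x. \<phi> i x - \<phi> j x)))\<^sup>2 < e\<^sup>2"
        using dist[of i j] N
          le_less_trans[of "(l2 \<mu> (gradient (\<lambda>x. \<phi> i x - \<phi> j x)))\<^sup>2" "4 * (1 / real (Suc N))" "e\<^sup>2"] by (auto simp: algebra_simps)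
      then show ?thesis by (rule power2_less_imp_less) (use \<open>e > 0\<close> in simp)
    qed
    then show ?thesis by blast
  qed
  have "\<exists>g. sqi \<mu> g \<and> (\<lambda>k. l2 \<mu> (\<lambda>x. gradient (\<phi> k) x - g x)) \<longlonglongrightarrow> 0"
  proof (rule l2_complete)
    have "gradient (\<lambda>x. \<phi> i x - \<phi> j x) = (\<lambda>x. gradient (\<phi> i) x - gradient (\<phi> j) x)" for i j
      by (simp add: fun_eq_iff gradient_diff s\<phi>)
    then show "\<exists>N. \<forall>i\<ge>N. \<forall>j\<ge>N. l2 \<mu> (\<lambda>x. gradient (\<phi> i) x - gradient (\<phi> j) x) < e" if "e > 0" for e
      using cauchy[OF that] by simp
  qed (intro smooth_gradient_sqi s\<phi>)
  then obtain g where g: "sqi \<mu> g" "(\<lambda>k. l2 \<mu> (\<lambda>x. gradient (\<phi> k) x - g x)) \<longlonglongrightarrow> 0" by blast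
  have "\<exists>u. sqi \<mu> u \<and> (\<lambda>k. l2 \<mu> (\<lambda>x. \<phi> k x - u x)) \<longlonglongrightarrow> 0"
  proof (rule l2_complete)
    show "sqi \<mu> (\<phi> k)" for k by (intro smooth_sqi s\<phi>)
    fix e :: real assume "e > 0"
    \<comment> \<open>c + 1 is positive even if c = 0 and makes the final bound c e / (c + 1) < e
      strict.\<close>
    then have "e / (c + 1) > 0" using c(1) by simp
    then obtain N where N: "\<And>i j. i \<ge> N \<Longrightarrow> j \<ge> N \<Longrightarrow> l2 \<mu> (gradient (\<lambda>x. \<phi> i x - \<phi> j x)) < e / (c + 1)"
      using cauchy by blast
    have "l2 \<mu> (\<lambda>x. \<phi> i x - \<phi> j x) < e" if "i \<ge> N" "j \<ge> N" for i j
    proof -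
      have "l2 \<mu> (\<lambda>x. \<phi> i x - \<phi> j x) \<le> c * l2 \<mu> (gradient (\<lambda>x. \<phi> i x - \<phi> j x))"
        by (intro c(2) test_function_diff \<phi>)
      also have "\<dots> \<le> c * (e / (c + 1))"
        using N[OF that] c(1) by (intro mult_left_mono) auto
      also have "\<dots> < e" using c(1) \<open>e > 0\<close> by (simp add: field_simps)
      finally show ?thesis .
    qed
    then show "\<exists>N. \<forall>i\<ge>N. \<forall>j\<ge>N. l2 \<mu> (\<lambda>x. \<phi> i x - \<phi> j x) < e" by blast
  qed
  then obtain u where u: "sqi \<mu> u" "(\<lambda>k. l2 \<mu> (\<lambda>x. \<phi> k x - u x)) \<longlonglongrightarrow> 0" by blast
  have "(\<lambda>k. J (\<phi> k) - m) \<longlonglongrightarrow> 0"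
  proof (rule Lim_null_comparison[OF always_eventually])
    show "\<forall>k. norm (J (\<phi> k) - m) \<le> 1 / Suc k"
      using m[OF \<phi>(1)] \<phi>(2) by (auto simp: abs_le_iff intro: less_imp_le) (smt (verit))
    show "(\<lambda>k. 1 / real (Suc k)) \<longlonglongrightarrow> 0" by (rule LIMSEQ_Suc[OF lim_1_over_n])
  qed
  then have Jm: "(\<lambda>k. J (\<phi> k)) \<longlonglongrightarrow> m" by (simp add: LIM_zero_iff)
  have "(LINT x|\<mu>. g x \<bullet> gradient \<psi> x) = (LINT x|\<mu>. F x * \<psi> x)" if \<psi>: "test_function \<Omega> \<psi>" for \<psi>
  proof -
    have s: "smooth \<psi>" using \<psi> by (rule test_function_smooth)
    \<comment> \<open>The first variation in the direction \<psi>. Minimality gives 0 \<le> 2 t L +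
      t^2 |grad \<psi>|^2 for every t, so the discriminant criterion forces L = 0.\<close>
    define L where "L = (LINT x|\<mu>. g x \<bullet> gradient \<psi> x) - (LINT x|\<mu>. F x * \<psi> x)"
    have "L\<^sup>2 \<le> 0 * (l2 \<mu> (gradient \<psi>))\<^sup>2"
    proof (rule quadratic_nonneg_imp)
      fix t
      have "(\<lambda>k. J (\<phi> k) + 2 * t * ((LINT x|\<mu>. gradient (\<phi> k) x \<bullet> gradient \<psi> x) - (LINT x|\<mu>. F x * \<psi> x)) + t\<^sup>2 * (l2 \<mu> (gradient \<psi>))\<^sup>2)
        \<longlonglongrightarrow> m + 2 * t * L + t\<^sup>2 * (l2 \<mu> (gradient \<psi>))\<^sup>2"
        unfolding L_def by (intro tendsto_intros Jm l2_inner_tendsto smooth_gradient_sqi s\<phi> g s)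
      then have "m \<le> m + 2 * t * L + t\<^sup>2 * (l2 \<mu> (gradient \<psi>))\<^sup>2"
      proof (rule LIMSEQ_le_const)
        show "\<exists>N. \<forall>k\<ge>N. m \<le> J (\<phi> k) + 2 * t * ((LINT x|\<mu>. gradient (\<phi> k) x \<bullet> gradient \<psi> x) - (LINT x|\<mu>. F x * \<psi> x)) + t\<^sup>2 * (l2 \<mu> (gradient \<psi>))\<^sup>2"
          unfolding J[OF s\<phi> s, symmetric]
          by (intro exI allI impI m test_function_add test_function_cmult \<phi> \<psi>)
      qed
      then show "0 \<le> 0 + 2 * t * L + t\<^sup>2 * (l2 \<mu> (gradient \<psi>))\<^sup>2" by simp
    qed simp
    then show ?thesis by (simp add: L_def)
  qed
  then have "poisson F u g \<phi>"
    unfolding poisson_def using u g \<phi> by blast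
  then show ?thesis by blast
qed

lemma torsion_exists_unique:
  "\<exists>u. torsion_function \<Omega> u \<and> (\<forall>v. torsion_function \<Omega> v \<longrightarrow> (AE x in \<mu>. v x = u x))"
proof -
  obtain u g \<phi> where P: "poisson (\<lambda>x. 1) u g \<phi>"
    using poisson_exists[of "\<lambda>x. 1"] by auto
  have "AE x in \<mu>. v x = u x" if "torsion_function \<Omega> v" for v
    using torsion_imp_poisson[OF that] poisson_unique[OF _ P] by (metis continuous_on_const)
  then show ?thesis using poisson_imp_torsion[OF P] by blast
qed

lemma torsion_le_supersolution:
  assumes u: "torsion_function \<Omega> u" and W: "smooth W" "\<And>x. x \<in> \<Omega> \<Longrightarrow> laplacian W x \<le> -1" "\<And>x. x \<in> \<Omega> \<Longrightarrow> 0 \<le> W x"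
  shows "AE x in \<mu>. u x \<le> W x"
proof -
  obtain g \<phi> where P: "poisson (\<lambda>x. 1) u g \<phi>" using torsion_imp_poisson[OF u] .
  show ?thesis
    by (rule comparison[OF P _ W(1), of "{}"]) (use W in force)+
qed

text \<open>Comparison of \<open>- u\<close> with the paraboloid (|x - a|^2 - r^2) / (2 n). Its
  Laplacian is 1 and it is nonnegative outside the ball; the closed ball is the compact set on which
  it may be negative.\<close>

lemma torsion_ge_ball:
  assumes u: "torsion_function \<Omega> u" and r: "0 \<le> r" "cball a r \<subseteq> \<Omega>"
  shows "AE x in \<mu>. (r\<^sup>2 - (norm (x - a))\<^sup>2) / (2 * DIM('a)) \<le> u x"
proof -
  obtain g \<phi> where P: "poisson (\<lambda>x. 1) u g \<phi>" using torsion_imp_poisson[OF u] .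
  define n where "n = real DIM('a)"
  have "n > 0" by (simp add: n_def)
  define q where "q x = (\<Sum>b\<in>Basis. ((x \<bullet> b) - a \<bullet> b)^2)" for x :: 'a
  have sb: "smooth (\<lambda>x. (x \<bullet> b) - a \<bullet> b)" for b :: 'a by (intro smooth_diff smooth_inner smooth_const)
  have q: "smooth q" unfolding q_def by (intro smooth_sum smooth_power sb)
  have qn: "q x = (norm (x - a))\<^sup>2" for x
    unfolding q_def power2_norm_eq_inner by (subst euclidean_inner) (simp add: inner_diff_left power2_eq_square)
  have qp: "partial b q = (\<lambda>x. 2 * (x \<bullet> b) - 2 * (a \<bullet> b))" for b
  proof
    fix x
    have "(q has_derivative (\<lambda>h. 2 * ((x - a) \<bullet> h))) (at x)"
      unfolding qn[abs_def] power2_norm_eq_inner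
      by (auto intro!: derivative_eq_intros simp: inner_commute)
    from partial_eqI[OF this] show "partial b q x = 2 * (x \<bullet> b) - 2 * (a \<bullet> b)"
      by (simp add: inner_diff_left)
  qed
  have "partial b (partial b q) x = 2" if "b \<in> Basis" for b x
  proof -
    have "((\<lambda>x. 2 * (x \<bullet> b) - 2 * (a \<bullet> b)) has_derivative (\<lambda>h. 2 * (h \<bullet> b))) (at x)"
      by (auto intro!: derivative_eq_intros)
    from partial_eqI[OF this] show ?thesis unfolding qp using that by simp
  qed
  then have lq: "laplacian q x = 2 * n" for x by (simp add: laplacian_def n_def)
  define W where "W x = (1 / (2 * n)) * (q x + (- r\<^sup>2))" for x
  have s: "smooth (\<lambda>x. q x + (- r\<^sup>2))" by (intro smooth_add q smooth_const)
  have pW: "partial b W x = (1 / (2 * n)) * partial b q x" for b x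
    unfolding W_def[abs_def] by (subst partial_cmult[OF s])
      (simp add: partial_add smooth_differentiable q del: add_uminus_conv_diff)
  then have "partial b (partial b W) x = (1 / (2 * n)) * partial b (partial b q) x" if "b \<in> Basis" for b x
    using partial_cmult[OF smooth_partial[OF q that], of b "1 / (2 * n)" x] by (simp add: pW[abs_def])
  then have "laplacian W x = (1 / (2 * n)) * laplacian q x" for x
    by (simp add: laplacian_def sum_divide_distrib)
  then have lW: "laplacian W x = 1" for x using \<open>n > 0\<close> by (simp add: lq)
  have "AE x in \<mu>. - u x \<le> W x"
  proof (rule comparison[OF poisson_uminus[OF P]])
    show "smooth W" unfolding W_def[abs_def] by (intro smooth_cmult s)
    show "compact (cball a r)" "cball a r \<subseteq> \<Omega>" using r by auto
    show "0 \<le> W x" if "x \<notin> cball a r" for x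
    proof -
      have "r \<le> norm (x - a)" using that by (auto simp: dist_norm norm_minus_commute)
      from power_mono[OF this r(1), of 2] show ?thesis
        using \<open>n > 0\<close> by (simp add: W_def qn)
    qed
  qed (auto simp: lW)
  then show ?thesis
    by eventually_elim (simp add: W_def qn n_def field_simps)
qed

end

subsection \<open>Hausdorff measure\<close>

definition hausdorff_cost :: "nat \<Rightarrow> 'a::euclidean_space set \<Rightarrow> ennreal" where
  "hausdorff_cost k U = (if U = {} then 0 else ennreal (unit_ball_vol (real k) * (diameter U / 2) ^ k))"

definition fine_cover :: "real \<Rightarrow> 'a::euclidean_space set \<Rightarrow> (nat \<Rightarrow> 'a set) \<Rightarrow> bool" where
  "fine_cover \<epsilon> E U \<longleftrightarrow> E \<subseteq> (\<Union>i. U i) \<and> (\<forall>i. bounded (U i) \<and> diameter (U i) \<le> \<epsilon>)"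

lemma hausdorff_premeasure_alt:
  "hausdorff_premeasure k \<epsilon> E = (INF U\<in>Collect (fine_cover \<epsilon> E). \<Sum>i. hausdorff_cost k (U i))"
  by (simp add: hausdorff_premeasure_def fine_cover_def[abs_def] hausdorff_cost_def)

lemma hausdorff_cost_empty [simp]: "hausdorff_cost k {} = 0"
  by (simp add: hausdorff_cost_def)

lemma hausdorff_premeasure_le:
  "fine_cover \<epsilon> E U \<Longrightarrow> hausdorff_premeasure k \<epsilon> E \<le> (\<Sum>i. hausdorff_cost k (U i))"
  unfolding hausdorff_premeasure_alt by (rule INF_lower) simp

lemma hausdorff_premeasure_greatest:
  "(\<And>U. fine_cover \<epsilon> E U \<Longrightarrow> c \<le> (\<Sum>i. hausdorff_cost k (U i))) \<Longrightarrow> c \<le> hausdorff_premeasure k \<epsilon> E"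
  unfolding hausdorff_premeasure_alt by (rule INF_greatest) simp

lemma hausdorff_premeasure_mono: "E \<subseteq> E' \<Longrightarrow> hausdorff_premeasure k \<epsilon> E \<le> hausdorff_premeasure k \<epsilon> E'"
  by (rule hausdorff_premeasure_greatest, rule hausdorff_premeasure_le) (auto simp: fine_cover_def)

lemma hausdorff_premeasure_antimono: "\<epsilon> \<le> \<epsilon>' \<Longrightarrow> hausdorff_premeasure k \<epsilon>' E \<le> hausdorff_premeasure k \<epsilon> E"
  by (rule hausdorff_premeasure_greatest, rule hausdorff_premeasure_le) (auto simp: fine_cover_def intro: order.trans)

text \<open>Covers of \<open>A\<close> and \<open>B\<close> that come within e/2 of the infima are
  interleaved, one on the even and one on the odd indices.\<close>

lemma hausdorff_premeasure_Un:
  "hausdorff_premeasure k \<epsilon> (A \<union> B) \<le> hausdorff_premeasure k \<epsilon> A + hausdorff_premeasure k \<epsilon> B"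
proof (rule ennreal_le_epsilon)
  fix e :: real assume fin: "hausdorff_premeasure k \<epsilon> A + hausdorff_premeasure k \<epsilon> B < top" and e: "0 < e"
  have "\<exists>U. fine_cover \<epsilon> E U \<and> (\<Sum>i. hausdorff_cost k (U i)) \<le> hausdorff_premeasure k \<epsilon> E + ennreal (e/2)"
    if "hausdorff_premeasure k \<epsilon> E < top" for E :: "'a set"
  proof -
    have "hausdorff_premeasure k \<epsilon> E < hausdorff_premeasure k \<epsilon> E + ennreal (e/2)"
      using that e by (metis add.right_neutral ennreal_add_left_cancel_less ennreal_less_zero_iff half_gt_zero
          order_less_le infinity_ennreal_def)
    then obtain U where "U \<in> Collect (fine_cover \<epsilon> E)" "(\<Sum>i. hausdorff_cost k (U i)) < hausdorff_premeasure k \<epsilon> E + ennreal (e/2)"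
      unfolding hausdorff_premeasure_alt INF_less_iff by blast
    then show ?thesis by (auto intro: less_imp_le)
  qed
  then obtain U V where U: "fine_cover \<epsilon> A U" "(\<Sum>i. hausdorff_cost k (U i)) \<le> hausdorff_premeasure k \<epsilon> A + ennreal (e/2)"
    and V: "fine_cover \<epsilon> B V" "(\<Sum>i. hausdorff_cost k (V i)) \<le> hausdorff_premeasure k \<epsilon> B + ennreal (e/2)"
    using fin by (metis add.commute add_top ennreal_add_eq_top top.not_eq_extremum)
  define W where "W n = (if even n then U (n div 2) else V (n div 2))" for n
  have W: "fine_cover \<epsilon> (A \<union> B) W"
  proof -
    have "U i \<subseteq> (\<Union>n. W n)" "V i \<subseteq> (\<Union>n. W n)" for i
    proof -
      have "W (2 * i) = U i" "W (2 * i + 1) = V i" by (auto simp: W_def)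
      then show "U i \<subseteq> (\<Union>n. W n)" "V i \<subseteq> (\<Union>n. W n)" by blast+
    qed
    then have "A \<union> B \<subseteq> (\<Union>n. W n)" using U(1) V(1) unfolding fine_cover_def by blast
    then show ?thesis using U(1) V(1) by (auto simp: fine_cover_def W_def)
  qed
  let ?c = "hausdorff_cost k"
  have part: "(\<Sum>i<2 * n. ?c (W i)) = (\<Sum>i<n. ?c (U i)) + (\<Sum>i<n. ?c (V i))" for n
    by (induction n) (auto simp: W_def add_ac)
  have "(\<lambda>n. \<Sum>i<2 * n. ?c (W i)) \<longlonglongrightarrow> (\<Sum>i. ?c (W i))"
    using LIMSEQ_subseq_LIMSEQ[OF summable_LIMSEQ[OF summableI], of "\<lambda>n. 2 * n"]
    by (auto simp: strict_mono_def o_def)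
  moreover have "(\<lambda>n. \<Sum>i<2 * n. ?c (W i)) \<longlonglongrightarrow> (\<Sum>i. ?c (U i)) + (\<Sum>i. ?c (V i))"
    unfolding part by (intro tendsto_add summable_LIMSEQ summableI)
  ultimately have "(\<Sum>i. ?c (W i)) = (\<Sum>i. ?c (U i)) + (\<Sum>i. ?c (V i))"
    by (rule LIMSEQ_unique)
  then have "hausdorff_premeasure k \<epsilon> (A \<union> B) \<le> (\<Sum>i. ?c (U i)) + (\<Sum>i. ?c (V i))"
    using hausdorff_premeasure_le[OF W] by metis
  also have "\<dots> \<le> (hausdorff_premeasure k \<epsilon> A + ennreal (e/2)) + (hausdorff_premeasure k \<epsilon> B + ennreal (e/2))"
    by (intro add_mono U V)
  also have "\<dots> = (hausdorff_premeasure k \<epsilon> A + hausdorff_premeasure k \<epsilon> B) + (ennreal (e/2) + ennreal (e/2))"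
    by (simp add: add_ac)
  also have "ennreal (e/2) + ennreal (e/2) = ennreal e"
    using e by (simp flip: ennreal_plus)
  finally show "hausdorff_premeasure k \<epsilon> (A \<union> B) \<le> hausdorff_premeasure k \<epsilon> A + hausdorff_premeasure k \<epsilon> B + ennreal e" .
qed

lemma hausdorff_premeasure_empty: "0 \<le> \<epsilon> \<Longrightarrow> hausdorff_premeasure k \<epsilon> {} = 0"
  using hausdorff_premeasure_le[of \<epsilon> "{}" "\<lambda>_. {}" k] by (simp add: fine_cover_def)

lemma hausdorff_measure_mono: "E \<subseteq> E' \<Longrightarrow> hausdorff_measure k E \<le> hausdorff_measure k E'"
  unfolding hausdorff_measure_def by (intro SUP_mono) (auto intro: hausdorff_premeasure_mono)

lemma hausdorff_premeasure_le_measure: "0 < \<epsilon> \<Longrightarrow> hausdorff_premeasure k \<epsilon> E \<le> hausdorff_measure k E"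
  unfolding hausdorff_measure_def by (intro SUP_upper) auto

lemma hausdorff_measure_Un: "hausdorff_measure k (A \<union> B) \<le> hausdorff_measure k A + hausdorff_measure k B"
  unfolding hausdorff_measure_def[of k "A \<union> B"]
  by (intro SUP_least order.trans[OF hausdorff_premeasure_Un] add_mono hausdorff_premeasure_le_measure) auto

lemma hausdorff_measure_empty [simp]: "hausdorff_measure k {} = 0"
  unfolding hausdorff_measure_def by (simp add: hausdorff_premeasure_empty)

lemma hausdorff_measure_UN:
  "finite I \<Longrightarrow> hausdorff_measure k (\<Union>i\<in>I. A i) \<le> (\<Sum>i\<in>I. hausdorff_measure k (A i))"
proof (induction I rule: finite_induct)
  case (insert i I)
  have "hausdorff_measure k (\<Union>i\<in>insert i I. A i) \<le> hausdorff_measure k (A i) + hausdorff_measure k (\<Union>i\<in>I. A i)"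
    using hausdorff_measure_Un by simp
  then show ?case using insert by (simp add: add_left_mono order.trans)
qed simp

text \<open>A supremum over an increasing sequence can be exchanged with a finite sum, as is done in
  \<open>hausdorff_measure_separated\<close>.\<close>

lemma hausdorff_measure_seq:
  assumes "0 < d"
  shows "hausdorff_measure k E = (SUP n. hausdorff_premeasure k (d / Suc n) E)"
proof (rule antisym)
  show "hausdorff_measure k E \<le> (SUP n. hausdorff_premeasure k (d / Suc n) E)"
    unfolding hausdorff_measure_def
  proof (rule SUP_least)
    fix \<epsilon> :: real assume "\<epsilon> \<in> {0<..}"
    then obtain n where "inverse (Suc n) < \<epsilon> / d"
      using reals_Archimedean[of "\<epsilon> / d"] assms by auto
    then have "d / Suc n \<le> \<epsilon>" using assms by (simp add: field_simps)
    then show "hausdorff_premeasure k \<epsilon> E \<le> (SUP n. hausdorff_premeasure k (d / Suc n) E)"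
      by (intro SUP_upper2[of n] hausdorff_premeasure_antimono) auto
  qed
qed (use assms in \<open>auto intro!: SUP_least hausdorff_premeasure_le_measure\<close>)

text \<open>The metric outer measure property. A covering set of diameter below \<eta> meets at most
  one \<open>A i\<close>, so a fine cover of \<open>E\<close> splits into covers of the pieces
  without counting any set twice.\<close>

lemma hausdorff_measure_separated:
  fixes A :: "'i \<Rightarrow> 'a::euclidean_space set"
  assumes I: "finite I" and \<eta>: "0 < \<eta>" and sub: "\<And>i. i \<in> I \<Longrightarrow> A i \<subseteq> E"
    and sep: "\<And>i j x y. i \<in> I \<Longrightarrow> j \<in> I \<Longrightarrow> i \<noteq> j \<Longrightarrow> x \<in> A i \<Longrightarrow> y \<in> A j \<Longrightarrow> \<eta> \<le> dist x y"
  shows "(\<Sum>i\<in>I. hausdorff_measure k (A i)) \<le> hausdorff_measure k E"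
proof -
  have pre: "(\<Sum>i\<in>I. hausdorff_premeasure k \<epsilon> (A i)) \<le> hausdorff_premeasure k \<epsilon> E" if \<epsilon>: "0 < \<epsilon>" "\<epsilon> < \<eta>" for \<epsilon>
  proof (rule hausdorff_premeasure_greatest)
    fix U assume U: "fine_cover \<epsilon> E U"
    define V where "V i n = (if U n \<inter> A i = {} then {} else U n)" for i n
    have "(\<Sum>i\<in>I. hausdorff_premeasure k \<epsilon> (A i)) \<le> (\<Sum>i\<in>I. \<Sum>n. hausdorff_cost k (V i n))"
    proof (intro sum_mono hausdorff_premeasure_le)
      fix i assume "i \<in> I"
      have "A i \<subseteq> (\<Union>n. V i n)"
      proof
        fix x assume x: "x \<in> A i"
        then obtain n where "x \<in> U n"
          using sub[OF \<open>i \<in> I\<close>] U unfolding fine_cover_def by blast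
        then have "x \<in> V i n" using x by (auto simp: V_def)
        then show "x \<in> (\<Union>n. V i n)" by blast
      qed
      then show "fine_cover \<epsilon> (A i) (V i)"
        using U \<epsilon> by (auto simp: fine_cover_def V_def)
    qed
    also have "\<dots> = (\<Sum>n. \<Sum>i\<in>I. hausdorff_cost k (V i n))"
      by (rule suminf_sum[symmetric]) simp
    also have "\<dots> \<le> (\<Sum>n. hausdorff_cost k (U n))"
    proof (rule suminf_le)
      fix n
      show "(\<Sum>i\<in>I. hausdorff_cost k (V i n)) \<le> hausdorff_cost k (U n)"
      proof (cases "\<exists>i\<in>I. U n \<inter> A i \<noteq> {}")
        case True
        then obtain i x where i: "i \<in> I" "x \<in> U n" "x \<in> A i" by blast
        have "V j n = {}" if "j \<in> I - {i}" for j
        proof (rule ccontr)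
          assume "V j n \<noteq> {}"
          then obtain y where "y \<in> U n" "y \<in> A j" by (auto simp: V_def split: if_splits)
          then have "\<eta> \<le> dist x y" using sep[of i j x y] i that by auto
          moreover have "dist x y \<le> diameter (U n)"
            using U i \<open>y \<in> U n\<close> by (intro diameter_bounded_bound) (auto simp: fine_cover_def)
          ultimately show False using U \<epsilon> unfolding fine_cover_def by (meson leD order.trans)
        qed
        then have "(\<Sum>j\<in>I. hausdorff_cost k (V j n)) = (\<Sum>j\<in>{i}. hausdorff_cost k (V j n))"
          using I i by (intro sum.mono_neutral_right) auto
        then show ?thesis by (simp add: V_def)
      qed (simp add: V_def)
    qed simp_all
    finally show "(\<Sum>i\<in>I. hausdorff_premeasure k \<epsilon> (A i)) \<le> (\<Sum>n. hausdorff_cost k (U n))" .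
  qed
  \<comment> \<open>The scales (\<eta>/2) / (n + 1) all lie strictly below \<eta>, as
    \<open>pre\<close> demands.\<close>
  have "0 < \<eta> / 2" using \<eta> by simp
  note seq = hausdorff_measure_seq[OF this, of k]
  have "(\<Sum>i\<in>I. hausdorff_measure k (A i)) = (SUP n. \<Sum>i\<in>I. hausdorff_premeasure k (\<eta> / 2 / Suc n) (A i))"
    unfolding seq
    by (intro ennreal_SUP_sum[symmetric] monoI hausdorff_premeasure_antimono)
       (use \<eta> in \<open>auto simp: incseq_def intro!: hausdorff_premeasure_antimono divide_left_mono\<close>)
  also have "\<dots> \<le> (SUP n. hausdorff_premeasure k (\<eta> / 2 / Suc n) E)"
  proof (intro SUP_mono)
    fix n
    have "\<eta> / 2 / Suc n \<le> \<eta> / 2" using \<eta> by (simp add: field_simps)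
    then have "\<eta> / 2 / Suc n < \<eta>" using \<eta> by linarith
    then show "\<exists>m\<in>UNIV. (\<Sum>i\<in>I. hausdorff_premeasure k (\<eta> / 2 / Suc n) (A i)) \<le> hausdorff_premeasure k (\<eta> / 2 / Suc m) E"
      using \<eta> by (intro bexI[of _ n] pre) auto
  qed
  also have "\<dots> = hausdorff_measure k E" by (rule seq[symmetric])
  finally show ?thesis .
qed

text \<open>The unit ball of the line has length 2, which cancels the halving of the
  diameter.\<close>

lemma hausdorff_cost_1: "bounded U \<Longrightarrow> U \<noteq> {} \<Longrightarrow> hausdorff_cost (Suc 0) U = ennreal (diameter U)"
  by (simp add: hausdorff_cost_def unit_ball_vol_1 eval_unit_ball_vol)

text \<open>A covering set is mapped into an interval of length twice its diameter, centred at the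
  image of one of its points in \<open>E\<close>; this is the origin of the factor 2. Applied to a
  coordinate projection it gives the lower Ahlfors bound for the cusp. The premeasure at scale 1
  suffices, since the measure dominates it.\<close>

lemma interval_le_hausdorff_measure:
  fixes f :: "'a::euclidean_space \<Rightarrow> real"
  assumes f: "\<And>x y. x \<in> E \<Longrightarrow> y \<in> E \<Longrightarrow> \<bar>f x - f y\<bar> \<le> dist x y" and I: "{a..b} \<subseteq> f ` E"
  shows "ennreal (b - a) \<le> 2 * hausdorff_measure (Suc 0) E"
proof -
  have "ennreal ((b - a) / 2) \<le> hausdorff_premeasure (Suc 0) 1 E"
  proof (rule hausdorff_premeasure_greatest)
    fix U assume U: "fine_cover 1 E U"
    define J where "J n = (if U n \<inter> E = {} then {} else
      (let z = (SOME z. z \<in> U n \<inter> E) in {f z - diameter (U n)..f z + diameter (U n)}))" for n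
    have bU: "bounded (U n)" for n using U by (simp add: fine_cover_def)
    have J: "f ` (U n \<inter> E) \<subseteq> J n \<and> emeasure lborel (J n) \<le> 2 * hausdorff_cost (Suc 0) (U n)" for n
    proof (cases "U n \<inter> E = {}")
      case False
      define z where "z = (SOME z. z \<in> U n \<inter> E)"
      have z: "z \<in> U n" "z \<in> E" using someI_ex[of "\<lambda>z. z \<in> U n \<inter> E"] False by (auto simp: z_def)
      have Jn: "J n = {f z - diameter (U n)..f z + diameter (U n)}"
        using False by (simp add: J_def z_def Let_def)
      have "f x \<in> J n" if "x \<in> U n" "x \<in> E" for x
        using f[OF that(2) z(2)] diameter_bounded_bound[OF bU that(1) z(1)] unfolding Jn by auto
      moreover have "emeasure lborel (J n) = ennreal (2 * diameter (U n))"
        unfolding Jn using diameter_ge_0[OF bU] by simp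
      moreover have "ennreal (2 * diameter (U n)) = 2 * hausdorff_cost (Suc 0) (U n)"
      proof -
        have "U n \<noteq> {}" using z by blast
        then show ?thesis
          using hausdorff_cost_1[OF bU, of n] diameter_ge_0[OF bU, of n] by (simp add: ennreal_mult')
      qed
      ultimately show ?thesis by auto
    qed (simp add: J_def)
    have JB: "J n \<in> sets lborel" for n by (simp add: J_def Let_def)
    have "{a..b} \<subseteq> (\<Union>n. J n)"
    proof
      fix t assume "t \<in> {a..b}"
      then obtain x where x: "x \<in> E" "t = f x" using I by blast
      then obtain n where "x \<in> U n" using U unfolding fine_cover_def by blast
      then have "t \<in> J n" using J[of n] x by blast
      then show "t \<in> (\<Union>n. J n)" by blast
    qed
    then have "emeasure lborel {a..b} \<le> emeasure lborel (\<Union>n. J n)"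
      using JB by (intro emeasure_mono sets.countable_UN) auto
    also have "\<dots> \<le> (\<Sum>n. emeasure lborel (J n))"
      using JB by (intro emeasure_subadditive_countably) auto
    also have "\<dots> \<le> (\<Sum>n. 2 * hausdorff_cost (Suc 0) (U n))"
      using J by (intro suminf_le) auto
    also have "\<dots> = 2 * (\<Sum>n. hausdorff_cost (Suc 0) (U n))" by (simp add: ennreal_suminf_cmult)
    finally have "ennreal (b - a) \<le> 2 * (\<Sum>n. hausdorff_cost (Suc 0) (U n))"
      by (cases "a \<le> b") (auto simp: ennreal_neg)
    then show "ennreal ((b - a) / 2) \<le> (\<Sum>n. hausdorff_cost (Suc 0) (U n))"
    proof (cases "(\<Sum>n. hausdorff_cost (Suc 0) (U n))")
      case (real r)
      then have "ennreal (b - a) \<le> ennreal (2 * r)"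
        using \<open>ennreal (b - a) \<le> _\<close> by (simp add: ennreal_mult')
      then show ?thesis using real by (simp add: ennreal_le_iff)
    qed simp
  qed
  also have "\<dots> \<le> hausdorff_measure (Suc 0) E" by (rule hausdorff_premeasure_le_measure) simp
  finally have "2 * ennreal ((b - a) / 2) \<le> 2 * hausdorff_measure (Suc 0) E"
    by (rule mult_left_mono) simp
  moreover have "2 * ennreal ((b - a) / 2) = ennreal (b - a)"
  proof -
    have e: "2 * ((b - a) / 2) = b - a" by simp
    show ?thesis using ennreal_mult'[of 2 "(b - a) / 2"] unfolding e by simp
  qed
  ultimately show ?thesis by simp
qed

text \<open>N equal subintervals of length h have images of diameter at most L h, and the costs add
  up to N L h = L (b - a) at every scale.\<close>

lemma hausdorff_measure_lipschitz_curve: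
  fixes \<gamma> :: "real \<Rightarrow> 'a::euclidean_space"
  assumes \<gamma>: "\<And>s t. s \<in> {a..b} \<Longrightarrow> t \<in> {a..b} \<Longrightarrow> dist (\<gamma> s) (\<gamma> t) \<le> L * \<bar>s - t\<bar>" and L: "0 \<le> L"
  shows "hausdorff_measure (Suc 0) (\<gamma> ` {a..b}) \<le> ennreal (L * (b - a))"
proof (cases "a \<le> b")
  case True
  show ?thesis
    unfolding hausdorff_measure_def
  proof (rule SUP_least)
    fix \<epsilon> :: real assume "\<epsilon> \<in> {0<..}"
    then have \<epsilon>: "\<epsilon> > 0" by simp
    define c where "c = L * (b - a)"
    have c: "0 \<le> c" using L True by (simp add: c_def)
    \<comment> \<open>Chosen so that L h = c / N is at most \<epsilon>.\<close>
    obtain N where N: "c / \<epsilon> < real N" using reals_Archimedean2 by blast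
    then have N0: "N > 0" using c \<epsilon> by (metis divide_nonneg_pos not_less of_nat_0 gr0I)
    define h where "h = (b - a) / N"
    have h: "0 \<le> h" "h * N = b - a" "L * h \<le> \<epsilon>" "N * (L * h) = c"
      using N N0 True \<epsilon> by (auto simp: h_def c_def field_simps)
    define U where "U i = (if i < N then \<gamma> ` {a + i * h..a + (i + 1) * h} else {})" for i :: nat
    have sub: "{a + i * h..a + (i + 1) * h} \<subseteq> {a..b}" if "i < N" for i :: nat
    proof -
      have "(real i + 1) * h \<le> N * h" using that h(1) by (intro mult_right_mono) auto
      then show ?thesis using h by (auto simp: algebra_simps)
    qed
    have dU: "bounded (U i) \<and> diameter (U i) \<le> L * h" for i
    proof (cases "i < N")
      case True
      have d: "dist x y \<le> L * h" if xy: "x \<in> U i" "y \<in> U i" for x y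
      proof -
        obtain s t where st: "x = \<gamma> s" "y = \<gamma> t" "s \<in> {a + i * h..a + (i + 1) * h}" "t \<in> {a + i * h..a + (i + 1) * h}"
          using xy True by (auto simp: U_def)
        then have "\<bar>s - t\<bar> \<le> h" by (auto simp: algebra_simps)
        then show ?thesis
          using \<gamma>[of s t] st(1,2) subsetD[OF sub[OF True] st(3)] subsetD[OF sub[OF True] st(4)]
            mult_left_mono[OF \<open>\<bar>s - t\<bar> \<le> h\<close> L] by simp
      qed
      have "U i \<noteq> {}" using True h by (auto simp: U_def algebra_simps)
      moreover have "bounded (U i)" unfolding bounded_two_points using d by blast
      ultimately show ?thesis using d by (auto intro: diameter_le simp: dist_norm)
    qed (use L h in \<open>simp add: U_def\<close>)
    have "fine_cover \<epsilon> (\<gamma> ` {a..b}) U"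
    proof -
      have "\<gamma> t \<in> (\<Union>i. U i)" if t: "t \<in> {a..b}" for t
      \<comment> \<open>For t = b the index given by the floor would be N, one too large. This case
        also takes care of a = b, where h = 0.\<close>
      proof (cases "t = b")
        case True
        have "b \<in> {a + (N - 1) * h..a + ((N - 1) + 1) * h}"
          using h N0 by (auto simp: algebra_simps of_nat_diff)
        then have "\<gamma> b \<in> U (N - 1)" using N0 by (auto simp: U_def of_nat_diff)
        then show ?thesis using True by blast
      next
        case False
        have "h > 0" using t False N0 by (auto simp: h_def)
        define i where "i = nat \<lfloor>(t - a) / h\<rfloor>"
        have q: "0 \<le> (t - a) / h" using t \<open>h > 0\<close> by auto
        then have i: "real i \<le> (t - a) / h" "(t - a) / h < real i + 1"
          by (auto simp: i_def)
        have "(t - a) / h < N" using t False h(2) \<open>h > 0\<close> by (auto simp: field_simps)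
        then have "i < N" using i by linarith
        moreover have "t \<in> {a + i * h..a + (i + 1) * h}"
          using i \<open>h > 0\<close> by (auto simp: field_simps)
        ultimately have "\<gamma> t \<in> U i" by (auto simp: U_def)
        then show ?thesis by blast
      qed
      then have "\<gamma> ` {a..b} \<subseteq> (\<Union>i. U i)" by blast
      moreover have "bounded (U i) \<and> diameter (U i) \<le> \<epsilon>" for i
        using dU[of i] h(3) by linarith
      ultimately show ?thesis by (simp add: fine_cover_def)
    qed
    from hausdorff_premeasure_le[OF this]
    have "hausdorff_premeasure (Suc 0) \<epsilon> (\<gamma> ` {a..b}) \<le> (\<Sum>i. hausdorff_cost (Suc 0) (U i))" .
    also have "\<dots> = (\<Sum>i<N. hausdorff_cost (Suc 0) (U i))"
      by (rule suminf_finite) (auto simp: U_def)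
    also have "\<dots> \<le> (\<Sum>i<N. ennreal (L * h))"
    proof (rule sum_mono)
      fix i assume "i \<in> {..<N}"
      have "hausdorff_cost (Suc 0) (U i) \<le> ennreal (diameter (U i))"
        using hausdorff_cost_1[of "U i"] dU[of i] by (cases "U i = {}") auto
      also have "\<dots> \<le> ennreal (L * h)" using dU by (intro ennreal_leI) auto
      finally show "hausdorff_cost (Suc 0) (U i) \<le> ennreal (L * h)" .
    qed
    also have "\<dots> = ennreal (N * (L * h))"
      using L h(1) by (simp add: ennreal_of_nat_eq_real_of_nat ennreal_mult'')
    finally show "hausdorff_premeasure (Suc 0) \<epsilon> (\<gamma> ` {a..b}) \<le> ennreal (L * (b - a))"
      using h(4) by (simp add: c_def)
  qed
qed simp

subsection \<open>Separated nets\<close>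

text \<open>A separated set of greatest cardinality: a point at distance at least r from all of it
  could be added. Cardinalities are bounded because two points at distance at least r cannot lie in
  the same ball of a finite cover by balls of radius r/2.\<close>

lemma compact_separated_net:
  fixes K :: "'a::euclidean_space set"
  assumes K: "compact K" and r: "0 < r"
  obtains P where "finite P" "P \<subseteq> K" "\<And>p q. p \<in> P \<Longrightarrow> q \<in> P \<Longrightarrow> p \<noteq> q \<Longrightarrow> r \<le> dist p q"
    "\<And>x. x \<in> K \<Longrightarrow> \<exists>p\<in>P. dist x p < r"
proof -
  define sep where "sep P \<longleftrightarrow> finite P \<and> P \<subseteq> K \<and> (\<forall>p\<in>P. \<forall>q\<in>P. p \<noteq> q \<longrightarrow> r \<le> dist p q)" for P
  obtain F where F: "finite F" "K \<subseteq> (\<Union>x\<in>F. ball x (r/2))"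
    using seq_compact_imp_totally_bounded[OF compact_imp_seq_compact[OF K], rule_format, of "r/2"] r by auto
  have card: "card P \<le> card F" if "sep P" for P
  proof -
    have "\<forall>p\<in>P. \<exists>x\<in>F. p \<in> ball x (r/2)" using that F(2) unfolding sep_def by blast
    then obtain f where f: "\<And>p. p \<in> P \<Longrightarrow> f p \<in> F \<and> p \<in> ball (f p) (r/2)" by metis
    have "inj_on f P"
    proof (rule inj_onI, rule ccontr)
      fix p q assume pq: "p \<in> P" "q \<in> P" "f p = f q" "p \<noteq> q"
      have "dist p q < r"
        using f[OF pq(1)] f[OF pq(2)] pq(3) dist_triangle_half_r[of "f p" p r q] by auto
      then show False using pq(1,2,4) that unfolding sep_def by (meson leD)
    qed
    then show ?thesis using f F(1) by (intro card_inj_on_le[of f]) auto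
  qed
  have "sep {}" by (simp add: sep_def)
  then obtain P where P: "sep P" "\<And>Q. sep Q \<Longrightarrow> card Q \<le> card P"
    using ex_has_greatest_nat[of sep "{}" card "card F + 1"] card le_imp_less_Suc by fastforce
  have "\<exists>p\<in>P. dist x p < r" if "x \<in> K" for x
  proof (rule ccontr)
    assume neg: "\<not> (\<exists>p\<in>P. dist x p < r)"
    then have "x \<notin> P" using r by force
    have "sep (insert x P)" using P(1) neg that by (auto simp: sep_def dist_commute not_less)
    then have "card (insert x P) \<le> card P" by (rule P(2))
    then show False using \<open>x \<notin> P\<close> P(1) by (simp add: sep_def)
  qed
  then show ?thesis using that P(1) by (auto simp: sep_def)
qed

subsection \<open>Negative powers of the distance to the boundary\<close>

text \<open>The integral is split along the dyadic layers \<open>r0 / 2 ^ Suc k \<le> d < r0 / 2 ^ k\<close>.\<close>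

lemma nn_integral_neg_powr_le:
  fixes d :: "'a \<Rightarrow> real"
  assumes d [measurable]: "d \<in> borel_measurable M" and "finite_measure M"
    and pos: "\<And>x. x \<in> space M \<Longrightarrow> 0 < d x"
    and s: "0 < s" "s < q" and r0: "0 < r0" and A: "0 \<le> A"
    and V: "\<And>r. 0 < r \<Longrightarrow> r \<le> r0 \<Longrightarrow> emeasure M {x\<in>space M. d x < r} \<le> ennreal (A * r powr q)"
  shows "(\<integral>\<^sup>+x. ennreal (d x powr (- s)) \<partial>M)
    \<le> ennreal (r0 powr (- s) * measure M (space M) + A * r0 powr (q - s) * 2 powr s / (1 - 2 powr (s - q)))"
proof -
  interpret finite_measure M by fact
  define c where "c k = r0 * 2 powr (- real k)" for k :: nat
  have c: "0 < c k" "c k \<le> r0" for k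
  proof -
    have "2 powr (- real k) \<le> 2 powr 0" by (intro powr_mono) auto
    then show "c k \<le> r0" using r0 mult_left_mono[of "2 powr (- real k)" 1 r0] by (simp add: c_def)
  qed (simp add: c_def r0)
  define w where "w k = (c (Suc k)) powr (- s)" for k
  \<comment> \<open>Points with r0 \<le> d x are covered by the constant. Any other point lies in a
    dyadic layer, where \<open>w k\<close> bounds the power, and the layer is enlarged to the
    sublevel set {d < c k} that \<open>V\<close> controls.\<close>
  have pt: "ennreal (d x powr (- s)) \<le> ennreal (r0 powr (- s)) +
      (\<Sum>k. ennreal (w k) * indicator {x\<in>space M. d x < c k} x)" if x: "x \<in> space M" for x
  proof (cases "r0 \<le> d x")
    case True
    then have "d x powr (- s) \<le> r0 powr (- s)" using s r0 by (intro powr_mono2') auto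
    then show ?thesis by (simp add: add_increasing2 ennreal_leI)
  next
    case False
    have "\<exists>k. c (Suc k) \<le> d x"
    proof -
      obtain n where "(1/2)^n < d x / r0"
        using real_arch_pow_inv[of "d x / r0" "1/2"] pos[OF x] r0 by auto
      then have "c n < d x" using r0 by (simp add: c_def powr_minus powr_realpow field_simps)
      moreover have "c (Suc n) \<le> c n"
        unfolding c_def using r0 by (intro mult_left_mono powr_mono) auto
      ultimately show ?thesis by (intro exI[of _ n]) simp
    qed
    define k where "k = (LEAST k. c (Suc k) \<le> d x)"
    have k: "c (Suc k) \<le> d x" unfolding k_def using LeastI_ex[OF \<open>\<exists>k. c (Suc k) \<le> d x\<close>] .
    have "d x < c k"
    proof (cases k)
      case 0
      then show ?thesis using False by (simp add: c_def)
    next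
      case (Suc j)
      then have "\<not> c (Suc j) \<le> d x" using not_less_Least[of j "\<lambda>k. c (Suc k) \<le> d x"] by (simp add: k_def)
      then show ?thesis using Suc by simp
    qed
    have "d x powr (- s) \<le> w k"
      unfolding w_def using k c s by (intro powr_mono2') auto
    then have "ennreal (d x powr (- s)) \<le> ennreal (w k) * indicator {x\<in>space M. d x < c k} x"
      using \<open>d x < c k\<close> x by (simp add: ennreal_leI)
    also have "\<dots> \<le> (\<Sum>k. ennreal (w k) * indicator {x\<in>space M. d x < c k} x)"
    proof -
      define T where "T j = ennreal (w j) * indicator {x\<in>space M. d x < c j} x" for j
      have "sum T {k} \<le> suminf T" by (rule sum_le_suminf) auto
      then have "T k \<le> suminf T" by (simp del: sum_mult_indicator)
      then show ?thesis unfolding T_def .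
    qed
    finally show ?thesis by (simp add: add_increasing)
  qed
  define \<rho> where "\<rho> = 2 powr (s - q)"
  have \<rho>: "0 < \<rho>" "\<rho> < 1" using s powr_less_mono[of "s - q" 0 2] by (auto simp: \<rho>_def)
  define B where "B = A * r0 powr (q - s) * 2 powr s"
  have B: "0 \<le> B" using A by (simp add: B_def)
  \<comment> \<open>The contributions form a geometric sequence with ratio 2^(s - q), below 1
    because s < q.\<close>
  have wk: "w k * (A * c k powr q) = B * \<rho> ^ k" for k
  proof -
    have "w k = r0 powr (- s) * 2 powr (s * (real k + 1))"
      using r0 by (simp add: w_def c_def powr_mult powr_powr algebra_simps)
    moreover have "c k powr q = r0 powr q * 2 powr (- real k * q)"
      using r0 by (simp add: c_def powr_mult powr_powr)
    moreover have "\<rho> ^ k = 2 powr (real k * (s - q))"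
      by (simp add: \<rho>_def powr_power mult.commute)
    moreover have "r0 powr (q - s) = r0 powr (- s) * r0 powr q"
      by (simp flip: powr_add)
    moreover have "2 powr (s * (real k + 1)) * 2 powr (- real k * q) = 2 powr s * 2 powr (real k * (s - q))"
      by (simp add: algebra_simps flip: powr_add)
    ultimately show ?thesis by (simp add: B_def algebra_simps)
  qed
  have "(\<integral>\<^sup>+x. ennreal (d x powr (- s)) \<partial>M)
     \<le> (\<integral>\<^sup>+x. ennreal (r0 powr (- s)) + (\<Sum>k. ennreal (w k) * indicator {x\<in>space M. d x < c k} x) \<partial>M)"
    by (rule nn_integral_mono) (rule pt)
  also have "\<dots> = (\<integral>\<^sup>+x. ennreal (r0 powr (- s)) \<partial>M) + (\<integral>\<^sup>+x. (\<Sum>k. ennreal (w k) * indicator {x\<in>space M. d x < c k} x) \<partial>M)"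
    by (rule nn_integral_add) measurable
  also have "(\<integral>\<^sup>+x. (\<Sum>k. ennreal (w k) * indicator {x\<in>space M. d x < c k} x) \<partial>M)
     = (\<Sum>k. \<integral>\<^sup>+x. ennreal (w k) * indicator {x\<in>space M. d x < c k} x \<partial>M)"
    by (rule nn_integral_suminf) measurable
  also have "\<dots> = (\<Sum>k. ennreal (w k) * emeasure M {x\<in>space M. d x < c k})"
    by (intro suminf_cong nn_integral_cmult_indicator) measurable
  also have "\<dots> \<le> (\<Sum>k. ennreal (w k) * ennreal (A * c k powr q))"
    by (intro suminf_le mult_left_mono V c) auto
  also have "\<dots> = (\<Sum>k. ennreal (B * \<rho> ^ k))"
  proof (rule suminf_cong)
    show "ennreal (w k) * ennreal (A * c k powr q) = ennreal (B * \<rho> ^ k)" for k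
      using A wk[of k] by (simp add: w_def flip: ennreal_mult)
  qed
  also have "\<dots> = ennreal (\<Sum>k. B * \<rho> ^ k)"
    using B \<rho> by (intro suminf_ennreal2 summable_mult summable_geometric) auto
  also have "(\<Sum>k. B * \<rho> ^ k) = B / (1 - \<rho>)"
    using \<rho> by (subst suminf_mult) (auto simp: suminf_geometric summable_geometric)
  also have "(\<integral>\<^sup>+x. ennreal (r0 powr (- s)) \<partial>M) = ennreal (r0 powr (- s) * measure M (space M))"
    by (simp add: emeasure_eq_measure ennreal_mult)
  also have "ennreal (r0 powr (- s) * measure M (space M)) + ennreal (B / (1 - \<rho>))
     = ennreal (r0 powr (- s) * measure M (space M) + B / (1 - \<rho>))"
    using B \<rho> by (intro ennreal_plus[symmetric]) auto
  finally show ?thesis by (simp add: B_def \<rho>_def add_left_mono)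
qed

lemma diameter_pos_of_open:
  fixes S :: "'a::euclidean_space set"
  assumes "open S" "bounded S" "S \<noteq> {}"
  shows "0 < diameter S"
proof -
  obtain a e where "0 < e" "ball a e \<subseteq> S"
    using assms by (meson all_not_in_conv openE)
  then show ?thesis
    using diameter_subset[OF \<open>ball a e \<subseteq> S\<close> assms(2)] by simp
qed

lemma infdist_lt_obtain:
  assumes "A \<noteq> {}" "infdist x A < r"
  obtains y where "y \<in> A" "dist x y < r"
  using assms cInf_lessD[of "dist x ` A" r] unfolding infdist_def by auto

section \<open>The lower bound for the torsion function in terms of the distance to the
  boundary\<close>

context bounded_open
begin

text \<open>A ball centred in \<Omega> that leaves \<Omega> meets the frontier, being connected, and
  it does so at a distance below its radius.\<close>

lemma ball_boundary_dist_subset: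
  assumes "x \<in> \<Omega>"
  shows "ball x (boundary_dist \<Omega> x) \<subseteq> \<Omega>"
proof (rule ccontr)
  assume n: "\<not> ball x (boundary_dist \<Omega> x) \<subseteq> \<Omega>"
  then have "0 < boundary_dist \<Omega> x" by (metis ball_eq_empty empty_subsetI not_le)
  then have "ball x (boundary_dist \<Omega> x) \<inter> frontier \<Omega> \<noteq> {}"
    using n assms centre_in_ball[of x "boundary_dist \<Omega> x"] by (intro connected_Int_frontier) blast+
  then obtain y where "y \<in> frontier \<Omega>" "dist x y < boundary_dist \<Omega> x" by auto
  then show False using infdist_le[of y "frontier \<Omega>" x] by (simp add: boundary_dist_def)
qed

lemma frontier_nonempty: "\<Omega> \<noteq> {} \<Longrightarrow> frontier \<Omega> \<noteq> {}"
  using bounded_domain not_bounded_UNIV frontier_eq_empty[of \<Omega>] by metis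

lemma compact_frontier: "compact (frontier \<Omega>)"
  using bounded_domain by (simp add: compact_frontier_bounded)

lemma boundary_dist_pos:
  assumes "x \<in> \<Omega>" shows "0 < boundary_dist \<Omega> x"
proof -
  have "x \<notin> frontier \<Omega>" using assms open_domain by (simp add: frontier_def interior_open)
  then show ?thesis
    using assms frontier_nonempty infdist_pos_not_in_closed[of "frontier \<Omega>" x] by (auto simp: boundary_dist_def)
qed

lemma boundary_dist_measurable [measurable]: "boundary_dist \<Omega> \<in> borel_measurable \<mu>"
  unfolding boundary_dist_def[abs_def]
  by (intro continuous_borel_measurable continuous_intros)

text \<open>The null set in \<open>torsion_ge_ball\<close> depends on the ball, so only countably
  many balls may be used: centres in a countable dense set, rational radii.\<close>

lemma torsion_ge_dist:
  assumes u: "torsion_function \<Omega> u"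
  shows "AE x in \<mu>. (boundary_dist \<Omega> x)\<^sup>2 / (16 * DIM('a)) \<le> u x"
proof -
  obtain D :: "'a set" where D: "countable D" "\<And>X. open X \<Longrightarrow> X \<noteq> {} \<Longrightarrow> \<exists>d\<in>D. d \<in> X"
    using countable_dense_setE by metis
  define S where "S = {(a, r). a \<in> D \<and> r \<in> \<rat> \<and> 0 \<le> r \<and> cball a r \<subseteq> \<Omega>}"
  have "countable S"
    by (rule countable_subset[of _ "D \<times> \<rat>"]) (use D countable_rat in \<open>auto simp: S_def\<close>)
  then have "AE x in \<mu>. \<forall>(a, r)\<in>S. (r\<^sup>2 - (norm (x - a))\<^sup>2) / (2 * DIM('a)) \<le> u x"
    using torsion_ge_ball[OF u] by (subst AE_ball_countable) (auto simp: S_def)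
  moreover have "AE x in \<mu>. x \<in> \<Omega>" by (rule AE_I2) simp
  ultimately show ?thesis
  proof eventually_elim
    case (elim x)
    define \<delta> where "\<delta> = boundary_dist \<Omega> x"
    have \<delta>: "0 < \<delta>" "ball x \<delta> \<subseteq> \<Omega>"
      using boundary_dist_pos ball_boundary_dist_subset elim(2) by (auto simp: \<delta>_def)
    \<comment> \<open>|x - a| < \<delta>/4 and \<delta>/2 < r < 3 \<delta>/4 keep the closed ball
      inside the ball of radius \<delta> about x. Then r^2 - |x - a|^2 is at least \<delta>^2/4 -
      \<delta>^2/16, which exceeds \<delta>^2/8.\<close>
    obtain a where a: "a \<in> D" "a \<in> ball x (\<delta> / 4)"
      using D(2)[of "ball x (\<delta> / 4)"] \<delta> by auto
    obtain r where r: "r \<in> \<rat>" "\<delta> / 2 < r" "r < 3 * \<delta> / 4"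
      using Rats_dense_in_real[of "\<delta> / 2" "3 * \<delta> / 4"] \<delta> by auto
    have "cball a r \<subseteq> ball x \<delta>"
    proof
      fix y assume "y \<in> cball a r"
      then show "y \<in> ball x \<delta>" using a r dist_triangle[of x y a] by auto
    qed
    then have "(a, r) \<in> S" using a r \<delta> by (auto simp: S_def)
    then have "(r\<^sup>2 - (norm (x - a))\<^sup>2) / (2 * DIM('a)) \<le> u x" using elim(1) by auto
    moreover have "\<delta>\<^sup>2 / 8 \<le> r\<^sup>2 - (norm (x - a))\<^sup>2"
    proof -
      have "(\<delta> / 2)\<^sup>2 \<le> r\<^sup>2" using r \<delta> by (intro power_mono) auto
      moreover have "0 \<le> \<delta>\<^sup>2" by simp
      moreover have "(norm (x - a))\<^sup>2 \<le> (\<delta> / 4)\<^sup>2"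
        using a by (intro power_mono) (auto simp: dist_norm)
      moreover have "(\<delta> / 2)\<^sup>2 = \<delta>\<^sup>2 / 4" "(\<delta> / 4)\<^sup>2 = \<delta>\<^sup>2 / 16" by (simp_all add: power_divide)
      ultimately show ?thesis by linarith
    qed
    then have "\<delta>\<^sup>2 / 8 / (2 * DIM('a)) \<le> (r\<^sup>2 - (norm (x - a))\<^sup>2) / (2 * DIM('a))"
      by (rule divide_right_mono) simp
    ultimately show ?case by (simp add: \<delta>_def)
  qed
qed

lemma neg_power_integral_le:
  assumes u: "torsion_function \<Omega> u" and \<beta>: "0 < \<beta>"
  shows "neg_power_integral \<Omega> u \<beta> \<le>
     ennreal ((16 * DIM('a)) powr \<beta>) * (\<integral>\<^sup>+x. ennreal (boundary_dist \<Omega> x powr (- (2 * \<beta>))) \<partial>\<mu>)"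
proof -
  have "AE x in \<mu>. x \<in> \<Omega>" by (rule AE_I2) simp
  with torsion_ge_dist[OF u]
  have "AE x in \<mu>. (if 0 < u x then ennreal (u x powr (- \<beta>)) else \<infinity>)
     \<le> ennreal ((16 * DIM('a)) powr \<beta>) * ennreal (boundary_dist \<Omega> x powr (- (2 * \<beta>)))"
  proof eventually_elim
    case (elim x)
    define \<delta> n where "\<delta> = boundary_dist \<Omega> x" and "n = 16 * real DIM('a)"
    have p: "0 < \<delta>" "0 < n" using boundary_dist_pos elim by (auto simp: \<delta>_def n_def)
    have le: "\<delta>\<^sup>2 / n \<le> u x" using elim by (simp add: \<delta>_def n_def)
    have "0 < \<delta>\<^sup>2 / n" using p by simp
    then have "u x powr (- \<beta>) \<le> (\<delta>\<^sup>2 / n) powr (- \<beta>)"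
      using le \<beta> by (intro powr_mono2') auto
    also have "\<dots> = n powr \<beta> * \<delta> powr (- (2 * \<beta>))"
    proof -
      have "(\<delta>\<^sup>2 / n) powr (- \<beta>) = (\<delta>\<^sup>2) powr (- \<beta>) / n powr (- \<beta>)"
        using p by (simp add: powr_divide)
      also have "(\<delta>\<^sup>2) powr (- \<beta>) = \<delta> powr (- (2 * \<beta>))"
        using p by (simp add: powr_powr flip: powr_numeral)
      also have "\<delta> powr (- (2 * \<beta>)) / n powr (- \<beta>) = n powr \<beta> * \<delta> powr (- (2 * \<beta>))"
        by (simp add: powr_minus divide_inverse mult.commute)
      finally show ?thesis .
    qed
    finally have "ennreal (u x powr (- \<beta>)) \<le> ennreal (n powr \<beta>) * ennreal (\<delta> powr (- (2 * \<beta>)))"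
      by (simp add: ennreal_leI flip: ennreal_mult)
    \<comment> \<open>Positivity almost everywhere excludes the value infinity of the
      integrand.\<close>
    moreover have "0 < u x" using le \<open>0 < \<delta>\<^sup>2 / n\<close> by linarith
    ultimately show ?case by (simp add: \<delta>_def n_def)
  qed
  then have "neg_power_integral \<Omega> u \<beta>
    \<le> (\<integral>\<^sup>+x. ennreal ((16 * DIM('a)) powr \<beta>) * ennreal (boundary_dist \<Omega> x powr (- (2 * \<beta>))) \<partial>\<mu>)"
    unfolding neg_power_integral_def by (rule nn_integral_mono_AE)
  also have "\<dots> = ennreal ((16 * DIM('a)) powr \<beta>) * (\<integral>\<^sup>+x. ennreal (boundary_dist \<Omega> x powr (- (2 * \<beta>))) \<partial>\<mu>)"
    by (rule nn_integral_cmult) measurable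
  finally show ?thesis .
qed

lemma emeasure_boundary_layer:
  "emeasure \<mu> {x\<in>space \<mu>. boundary_dist \<Omega> x < r} = emeasure lebesgue {x\<in>\<Omega>. boundary_dist \<Omega> x < r}"
  using lmeasurable_domain by (subst emeasure_restrict_space) (auto simp: fmeasurable_def)

lemma measure_mu: "measure \<mu> (space \<mu>) = measure lebesgue \<Omega>"
  using lmeasurable_domain by (simp add: measure_restrict_space fmeasurable_def)

lemma neg_power_integral_minkowski:
  assumes u: "torsion_function \<Omega> u" and m: "upper_minkowski_content \<gamma> \<Omega> < \<infinity>"
    and \<beta>: "0 < \<beta>" "\<beta> < (real DIM('a) - \<gamma>) / 2"
  shows "neg_power_integral \<Omega> u \<beta> < \<infinity>"
proof -
  define q where "q = real DIM('a) - \<gamma>"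
  let ?f = "\<lambda>r. emeasure lebesgue {x\<in>\<Omega>. boundary_dist \<Omega> x < r}"
  obtain L where L: "upper_minkowski_content \<gamma> \<Omega> = ennreal L" "0 \<le> L"
    using m by (cases "upper_minkowski_content \<gamma> \<Omega>") auto
  \<comment> \<open>A number strictly above the upper limit bounds the quotients for all small
    r.\<close>
  have "ennreal L < ennreal (L + 1)" using L by (simp add: ennreal_less_iff)
  then have "\<forall>\<^sub>F r in at_right 0. ?f r / ennreal (r powr q) < ennreal (L + 1)"
    using L(1) Limsup_le_iff[of "at_right 0" "\<lambda>r. ?f r / ennreal (r powr q)" "ennreal L"]
    by (auto simp: upper_minkowski_content_def q_def)
  then obtain b where b: "b > 0" "\<And>r. 0 < r \<Longrightarrow> r < b \<Longrightarrow> ?f r / ennreal (r powr q) < ennreal (L + 1)"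
    by (auto simp: eventually_at_right_field)
  \<comment> \<open>The bound is known for r < b; b/2 serves as the largest layer width, which is
    attained.\<close>
  have V: "emeasure \<mu> {x\<in>space \<mu>. boundary_dist \<Omega> x < r} \<le> ennreal ((L + 1) * r powr q)" if r: "0 < r" "r \<le> b / 2" for r
  proof -
    have p: "0 < r powr q" using r by simp
    have "?f r = ?f r / ennreal (r powr q) * ennreal (r powr q)"
      using p by (simp add: ennreal_divide_times)
    also have "\<dots> \<le> ennreal (L + 1) * ennreal (r powr q)"
      using b(2)[of r] r by (intro mult_right_mono) auto
    also have "\<dots> = ennreal ((L + 1) * r powr q)" using L p by (simp add: ennreal_mult)
    finally show ?thesis by (simp only: emeasure_boundary_layer)
  qed
  have "(\<integral>\<^sup>+x. ennreal (boundary_dist \<Omega> x powr (- (2 * \<beta>))) \<partial>\<mu>)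
    \<le> ennreal ((b / 2) powr (- (2 * \<beta>)) * measure \<mu> (space \<mu>)
        + (L + 1) * (b / 2) powr (q - 2 * \<beta>) * 2 powr (2 * \<beta>) / (1 - 2 powr (2 * \<beta> - q)))"
    by (rule nn_integral_neg_powr_le[OF boundary_dist_measurable finite_measure_axioms _ _ _ _ _ V])
       (use boundary_dist_pos \<beta> b L in \<open>auto simp: q_def\<close>)
  also have "\<dots> < \<infinity>" by simp
  finally have "(\<integral>\<^sup>+x. ennreal (boundary_dist \<Omega> x powr (- (2 * \<beta>))) \<partial>\<mu>) < \<infinity>" .
  then have "ennreal ((16 * DIM('a)) powr \<beta>) * (\<integral>\<^sup>+x. ennreal (boundary_dist \<Omega> x powr (- (2 * \<beta>))) \<partial>\<mu>) < \<infinity>"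
    by (simp add: ennreal_mult_less_top)
  then show ?thesis using neg_power_integral_le[OF u \<beta>(1)] by (rule le_less_trans[rotated])
qed

subsection \<open>Ahlfors regular boundaries\<close>

lemma sum_const_ennreal: "(\<Sum>i\<in>I. ennreal c) = ennreal (real (card I) * c)" if "0 \<le> c"
  using that by (simp add: ennreal_mult' ennreal_of_nat_eq_real_of_nat)

text \<open>The balls of radius r/4 about the net have mutual distance at least r/2, so the lower
  Ahlfors bounds add up.\<close>

lemma separated_net_card_le:
  assumes ah: "has_ahlfors_character C0 C1 R (frontier \<Omega>)"
    and P: "finite P" "P \<subseteq> frontier \<Omega>" "\<And>p q. p \<in> P \<Longrightarrow> q \<in> P \<Longrightarrow> p \<noteq> q \<Longrightarrow> r \<le> dist p q"
    and r: "0 < r" "r < R"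
  shows "ennreal (card P * (C0 * (r / 4) ^ (DIM('a) - 1))) \<le> hausdorff_measure (DIM('a) - 1) (frontier \<Omega>)"
proof -
  have C0: "C0 > 0" using ah by (simp add: has_ahlfors_character_def)
  have "ennreal (card P * (C0 * (r / 4) ^ (DIM('a) - 1))) = (\<Sum>p\<in>P. ennreal (C0 * (r / 4) ^ (DIM('a) - 1)))"
    using C0 r by (subst sum_const_ennreal) auto
  also have "\<dots> \<le> (\<Sum>p\<in>P. hausdorff_measure (DIM('a) - 1) (ball p (r / 4) \<inter> frontier \<Omega>))"
    using ah P(2) r by (intro sum_mono) (auto simp: has_ahlfors_character_def)
  also have "\<dots> \<le> hausdorff_measure (DIM('a) - 1) (frontier \<Omega>)"
  proof (rule hausdorff_measure_separated[OF P(1), where \<eta>="r / 2"])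
    fix p q x y assume pq: "p \<in> P" "q \<in> P" "p \<noteq> q" "x \<in> ball p (r / 4) \<inter> frontier \<Omega>" "y \<in> ball q (r / 4) \<inter> frontier \<Omega>"
    have "dist p q \<le> dist p x + dist x y + dist y q"
      using dist_triangle[of p q x] dist_triangle[of x q y] by simp
    then show "r / 2 \<le> dist x y"
      using P(3)[OF pq(1-3)] pq(4,5) by (simp add: dist_commute)
  qed (use r in auto)
  finally show ?thesis .
qed

text \<open>A point of the layer is within r of the frontier and hence within 2 r of an r-net. The
  net has at most h / (C0 (r/4)^(n-1)) points, each ball has volume of order (2 r)^n, and a single
  power of r remains.\<close>

lemma emeasure_boundary_layer_le:
  assumes ah: "has_ahlfors_character C0 C1 R (frontier \<Omega>)" and H: "hausdorff_measure (DIM('a) - 1) (frontier \<Omega>) = ennreal h" "0 \<le> h"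
    and r: "0 < r" "r < R" and ne: "\<Omega> \<noteq> {}"
  shows "emeasure \<mu> {x\<in>space \<mu>. boundary_dist \<Omega> x < r}
    \<le> ennreal (unit_ball_vol DIM('a) * 2 ^ DIM('a) * 4 ^ (DIM('a) - 1) / C0 * h * r)"
proof -
  define n where "n = DIM('a)"
  have n: "n > 0" by (simp add: n_def)
  have C0: "C0 > 0" using ah by (simp add: has_ahlfors_character_def)
  obtain P where P: "finite P" "P \<subseteq> frontier \<Omega>" "\<And>p q. p \<in> P \<Longrightarrow> q \<in> P \<Longrightarrow> p \<noteq> q \<Longrightarrow> r \<le> dist p q"
    "\<And>x. x \<in> frontier \<Omega> \<Longrightarrow> \<exists>p\<in>P. dist x p < r"
    using compact_separated_net[OF compact_frontier r(1)] by metis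
  have "card P * (C0 * (r / 4) ^ (n - 1)) \<le> h"
    using separated_net_card_le[OF ah P(1-3) r] H by (simp add: n_def ennreal_le_iff)
  then have cP: "card P \<le> h / (C0 * (r / 4) ^ (n - 1))"
    using C0 r by (simp add: field_simps)
  have sub: "{x\<in>\<Omega>. boundary_dist \<Omega> x < r} \<subseteq> (\<Union>p\<in>P. ball p (2 * r))"
  proof
    fix x assume x: "x \<in> {x\<in>\<Omega>. boundary_dist \<Omega> x < r}"
    then obtain y where y: "y \<in> frontier \<Omega>" "dist x y < r"
      using infdist_lt_obtain[OF frontier_nonempty[OF ne], of x r] by (auto simp: boundary_dist_def)
    then obtain p where p: "p \<in> P" "dist y p < r" using P(4) by blast
    have "dist p x < 2 * r" using y p dist_triangle[of p x y] by (simp add: dist_commute)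
    then show "x \<in> (\<Union>p\<in>P. ball p (2 * r))" using p by auto
  qed
  have "emeasure \<mu> {x\<in>space \<mu>. boundary_dist \<Omega> x < r} \<le> emeasure lebesgue (\<Union>p\<in>P. ball p (2 * r))"
    unfolding emeasure_boundary_layer using P(1) by (intro emeasure_mono sub sets.finite_UN) auto
  also have "\<dots> \<le> (\<Sum>p\<in>P. emeasure lebesgue (ball p (2 * r)))"
    using P(1) by (intro emeasure_subadditive_finite) auto
  also have "\<dots> = (\<Sum>p\<in>P. ennreal (unit_ball_vol n * (2 * r) ^ n))"
    using r by (simp add: emeasure_ball n_def)
  also have "\<dots> = ennreal (card P * (unit_ball_vol n * (2 * r) ^ n))"
    using r by (intro sum_const_ennreal) auto
  also have "\<dots> \<le> ennreal (h / (C0 * (r / 4) ^ (n - 1)) * (unit_ball_vol n * (2 * r) ^ n))"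
    using r by (intro ennreal_leI mult_right_mono cP) auto
  also have "h / (C0 * (r / 4) ^ (n - 1)) * (unit_ball_vol n * (2 * r) ^ n)
     = unit_ball_vol n * 2 ^ n * 4 ^ (n - 1) / C0 * h * r"
  proof -
    have "(2 * r) ^ n = 2 ^ n * (r ^ (n - 1) * r)"
      using power_minus_mult[of n r] n by (simp add: power_mult_distrib)
    then show ?thesis using r C0 by (simp add: power_divide field_simps)
  qed
  finally show ?thesis by (simp add: n_def)
qed

text \<open>This is one of the two places where the bound \<open>K\<close> on diam \<Omega> / R
  enters. The radius r = d / (K + 1) is below R, so the upper Ahlfors bound applies to the balls of
  an r-net. Disjoint balls of radius r/2 inside one of radius d + r/2 = (2 K + 3) r/2 limit the net
  to (2 K + 3)^n points.\<close>

lemma hausdorff_frontier_le: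
  assumes ah: "has_ahlfors_character C0 C1 R (frontier \<Omega>)" and dK: "diameter \<Omega> \<le> K * R" and ne: "\<Omega> \<noteq> {}" and K: "0 < K"
    and d: "0 < diameter \<Omega>"
  shows "hausdorff_measure (DIM('a) - 1) (frontier \<Omega>)
     \<le> ennreal ((2 * K + 3) ^ DIM('a) * C1 / (K + 1) ^ (DIM('a) - 1) * diameter \<Omega> ^ (DIM('a) - 1))"
proof -
  define n where "n = DIM('a)"
  define d where "d = diameter \<Omega>"
  define r where "r = d / (K + 1)"
  have dp: "0 < d" using d by (simp add: d_def)
  have C1: "C1 > 0" and R: "R > 0" using ah by (auto simp: has_ahlfors_character_def)
  have r: "0 < r" "r < R" "d = (K + 1) * r"
    using dp K dK R by (auto simp: r_def d_def field_simps add_strict_increasing2)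
  obtain P where P: "finite P" "P \<subseteq> frontier \<Omega>" "\<And>p q. p \<in> P \<Longrightarrow> q \<in> P \<Longrightarrow> p \<noteq> q \<Longrightarrow> r \<le> dist p q"
    "\<And>x. x \<in> frontier \<Omega> \<Longrightarrow> \<exists>p\<in>P. dist x p < r"
    using compact_separated_net[OF compact_frontier r(1)] by metis
  have diam: "dist p q \<le> d" if "p \<in> frontier \<Omega>" "q \<in> frontier \<Omega>" for p q
    using diameter_bounded_bound[of "closure \<Omega>" p q] bounded_domain that
    by (auto simp: d_def diameter_closure frontier_def)
  obtain p0 where p0: "p0 \<in> frontier \<Omega>" using frontier_nonempty[OF ne] by blast
  have card: "card P \<le> (2 * K + 3) ^ n"
  proof -
    have "ennreal (card P * (unit_ball_vol n * (r / 2) ^ n)) = (\<Sum>p\<in>P. emeasure lborel (ball p (r / 2)))"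
      using r by (simp add: emeasure_ball n_def sum_const_ennreal flip: sum_const_ennreal)
    also have "\<dots> = emeasure lborel (\<Union>p\<in>P. ball p (r / 2))"
    proof (rule sum_emeasure)
      show "disjoint_family_on (\<lambda>p. ball p (r / 2)) P"
        unfolding disjoint_family_on_def
      proof (intro ballI impI)
        fix p q assume pq: "p \<in> P" "q \<in> P" "p \<noteq> q"
        show "ball p (r / 2) \<inter> ball q (r / 2) = {}"
          using P(3)[OF pq] by (simp add: disjoint_ballI)
      qed
    qed (use P in auto)
    also have "\<dots> \<le> emeasure lborel (ball p0 (d + r / 2))"
    proof (intro emeasure_mono)
      show "(\<Union>p\<in>P. ball p (r / 2)) \<subseteq> ball p0 (d + r / 2)"
      proof
        fix x assume "x \<in> (\<Union>p\<in>P. ball p (r / 2))"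
        then obtain p where p: "p \<in> P" "dist p x < r / 2" by auto
        then show "x \<in> ball p0 (d + r / 2)"
          using diam[OF p0, of p] P(2) dist_triangle[of p0 x p] by auto
      qed
    qed auto
    also have "\<dots> = ennreal (unit_ball_vol n * (d + r / 2) ^ n)"
      using r dp by (simp add: emeasure_ball n_def)
    finally have "card P * (unit_ball_vol n * (r / 2) ^ n) \<le> unit_ball_vol n * (d + r / 2) ^ n"
      using r dp by (simp add: ennreal_le_iff)
    moreover have "d + r / 2 = (2 * K + 3) * (r / 2)" using r(3) by (simp add: field_simps)
    then have "(d + r / 2) ^ n = (2 * K + 3) ^ n * (r / 2) ^ n" by (simp only: power_mult_distrib)
    moreover have "0 < unit_ball_vol n" "0 < (r / 2) ^ n" using r by auto
    ultimately have "card P * (unit_ball_vol n * (r / 2) ^ n) \<le> (2 * K + 3) ^ n * (unit_ball_vol n * (r / 2) ^ n)"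
      by (simp add: mult.left_commute)
    then show ?thesis
      using \<open>0 < unit_ball_vol n\<close> \<open>0 < (r / 2) ^ n\<close> by (simp only: mult_le_cancel_right) (auto simp: mult_pos_pos)
  qed
  have "hausdorff_measure (n - 1) (frontier \<Omega>) \<le> hausdorff_measure (n - 1) (\<Union>p\<in>P. ball p r \<inter> frontier \<Omega>)"
    using P(4) by (intro hausdorff_measure_mono) (auto simp: dist_commute)
  also have "\<dots> \<le> (\<Sum>p\<in>P. hausdorff_measure (n - 1) (ball p r \<inter> frontier \<Omega>))"
    by (rule hausdorff_measure_UN[OF P(1)])
  also have "\<dots> \<le> (\<Sum>p\<in>P. ennreal (C1 * r ^ (n - 1)))"
    using ah P(2) r by (intro sum_mono) (auto simp: has_ahlfors_character_def n_def)
  also have "\<dots> = ennreal (card P * (C1 * r ^ (n - 1)))"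
    using C1 r by (intro sum_const_ennreal) auto
  also have "\<dots> \<le> ennreal ((2 * K + 3) ^ n * (C1 * r ^ (n - 1)))"
    using C1 r by (intro ennreal_leI mult_right_mono card) auto
  also have "(2 * K + 3) ^ n * (C1 * r ^ (n - 1)) = (2 * K + 3) ^ n * C1 / (K + 1) ^ (n - 1) * d ^ (n - 1)"
    by (simp add: r_def power_divide)
  finally show ?thesis by (simp add: n_def d_def)
qed

lemma measure_domain_le: "measure lebesgue \<Omega> \<le> unit_ball_vol DIM('a) * diameter \<Omega> ^ DIM('a)"
proof (cases "\<Omega> = {}")
  case False
  then obtain a where a: "a \<in> \<Omega>" by blast
  have "\<Omega> \<subseteq> cball a (diameter \<Omega>)"
    using diameter_bounded_bound[OF bounded_domain a] by auto
  then have "measure lebesgue \<Omega> \<le> measure lebesgue (cball a (diameter \<Omega>))"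
    by (intro measure_mono_fmeasurable lmeasurable_cball) (use lmeasurable_domain in auto)
  also have "\<dots> = unit_ball_vol DIM('a) * diameter \<Omega> ^ DIM('a)"
    using diameter_ge_0[OF bounded_domain] by (simp add: content_cball)
  finally show ?thesis .
qed (simp add: diameter_ge_0)

end

text \<open>The layer estimate is assumed for every r > 0, which leaves the cut-off free. At
  |\<Omega>| / h the interior term and the sum over the layers are both multiples of |\<Omega>|^(1 -
  2 \<beta>) h^(2 \<beta>).\<close>

lemma (in bounded_open) neg_power_integral_ahlfors:
  assumes u: "torsion_function \<Omega> u" and \<beta>: "0 < \<beta>" "\<beta> < 1/2" and Q: "0 \<le> Q" and h: "0 < h" and vol: "0 < measure lebesgue \<Omega>"
    and V: "\<And>r. 0 < r \<Longrightarrow> emeasure \<mu> {x\<in>space \<mu>. boundary_dist \<Omega> x < r} \<le> ennreal (Q * h * r)"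
  shows "neg_power_integral \<Omega> u \<beta> \<le> ennreal ((16 * DIM('a)) powr \<beta> * (1 + Q * 2 powr (2 * \<beta>) / (1 - 2 powr (2 * \<beta> - 1)))
     * (measure lebesgue \<Omega> powr (1 - 2 * \<beta>) * h powr (2 * \<beta>)))"
proof -
  define m where "m = measure lebesgue \<Omega>"
  define r0 where "r0 = m / h" \<comment> \<open>balances the interior against the boundary layers\<close>
  have m: "0 < m" and r0: "0 < r0" using vol h by (auto simp: m_def r0_def)
  have "(\<integral>\<^sup>+x. ennreal (boundary_dist \<Omega> x powr (- (2 * \<beta>))) \<partial>\<mu>)
    \<le> ennreal (r0 powr (- (2 * \<beta>)) * measure \<mu> (space \<mu>)
        + (Q * h) * r0 powr (1 - 2 * \<beta>) * 2 powr (2 * \<beta>) / (1 - 2 powr (2 * \<beta> - 1)))"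
  proof (rule nn_integral_neg_powr_le[OF boundary_dist_measurable finite_measure_axioms _ _ _ r0])
    show "emeasure \<mu> {x \<in> space \<mu>. boundary_dist \<Omega> x < r} \<le> ennreal (Q * h * r powr 1)" if "0 < r" for r
      using V[OF that] that by simp
  qed (use boundary_dist_pos \<beta> Q h in auto)
  also have "r0 powr (- (2 * \<beta>)) * measure \<mu> (space \<mu>) = m powr (1 - 2 * \<beta>) * h powr (2 * \<beta>)"
    unfolding measure_mu m_def[symmetric] r0_def using m h
    by (simp add: powr_divide powr_minus powr_diff field_simps)
  also have "(Q * h) * r0 powr (1 - 2 * \<beta>) * 2 powr (2 * \<beta>) / (1 - 2 powr (2 * \<beta> - 1))
     = Q * 2 powr (2 * \<beta>) / (1 - 2 powr (2 * \<beta> - 1)) * (m powr (1 - 2 * \<beta>) * h powr (2 * \<beta>))"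
    unfolding r0_def using m h by (simp add: powr_divide powr_diff mult_ac)
  finally have "(\<integral>\<^sup>+x. ennreal (boundary_dist \<Omega> x powr (- (2 * \<beta>))) \<partial>\<mu>)
    \<le> ennreal ((1 + Q * 2 powr (2 * \<beta>) / (1 - 2 powr (2 * \<beta> - 1))) * (m powr (1 - 2 * \<beta>) * h powr (2 * \<beta>)))"
    by (simp add: distrib_right)
  then have "ennreal ((16 * DIM('a)) powr \<beta>) * (\<integral>\<^sup>+x. ennreal (boundary_dist \<Omega> x powr (- (2 * \<beta>))) \<partial>\<mu>)
    \<le> ennreal ((16 * DIM('a)) powr \<beta>) * ennreal ((1 + Q * 2 powr (2 * \<beta>) / (1 - 2 powr (2 * \<beta> - 1))) * (m powr (1 - 2 * \<beta>) * h powr (2 * \<beta>)))"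
    by (rule mult_left_mono) simp
  also have "\<dots> = ennreal ((16 * DIM('a)) powr \<beta> * ((1 + Q * 2 powr (2 * \<beta>) / (1 - 2 powr (2 * \<beta> - 1))) * (m powr (1 - 2 * \<beta>) * h powr (2 * \<beta>))))"
    by (rule ennreal_mult'[symmetric]) simp
  finally show ?thesis
    using order.trans[OF neg_power_integral_le[OF u \<beta>(1)]] unfolding m_def mult.assoc by blast
qed

text \<open>The layer estimate with \<open>Q1\<close> is valid for r < R only. For larger r the
  layer is bounded by the whole volume, and |\<Omega>| \<le> Q2 h R because the diameter is at most
  K R and the boundary has measure at least of order R^(n-1). So Q = Q1 + Q2 works for all
  r.\<close>

theorem neg_power_integral_ahlfors_bound:
  fixes C0 C1 K \<beta> :: real
  assumes \<beta>: "0 < \<beta>" "\<beta> < 1/2"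
  shows "\<exists>C C'. C > 0 \<and> C' > 0 \<and>
       (\<forall>R (\<Omega> :: 'a::euclidean_space set) u.
          bounded_domain \<Omega> \<and> has_ahlfors_character C0 C1 R (frontier \<Omega>) \<and>
          diameter \<Omega> \<le> K * R \<and> torsion_function \<Omega> u \<longrightarrow>
          hausdorff_measure (DIM('a) - 1) (frontier \<Omega>) < \<infinity> \<and>
          (let A = measure lebesgue \<Omega> powr (1 - 2 * \<beta>) *
                   enn2real (hausdorff_measure (DIM('a) - 1) (frontier \<Omega>)) powr (2 * \<beta>)
           in neg_power_integral \<Omega> u \<beta> \<le> ennreal (C * A) \<and>
              C * A \<le> C' * diameter \<Omega> powr (real DIM('a) - 2 * \<beta>)))"
proof (cases "0 < C0 \<and> 0 < C1 \<and> 0 < K")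
  case False
  have "\<not> (bounded_domain \<Omega> \<and> has_ahlfors_character C0 C1 R (frontier \<Omega>) \<and> diameter \<Omega> \<le> K * R)"
    for R and \<Omega> :: "'a set"
  proof (rule notI, elim conjE)
    assume a: "bounded_domain \<Omega>" "has_ahlfors_character C0 C1 R (frontier \<Omega>)" "diameter \<Omega> \<le> K * R"
    \<comment> \<open>An Ahlfors character has positive \<open>C0\<close> and \<open>C1\<close>, so
      in this case it is \<open>K\<close> that fails to be positive; then no domain
      qualifies.\<close>
    have "K \<le> 0" "R > 0" using False a(2) by (auto simp: has_ahlfors_character_def)
    then have "diameter \<Omega> \<le> 0" using a(3) by (meson mult_nonpos_nonneg order.trans less_imp_le)
    moreover have "0 < diameter \<Omega>" using a(1) by (auto simp: bounded_domain_def intro: diameter_pos_of_open)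
    ultimately show False by simp
  qed
  then show ?thesis by (intro exI[of _ 1]) (metis zero_less_one)
next
  case True
  define n where "n = DIM('a)"
  define v where "v = unit_ball_vol n"
  define Q1 where "Q1 = v * 2 ^ n * 4 ^ (n - 1) / C0"
  \<comment> \<open>Solves v (K R)^n = Q2 C0 (R/8)^(n-1) R, with the lower bound \<open>hlow\<close>
    for the measure of the boundary.\<close>
  define Q2 where "Q2 = v * K ^ n * 8 ^ (n - 1) / C0"
  define Q where "Q = Q1 + Q2"
  define C where "C = (16 * n) powr \<beta> * (1 + Q * 2 powr (2 * \<beta>) / (1 - 2 powr (2 * \<beta> - 1)))"
  define D where "D = (2 * K + 3) ^ n * C1 / (K + 1) ^ (n - 1)"
  define C' where "C' = C * (v powr (1 - 2 * \<beta>) * D powr (2 * \<beta>))"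
  have n: "n > 0" by (simp add: n_def)
  have v: "v > 0" by (simp add: v_def)
  have Qp: "Q1 > 0" "Q2 > 0" "Q > 0" using v True by (auto simp: Q1_def Q2_def Q_def add_pos_pos)
  have "2 powr (2 * \<beta> - 1) < 2 powr 0" using \<beta> by (intro powr_less_mono) auto
  then have Cp: "C > 0" unfolding C_def using n Qp by (intro mult_pos_pos add_pos_nonneg) auto
  have Dp: "D > 0" using True by (simp add: D_def)
  have C'p: "C' > 0" using Cp Dp v by (simp add: C'_def)
  show ?thesis
  proof (rule exI[of _ C], rule exI[of _ C'], intro conjI allI impI Cp C'p; elim conjE)
    fix R and \<Omega> :: "'a set" and u
    assume dom: "bounded_domain \<Omega>" and ah: "has_ahlfors_character C0 C1 R (frontier \<Omega>)"
      and dK: "diameter \<Omega> \<le> K * R" and u: "torsion_function \<Omega> u"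
    interpret bounded_open \<Omega> using dom by unfold_locales (auto simp: bounded_domain_def)
    define d where "d = diameter \<Omega>"
    have ne: "\<Omega> \<noteq> {}" and op: "open \<Omega>" using dom by (auto simp: bounded_domain_def)
    have R: "R > 0" using ah by (simp add: has_ahlfors_character_def)
    have d: "0 < d" using dom by (auto simp: d_def bounded_domain_def intro: diameter_pos_of_open)
    have HD: "hausdorff_measure (n - 1) (frontier \<Omega>) \<le> ennreal (D * d ^ (n - 1))"
      using hausdorff_frontier_le[OF ah dK ne _] True d by (simp add: n_def D_def d_def)
    from le_less_trans[OF HD ennreal_less_top]
    show fin: "hausdorff_measure (DIM('a) - 1) (frontier \<Omega>) < \<infinity>"
      by (simp add: n_def)
    define h where "h = enn2real (hausdorff_measure (n - 1) (frontier \<Omega>))"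
    have h: "hausdorff_measure (n - 1) (frontier \<Omega>) = ennreal h"
      using fin by (simp add: h_def n_def)
    have h0: "0 \<le> h" by (simp add: h_def)
    have hD: "h \<le> D * d ^ (n - 1)"
      using HD Dp d unfolding h by (simp add: ennreal_le_iff)
    \<comment> \<open>A net of one point with separation R/2, which is below R; the balls then have
      radius R/8. In particular h is positive, so that |\<Omega>| / h makes sense.\<close>
    have hlow: "C0 * (R / 8) ^ (n - 1) \<le> h"
    proof -
      obtain p where "p \<in> frontier \<Omega>" using frontier_nonempty[OF ne] by blast
      then have "ennreal (card {p} * (C0 * (R / 2 / 4) ^ (n - 1))) \<le> ennreal h"
        using separated_net_card_le[OF ah, of "{p}" "R / 2"] R h by (auto simp: n_def)
      then show ?thesis using h0 by (simp add: ennreal_le_iff)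
    qed
    have "0 < C0 * (R / 8) ^ (n - 1)" using True R by simp
    then have hp: "0 < h" using hlow by linarith
    define m where "m = measure lebesgue \<Omega>"
    have mp: "0 < m"
      using open_not_negligible[OF op ne] negligible_iff_measure[of \<Omega>] lmeasurable_domain
        measure_nonneg[of lebesgue \<Omega>] unfolding m_def by linarith
    have md: "m \<le> v * d ^ n"
      using measure_domain_le by (simp add: m_def v_def n_def d_def)
    have mQ: "m \<le> Q2 * h * R"
    proof -
      have "m \<le> v * (K * R) ^ n"
        using order.trans[OF md mult_left_mono[OF power_mono[OF dK[folded d_def], of n], of v]] d v by simp
      also have "\<dots> = Q2 * (C0 * (R / 8) ^ (n - 1)) * R"
        using power_minus_mult[of n R] n True by (simp add: Q2_def power_mult_distrib power_divide)
      also have "\<dots> \<le> Q2 * h * R"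
        using hlow Qp R by (intro mult_right_mono mult_left_mono) auto
      finally show ?thesis .
    qed
    have V: "emeasure \<mu> {x\<in>space \<mu>. boundary_dist \<Omega> x < r} \<le> ennreal (Q * h * r)" if r: "0 < r" for r
    proof (cases "r < R")
      case True
      have "emeasure \<mu> {x\<in>space \<mu>. boundary_dist \<Omega> x < r} \<le> ennreal (Q1 * h * r)"
        using emeasure_boundary_layer_le[OF ah _ h0 r True ne] h by (simp add: Q1_def v_def n_def)
      also have "\<dots> \<le> ennreal (Q * h * r)"
        using Qp h0 r by (intro ennreal_leI mult_right_mono) (auto simp: Q_def)
      finally show ?thesis .
    next
      case False
      have "emeasure \<mu> {x\<in>space \<mu>. boundary_dist \<Omega> x < r} \<le> emeasure \<mu> (space \<mu>)"
        by (rule emeasure_space)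
      also have "\<dots> = ennreal m" by (simp add: emeasure_eq_measure measure_mu[simplified] m_def)
      also have "\<dots> \<le> ennreal (Q2 * h * R)" by (intro ennreal_leI mQ)
      also have "\<dots> \<le> ennreal (Q * h * r)"
        using Qp h0 r R False by (intro ennreal_leI mult_mono) (auto simp: Q_def)
      finally show ?thesis .
    qed
    define A where "A = m powr (1 - 2 * \<beta>) * h powr (2 * \<beta>)"
    have 1: "neg_power_integral \<Omega> u \<beta> \<le> ennreal (C * A)"
      using neg_power_integral_ahlfors[OF u \<beta> _ hp _ V] Qp mp by (simp add: C_def n_def A_def m_def)
    have "A \<le> (v * d ^ n) powr (1 - 2 * \<beta>) * (D * d ^ (n - 1)) powr (2 * \<beta>)"
      unfolding A_def using md hD mp h0 \<beta> by (intro mult_mono powr_mono2) auto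
    also have "\<dots> = (v powr (1 - 2 * \<beta>) * D powr (2 * \<beta>)) * d powr (real n - 2 * \<beta>)"
    proof -
      have "(d ^ n) powr (1 - 2 * \<beta>) = d powr (real n * (1 - 2 * \<beta>))"
        using d by (simp add: powr_powr flip: powr_realpow)
      moreover have "(d ^ (n - 1)) powr (2 * \<beta>) = d powr ((real n - 1) * (2 * \<beta>))"
        using d n by (simp add: powr_powr of_nat_diff flip: powr_realpow)
      moreover have "d powr (real n * (1 - 2 * \<beta>)) * d powr ((real n - 1) * (2 * \<beta>)) = d powr (real n - 2 * \<beta>)"
        by (simp add: algebra_simps flip: powr_add)
      ultimately show ?thesis using v Dp d by (simp add: powr_mult mult_ac)
    qed
    finally have "C * A \<le> C' * d powr (real n - 2 * \<beta>)"
      using Cp by (simp add: C'_def mult.assoc)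
    then show "let A = measure lebesgue \<Omega> powr (1 - 2 * \<beta>) *
                   enn2real (hausdorff_measure (DIM('a) - 1) (frontier \<Omega>)) powr (2 * \<beta>)
           in neg_power_integral \<Omega> u \<beta> \<le> ennreal (C * A) \<and>
              C * A \<le> C' * diameter \<Omega> powr (real DIM('a) - 2 * \<beta>)"
      using 1 by (simp add: A_def m_def h_def n_def d_def Let_def)
  qed
qed

subsection \<open>Weyl's lemma\<close>

text \<open>The counterpart of \<open>smooth_local\<close> on a set. In \<open>weyl\<close> the
  representing smooth function changes with the point, as the mollifier must fit into
  \<Omega>.\<close>

lemma C_k_on_local:
  fixes f :: "'a::euclidean_space \<Rightarrow> real"
  assumes "\<And>x. x \<in> S \<Longrightarrow> \<exists>U g. open U \<and> x \<in> U \<and> smooth g \<and> (\<forall>y\<in>U. f y = g y)"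
  shows "C_k_on k f S"
  unfolding C_k_on_def
proof (intro allI impI)
  fix bs :: "'a list" assume bs: "set bs \<subseteq> Basis \<and> length bs \<le> k"
  have *: "foldr partial bs f differentiable (at x)" if "x \<in> S" for x
  proof -
    obtain U g where U: "open U" "x \<in> U" "smooth g" "\<forall>y\<in>U. f y = g y" using assms[OF \<open>x \<in> S\<close>] by blast
    have "smooth (foldr partial bs g)"
      using bs U(3) by (induction bs) (auto intro: smooth_partial)
    then show ?thesis
    proof (intro differentiable_cong_open[OF U(1) _ U(2) smooth_differentiable])
      show "foldr partial bs f y = foldr partial bs g y" if "y \<in> U" for y
        by (rule foldr_partial_cong[OF U(1) _ that]) (use U(4) in auto)
    qed
  qed
  then show "continuous_on S (foldr partial bs f) \<and> (length bs < k \<longrightarrow> (\<forall>x\<in>S. foldr partial bs f differentiable at x))"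
    using differentiable_imp_continuous_on[of "foldr partial bs f" S]
    by (auto simp: differentiable_on_def intro: differentiable_at_withinI)
qed

lemma laplacian_cong:
  fixes f g :: "'a::euclidean_space \<Rightarrow> real"
  assumes "open S" "\<And>x. x \<in> S \<Longrightarrow> f x = g x" "x \<in> S"
  shows "laplacian f x = laplacian g x"
  unfolding laplacian_def
  by (intro sum.cong refl partial_cong[OF assms(1) _ assms(3)] partial_cong[OF assms(1,2)])

lemma partial_reflect:
  fixes f :: "'a::euclidean_space \<Rightarrow> real"
  assumes "smooth f"
  shows "partial b (\<lambda>y. f (x - y)) y = - partial b f (x - y)" "(\<lambda>y. f (x - y)) differentiable (at y)"
proof -
  have D: "(f has_derivative frechet_derivative f (at (x - y))) (at (x - y))"
    using smooth_differentiable[OF assms] frechet_derivative_works by blast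
  have *: "((\<lambda>y. f (x - y)) has_derivative (\<lambda>h. frechet_derivative f (at (x - y)) (- h))) (at y)"
    by (rule has_derivative_compose[where g=f and f="\<lambda>y. x - y", OF _ D]) (auto intro!: derivative_eq_intros)
  show "(\<lambda>y. f (x - y)) differentiable (at y)" using * unfolding differentiable_def by blast
  show "partial b (\<lambda>y. f (x - y)) y = - partial b f (x - y)"
    using partial_eqI[OF *] linear_neg[OF has_derivative_linear[OF D], of b] by (simp add: partial_def)
qed

lemma smooth_reflect:
  fixes f :: "'a::euclidean_space \<Rightarrow> real"
  assumes "smooth f"
  shows "smooth (\<lambda>y. f (x - y))"
proof (rule smooth_coinduct[where P="\<lambda>g. \<exists>f. smooth f \<and> g = (\<lambda>y. f (x - y))"])
  fix g :: "'a \<Rightarrow> real" and b :: 'a assume "\<exists>f. smooth f \<and> g = (\<lambda>y. f (x - y))" "b \<in> Basis"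
  then obtain f where f: "smooth f" "g = (\<lambda>y. f (x - y))" by blast
  have "partial b g = (\<lambda>y. (\<lambda>z. - partial b f z) (x - y))"
    using partial_reflect(1)[OF f(1)] by (simp add: f(2) fun_eq_iff)
  then show "\<exists>f. smooth f \<and> partial b g = (\<lambda>y. f (x - y))"
    using smooth_minus[OF smooth_partial[OF f(1) \<open>b \<in> Basis\<close>]] by blast
qed (use assms partial_reflect(2) in blast)+

lemma laplacian_reflect:
  fixes f :: "'a::euclidean_space \<Rightarrow> real"
  assumes "smooth f"
  shows "laplacian (\<lambda>y. f (x - y)) y = laplacian f (x - y)"
proof -
  have "partial b (partial b (\<lambda>y. f (x - y))) y = partial b (partial b f) (x - y)" if b: "b \<in> Basis" for b
  proof -
    have "partial b (\<lambda>y. f (x - y)) = (\<lambda>y. -1 * partial b f (x - y))"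
      using partial_reflect(1)[OF assms] by (simp add: fun_eq_iff)
    then show ?thesis
      using partial_cmult[OF smooth_reflect[OF smooth_partial[OF assms b]], of b "-1" x y]
        partial_reflect(1)[OF smooth_partial[OF assms b], of b x y] by simp
  qed
  then show ?thesis by (simp add: laplacian_def)
qed

lemma laplacian_cmult:
  assumes "smooth f" shows "laplacian (\<lambda>x. c * f x) x = c * laplacian f x"
proof -
  have "partial b (partial b (\<lambda>x. c * f x)) x = c * partial b (partial b f) x" if "b \<in> Basis" for b
    using partial_cmult[OF smooth_partial[OF assms that], of b c x] by (simp add: partial_cmult[OF assms, abs_def])
  then show ?thesis by (simp add: laplacian_def sum_distrib_left)
qed

section \<open>Convolution with smooth kernels of compact support\<close>

definition convolve :: "('a::euclidean_space \<Rightarrow> real) \<Rightarrow> ('a \<Rightarrow> real) \<Rightarrow> 'a \<Rightarrow> real" where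
  "convolve v \<eta> x = (LINT y|lborel. v y * \<eta> (x - y))"

lemma convolve_partial:
  fixes v \<eta> :: "'a::euclidean_space \<Rightarrow> real"
  assumes v: "integrable lborel v" and \<eta>: "smooth \<eta>" "compact C" "\<And>z. z \<notin> C \<Longrightarrow> \<eta> z = 0"
  shows "convolve v \<eta> differentiable (at x)"
    and "b \<in> Basis \<Longrightarrow> partial b (convolve v \<eta>) x = convolve v (partial b \<eta>) x"
proof -
  \<comment> \<open>Contains every y with p - y in \<open>C\<close> for some p in the unit ball
    about x, so one compact set serves all parameters near x.\<close>
  define C' where "C' = (\<lambda>(p, z). p - z) ` (cball x 1 \<times> C)"
  have C': "compact C'"
    unfolding C'_def using \<eta>(2)
    by (intro compact_continuous_image compact_Times) (auto simp: case_prod_beta intro!: continuous_intros)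
  have out: "p - y \<notin> C" if "p \<in> ball x 1" "y \<notin> C'" for p y
  proof
    assume "p - y \<in> C"
    then have "(\<lambda>(p, z). p - z) (p, p - y) \<in> C'" using that unfolding C'_def by (intro imageI) auto
    then show False using that by simp
  qed
  have grad0: "gradient \<eta> z = 0" if "z \<notin> C" for z
    using partial_zero_outside[OF compact_imp_closed[OF \<eta>(2)] \<eta>(3) that] by (simp add: gradient_def)
  have cg: "continuous_on UNIV (\<lambda>y. gradient \<eta> (x - y))"
    by (rule continuous_on_compose2[OF continuous_on_gradient[OF \<eta>(1), of UNIV]]) (auto intro!: continuous_intros)
  have D: "(convolve v \<eta> has_derivative (\<lambda>h. (LINT y|lborel. v y *\<^sub>R gradient \<eta> (x - y)) \<bullet> h)) (at x)"
    unfolding convolve_def[abs_def]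
  proof (rule has_derivative_integral_kernel[OF v open_ball, of x x 1])
    show "((\<lambda>p. \<eta> (p - y)) has_derivative (\<lambda>h. gradient \<eta> (p - y) \<bullet> h)) (at p)" for p y
      by (rule has_derivative_compose[where g=\<eta> and f="\<lambda>p. p - y", OF _ has_derivative_gradient])
         (auto intro!: derivative_eq_intros smooth_differentiable \<eta>)
    show "continuous_on (ball x 1 \<times> UNIV) (\<lambda>(p, y). gradient \<eta> (p - y))"
      unfolding case_prod_beta
      by (rule continuous_on_compose2[OF continuous_on_gradient[OF \<eta>(1), of UNIV]]) (auto intro!: continuous_intros)
    show "continuous_on UNIV (\<lambda>y. \<eta> (p - y))" for p
      by (rule smooth_continuous[OF smooth_reflect[OF \<eta>(1)]])
    show "compact C'" by (rule C')
  qed (use out \<eta>(3) grad0 in auto)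
  then show "convolve v \<eta> differentiable (at x)" unfolding differentiable_def by blast
  assume b: "b \<in> Basis"
  have "integrable lborel (\<lambda>y. v y *\<^sub>R gradient \<eta> (x - y))"
    using out[of x] grad0 by (intro integrable_mult_compact_support[OF v cg C']) auto
  then have "(LINT y|lborel. v y *\<^sub>R gradient \<eta> (x - y)) \<bullet> b = (LINT y|lborel. (v y *\<^sub>R gradient \<eta> (x - y)) \<bullet> b)"
    by (rule integral_inner_left[symmetric])
  then show "partial b (convolve v \<eta>) x = convolve v (partial b \<eta>) x"
    using partial_eqI[OF D, of b] by (simp add: gradient_inner b convolve_def)
qed

lemma convolve_smooth:
  fixes v \<eta> :: "'a::euclidean_space \<Rightarrow> real"
  assumes v: "integrable lborel v" and \<eta>: "smooth \<eta>" "compact C" "\<And>z. z \<notin> C \<Longrightarrow> \<eta> z = 0"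
  shows "smooth (convolve v \<eta>)"
proof (rule smooth_coinduct[where P="\<lambda>f. \<exists>\<eta>. smooth \<eta> \<and> (\<forall>z. z \<notin> C \<longrightarrow> \<eta> z = 0) \<and> f = convolve v \<eta>"])
  show "\<exists>\<eta>'. smooth \<eta>' \<and> (\<forall>z. z \<notin> C \<longrightarrow> \<eta>' z = 0) \<and> convolve v \<eta> = convolve v \<eta>'"
    using \<eta> by blast
next
  fix f and b :: 'a assume "\<exists>\<eta>. smooth \<eta> \<and> (\<forall>z. z \<notin> C \<longrightarrow> \<eta> z = 0) \<and> f = convolve v \<eta>" "b \<in> Basis"
  then obtain \<eta>' where e: "smooth \<eta>'" "\<And>z. z \<notin> C \<Longrightarrow> \<eta>' z = 0" "f = convolve v \<eta>'" by blast
  have "partial b f = convolve v (partial b \<eta>')"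
    using convolve_partial(2)[OF v e(1) \<eta>(2) e(2) \<open>b \<in> Basis\<close>] by (auto simp: e(3))
  moreover have "partial b \<eta>' z = 0" if "z \<notin> C" for z
    using partial_zero_outside[OF compact_imp_closed[OF \<eta>(2)] e(2) that] .
  ultimately show "\<exists>\<eta>. smooth \<eta> \<and> (\<forall>z. z \<notin> C \<longrightarrow> \<eta> z = 0) \<and> partial b f = convolve v \<eta>"
    using smooth_partial[OF e(1) \<open>b \<in> Basis\<close>] by blast
qed (use convolve_partial(1)[OF v _ \<eta>(2)] in blast)

text \<open>The Laplacian falls on the kernel as a function of y, the variable in which a weak
  equation for \<open>v\<close> can be tested.\<close>

lemma convolve_laplacian:
  fixes v \<eta> :: "'a::euclidean_space \<Rightarrow> real"
  assumes v: "integrable lborel v" and \<eta>: "smooth \<eta>" "compact C" "\<And>z. z \<notin> C \<Longrightarrow> \<eta> z = 0"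
  shows "laplacian (convolve v \<eta>) x = (LINT y|lborel. v y * laplacian (\<lambda>y. \<eta> (x - y)) y)"
proof -
  have p0: "partial b \<eta> z = 0" if "z \<notin> C" for z b
    using partial_zero_outside[OF compact_imp_closed[OF \<eta>(2)] \<eta>(3) that] .
  have pp0: "partial b (partial b \<eta>) z = 0" if "z \<notin> C" for z b
    using partial_zero_outside[OF compact_imp_closed[OF \<eta>(2)] p0 that] .
  have "compact ((\<lambda>z. x - z) ` C)" using \<eta>(2) by (intro compact_continuous_image continuous_intros)
  then have i: "integrable lborel (\<lambda>y. v y * partial b (partial b \<eta>) (x - y))" if b: "b \<in> Basis" for b
    using integrable_mult_compact_support[OF v smooth_continuous[OF smooth_reflect[OF smooth_partial[OF smooth_partial[OF \<eta>(1) b] b]]], of "(\<lambda>z. x - z) ` C" x]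
      pp0 by (force simp: image_iff)
  have "laplacian (convolve v \<eta>) x = (\<Sum>b\<in>Basis. convolve v (partial b (partial b \<eta>)) x)"
    unfolding laplacian_def
  proof (rule sum.cong[OF refl])
    fix b :: 'a assume b: "b \<in> Basis"
    have "partial b (convolve v \<eta>) = convolve v (partial b \<eta>)"
      using convolve_partial(2)[OF v \<eta> b] by auto
    then show "partial b (partial b (convolve v \<eta>)) x = convolve v (partial b (partial b \<eta>)) x"
      using convolve_partial(2)[OF v smooth_partial[OF \<eta>(1) b] \<eta>(2) p0 b] by simp
  qed
  also have "\<dots> = (LINT y|lborel. (\<Sum>b\<in>Basis. v y * partial b (partial b \<eta>) (x - y)))"
    unfolding convolve_def by (rule Bochner_Integration.integral_sum[symmetric]) (rule i)
  finally show ?thesis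
    by (simp add: laplacian_reflect[OF \<eta>(1)] laplacian_def sum_distrib_left)
qed

text \<open>A bump supported in the ball of radius \<sigma>^(-1/2). Its mass is not 1, but for
  \<sigma> > 1/4 it is shown not to depend on \<sigma>. The profile is the derivative of
  \<open>hk 0\<close>, so that a potential built from \<open>hk 0\<close> exists.\<close>

definition mollifier :: "real \<Rightarrow> 'a::euclidean_space \<Rightarrow> real" where
  "mollifier \<sigma> z = \<sigma> powr (DIM('a) / 2) * hk (Suc 0) (1 - \<sigma> * (z \<bullet> z))"

lemma smooth_inner_self: "smooth (\<lambda>x::'a::euclidean_space. x \<bullet> x)"
  by (subst euclidean_inner) (intro smooth_sum smooth_mult smooth_inner)

lemma partial_inner_self: "partial b (\<lambda>x::'a::euclidean_space. x \<bullet> x) x = 2 * (x \<bullet> b)"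
  by (rule partial_eqI[where f'="\<lambda>h. 2 * (x \<bullet> h)"]) (auto intro!: derivative_eq_intros simp: inner_commute)

lemma mollifier_props:
  fixes z :: "'a::euclidean_space"
  shows smooth_mollifier: "smooth (mollifier \<sigma> :: 'a \<Rightarrow> real)"
    and mollifier_nonneg: "0 \<le> mollifier \<sigma> z"
    and mollifier_minus: "mollifier \<sigma> (x - y) = mollifier \<sigma> (y - x)"
    and mollifier_uminus: "mollifier \<sigma> (- z) = mollifier \<sigma> z"
proof -
  show "smooth (mollifier \<sigma> :: 'a \<Rightarrow> real)"
    unfolding mollifier_def[abs_def]
    by (intro smooth_cmult smooth_hk smooth_diff smooth_const smooth_inner_self)
  show "mollifier \<sigma> (x - y) = mollifier \<sigma> (y - x)" by (simp add: mollifier_def inner_diff inner_commute algebra_simps)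
qed (simp_all add: mollifier_def hk_1_nonneg)

lemma hk_outside:
  assumes "0 < \<rho>" "1 / \<rho>\<^sup>2 \<le> \<sigma>" "z \<notin> cball 0 \<rho>"
  shows "hk j (1 - \<sigma> * (z \<bullet> z)) = 0"
proof -
  have "\<rho>\<^sup>2 \<le> z \<bullet> z"
    using assms power_mono[of \<rho> "norm z" 2] by (simp add: power2_norm_eq_inner)
  then have "1 / \<rho>\<^sup>2 * \<rho>\<^sup>2 \<le> \<sigma> * (z \<bullet> z)"
    using assms by (intro mult_mono) (auto intro: order.trans[rotated])
  then show ?thesis using assms by simp
qed

lemma mollifier_outside: "0 < \<rho> \<Longrightarrow> 1 / \<rho>\<^sup>2 \<le> \<sigma> \<Longrightarrow> z \<notin> cball 0 \<rho> \<Longrightarrow> mollifier \<sigma> z = 0"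
  by (simp add: mollifier_def hk_outside del: mem_cball_0)

text \<open>The normalisation of \<open>mollifier\<close> is the one for which its \<open>\<sigma>\<close>-derivative is a Laplacian.\<close>

definition mollifier_potential :: "real \<Rightarrow> 'a::euclidean_space \<Rightarrow> real" where
  "mollifier_potential \<sigma> z = (- (\<sigma> powr (DIM('a) / 2 - 2)) / 4) * hk 0 (1 - \<sigma> * (z \<bullet> z))"

definition mollifier_deriv :: "real \<Rightarrow> 'a::euclidean_space \<Rightarrow> real" where
  "mollifier_deriv \<sigma> z = DIM('a) / 2 * \<sigma> powr (DIM('a) / 2 - 1) * hk (Suc 0) (1 - \<sigma> * (z \<bullet> z))
     - \<sigma> powr (DIM('a) / 2) * (z \<bullet> z) * hk (Suc (Suc 0)) (1 - \<sigma> * (z \<bullet> z))"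

lemma mollifier_has_derivative:
  fixes z :: "'a::euclidean_space"
  assumes "0 < \<sigma>"
  shows "((\<lambda>\<sigma>. mollifier \<sigma> z) has_real_derivative mollifier_deriv \<sigma> z) (at \<sigma>)"
proof -
  have 1: "((\<lambda>\<sigma>. \<sigma> powr (DIM('a) / 2)) has_real_derivative (DIM('a) / 2 * \<sigma> powr (DIM('a) / 2 - 1))) (at \<sigma>)"
    using assms by (rule has_real_derivative_powr)
  have "((\<lambda>\<sigma>. 1 - \<sigma> * (z \<bullet> z)) has_real_derivative - (z \<bullet> z)) (at \<sigma>)"
    by (auto intro!: derivative_eq_intros)
  from DERIV_chain2[OF hk_deriv this] DERIV_mult[OF 1 this]
  have 2: "((\<lambda>\<sigma>. hk (Suc 0) (1 - \<sigma> * (z \<bullet> z))) has_real_derivative hk (Suc (Suc 0)) (1 - \<sigma> * (z \<bullet> z)) * - (z \<bullet> z)) (at \<sigma>)"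
    by blast
  from DERIV_mult[OF 1 2] show ?thesis
    unfolding mollifier_def by (rule DERIV_cong) (simp add: mollifier_deriv_def algebra_simps)
qed

lemma smooth_mollifier_potential: "smooth (mollifier_potential \<sigma>)"
  unfolding mollifier_potential_def[abs_def]
  by (intro smooth_cmult smooth_hk smooth_diff smooth_const smooth_inner_self)

text \<open>With h' and h'' denoting \<open>hk (Suc 0)\<close> and \<open>hk (Suc (Suc 0))\<close>
  at 1 - \<sigma> |z|^2, the function \<open>hk 0\<close> of that argument has Laplacian 4
  \<sigma>^2 |z|^2 h'' - 2 n \<sigma> h'. The prefactor of the potential is found by matching this
  with the product rule in \<sigma>.\<close>

lemma mollifier_deriv_eq_laplacian:
  fixes z :: "'a::euclidean_space"
  assumes "0 < \<sigma>"
  shows "mollifier_deriv \<sigma> z = laplacian (mollifier_potential \<sigma>) z"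
proof -
  define c where "c = - (\<sigma> powr (DIM('a) / 2 - 2)) / 4"
  define s where "s z = 1 - \<sigma> * (z \<bullet> z)" for z :: 'a
  have ss: "smooth s" unfolding s_def[abs_def] by (intro smooth_diff smooth_const smooth_cmult smooth_inner_self)
  have ps: "partial b s z = - (2 * \<sigma>) * (z \<bullet> b)" for b z
    using partial_add[of "\<lambda>_. 1" z "\<lambda>z. - \<sigma> * (z \<bullet> z)" b] partial_cmult[OF smooth_inner_self, of b "- \<sigma>" z]
      smooth_differentiable[OF smooth_cmult[OF smooth_inner_self, of "- \<sigma>"]]
    by (simp add: s_def[abs_def] partial_inner_self)
  have ph: "partial b (\<lambda>z. hk j (s z)) z = hk (Suc j) (s z) * (- (2 * \<sigma>) * (z \<bullet> b))" for b j z
    using partial_compose[OF smooth_differentiable[OF ss] hk_deriv] by (simp add: ps)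
  have sh: "smooth (\<lambda>z. hk j (s z))" for j by (rule smooth_hk[OF ss])
  have pp: "partial b (partial b (mollifier_potential \<sigma>)) z
      = c * (4 * \<sigma>\<^sup>2 * (z \<bullet> b)\<^sup>2 * hk (Suc (Suc 0)) (s z) - 2 * \<sigma> * hk (Suc 0) (s z))" if b: "b \<in> Basis" for b
  proof -
    have kp: "mollifier_potential \<sigma> = (\<lambda>z. c * hk 0 (s z))" by (simp add: mollifier_potential_def[abs_def] c_def s_def)
    have 1: "partial b (mollifier_potential \<sigma>) = (\<lambda>z. (- (2 * \<sigma>) * c) * (hk (Suc 0) (s z) * (z \<bullet> b)))"
      unfolding kp by (rule ext, subst partial_cmult[OF sh]) (simp add: ph)
    have "partial b (\<lambda>z. hk (Suc 0) (s z) * (z \<bullet> b)) z = hk (Suc 0) (s z) + hk (Suc (Suc 0)) (s z) * (- (2 * \<sigma>) * (z \<bullet> b)) * (z \<bullet> b)"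
      using b by (subst partial_mult) (auto simp: smooth_differentiable sh smooth_inner ph)
    note 2 = this
    show ?thesis
      unfolding 1 partial_cmult[OF smooth_mult[OF sh smooth_inner]] 2 by (simp add: algebra_simps power2_eq_square)
  qed
  have "laplacian (mollifier_potential \<sigma>) z = c * (4 * \<sigma>\<^sup>2 * hk (Suc (Suc 0)) (s z) * (\<Sum>b\<in>Basis. (z \<bullet> b)\<^sup>2) - DIM('a) * (2 * \<sigma> * hk (Suc 0) (s z)))"
    unfolding laplacian_def by (simp add: pp sum_subtractf sum_distrib_left algebra_simps)
  also have "(\<Sum>b\<in>Basis. (z \<bullet> b)\<^sup>2) = z \<bullet> z" by (subst (2) euclidean_inner) (simp add: power2_eq_square)
  also have "c * (4 * \<sigma>\<^sup>2 * hk (Suc (Suc 0)) (s z) * (z \<bullet> z) - DIM('a) * (2 * \<sigma> * hk (Suc 0) (s z))) = mollifier_deriv \<sigma> z"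
  proof -
    have e: "\<sigma> powr (DIM('a) / 2 - 2) = \<sigma> powr (DIM('a) / 2) / \<sigma>\<^sup>2" "\<sigma> powr (DIM('a) / 2 - 1) = \<sigma> powr (DIM('a) / 2) / \<sigma>"
      using assms by (simp_all add: powr_diff powr_numeral)
    show ?thesis
      using assms unfolding mollifier_deriv_def c_def e s_def by (simp add: field_simps power2_eq_square)
  qed
  finally show ?thesis by simp
qed

text \<open>The derivative in \<sigma> is \<open>v\<close> tested with the Laplacian of the
  reflected potential. It vanishes as long as the support, a ball of radius below \<rho>, stays
  inside \<Omega>. This takes the place of the mean value property.\<close>

lemma convolve_mollifier_const:
  fixes v :: "'a::euclidean_space \<Rightarrow> real"
  assumes v: "integrable lborel v" and harm: "\<And>\<phi>. test_function \<Omega> \<phi> \<Longrightarrow> (LINT x|lborel. v x * laplacian \<phi> x) = 0"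
    and \<rho>: "0 < \<rho>" "cball x \<rho> \<subseteq> \<Omega>" and \<sigma>: "1 / \<rho>\<^sup>2 < \<sigma>" "1 / \<rho>\<^sup>2 < \<sigma>'"
  shows "convolve v (mollifier \<sigma>) x = convolve v (mollifier \<sigma>') x"
proof -
  define S where "S = {1 / \<rho>\<^sup>2<..}"
  have S: "0 < \<sigma>" "1 / \<rho>\<^sup>2 \<le> \<sigma>" if "\<sigma> \<in> S" for \<sigma>
    using that \<rho>(1) by (auto simp: S_def intro: less_trans[rotated])
  have ball: "x - y \<notin> cball 0 \<rho>" if "y \<notin> cball x \<rho>" for y
    using that by (simp add: dist_norm norm_minus_commute)
  have hkc: "continuous_on UNIV (hk j)" for j
    using hk_deriv DERIV_isCont continuous_at_imp_continuous_on by blast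
  have "((\<lambda>\<sigma>. convolve v (mollifier \<sigma>) x) has_derivative (\<lambda>h. 0)) (at \<sigma>)" if "\<sigma> \<in> S" for \<sigma>
  proof -
    have "((\<lambda>\<sigma>. convolve v (mollifier \<sigma>) x) has_derivative (\<lambda>h. (LINT y|lborel. v y *\<^sub>R mollifier_deriv \<sigma> (x - y)) \<bullet> h)) (at \<sigma>)"
      unfolding convolve_def
    proof (rule has_derivative_integral_kernel[OF v, of S])
      show "((\<lambda>\<sigma>. mollifier \<sigma> (x - y)) has_derivative (\<lambda>h. mollifier_deriv p (x - y) \<bullet> h)) (at p)" if "p \<in> S" for p y
        using mollifier_has_derivative[OF S(1)[OF that], of "x - y"] by (simp add: has_field_derivative_def)
      show "continuous_on (S \<times> UNIV) (\<lambda>(\<sigma>, y). mollifier_deriv \<sigma> (x - y))"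
        unfolding mollifier_deriv_def case_prod_beta
        using S(1) by (intro continuous_intros continuous_on_compose2[OF hkc]) auto
      show "continuous_on UNIV (\<lambda>y. mollifier p (x - y))" for p
        by (rule smooth_continuous[OF smooth_reflect[OF smooth_mollifier]])
      show "mollifier p (x - y) = 0" if "p \<in> S" "y \<notin> cball x \<rho>" for p y
        by (rule mollifier_outside[OF \<rho>(1) S(2)[OF that(1)] ball[OF that(2)]])
      show "mollifier_deriv p (x - y) = 0" if "p \<in> S" "y \<notin> cball x \<rho>" for p y
        using hk_outside[OF \<rho>(1) S(2)[OF that(1)] ball[OF that(2)]] by (simp add: mollifier_deriv_def)
    qed (use that in \<open>auto simp: S_def\<close>)
    moreover have "(LINT y|lborel. v y *\<^sub>R mollifier_deriv \<sigma> (x - y)) = 0"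
    proof -
      have "test_function \<Omega> (\<lambda>y. mollifier_potential \<sigma> (x - y))"
        unfolding test_function_alt
        using smooth_reflect[OF smooth_mollifier_potential] \<rho> hk_outside[OF \<rho>(1) S(2)[OF that] ball]
        by (intro conjI exI[of _ "cball x \<rho>"]) (auto simp: mollifier_potential_def simp del: mem_cball)
      from harm[OF this] show ?thesis
        by (simp add: laplacian_reflect[OF smooth_mollifier_potential] mollifier_deriv_eq_laplacian[OF S(1)[OF that]])
    qed
    ultimately show ?thesis by simp
  qed
  then have "\<exists>c. \<forall>\<sigma>\<in>S. convolve v (mollifier \<sigma>) x = c"
    by (intro has_derivative_zero_constant[of S]) (auto simp: S_def intro: has_derivative_at_withinI)
  then show ?thesis using \<sigma> by (auto simp: S_def)
qed

lemma integral_laplacian_test: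
  assumes "test_function S \<phi>"
  shows "(LINT x|lborel. laplacian \<phi> x) = 0"
proof -
  obtain C where C: "compact C" "\<And>x. x \<notin> C \<Longrightarrow> \<phi> x = 0" "smooth \<phi>"
    using assms unfolding test_function_alt by blast
  have p0: "partial b \<phi> z = 0" if "z \<notin> C" for z b
    using partial_zero_outside[OF compact_imp_closed[OF C(1)] C(2) that] .
  have pp0: "partial b (partial b \<phi>) z = 0" if "z \<notin> C" for z b
    using partial_zero_outside[OF compact_imp_closed[OF C(1)] p0 that] .
  have i: "integrable lborel (partial b (partial b \<phi>))" if "b \<in> Basis" for b
  proof -
    have "integrable lborel (\<lambda>x. indicator C x * partial b (partial b \<phi>) x)"
      using integrable_mult_compact_support[of "indicator C" "partial b (partial b \<phi>)" C] emeasure_compact_finite[OF C(1)]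
        smooth_continuous[OF smooth_partial[OF smooth_partial[OF C(3) that] that]] pp0 C(1)
      by (auto simp: compact_imp_closed)
    also have "(\<lambda>x. indicator C x * partial b (partial b \<phi>) x) = partial b (partial b \<phi>)"
      using pp0 by (auto simp: indicator_def fun_eq_iff)
    finally show ?thesis .
  qed
  then have "(LINT x|lborel. laplacian \<phi> x) = (\<Sum>b\<in>Basis. LINT x|lborel. partial b (partial b \<phi>) x)"
    unfolding laplacian_def by (rule Bochner_Integration.integral_sum)
  also have "\<dots> = 0"
    using integral_partial_eq_0[OF smooth_partial[OF C(3)] C(1) p0] by (intro sum.neutral) auto
  finally show ?thesis .
qed

definition mollifier_mass :: "'a::euclidean_space itself \<Rightarrow> real" where
  "mollifier_mass _ = (LINT y|lborel. mollifier 1 (y::'a))"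

lemma integrable_mollifier:
  assumes "0 < \<sigma>" shows "integrable lborel (\<lambda>y::'a::euclidean_space. mollifier \<sigma> (x - y))"
proof -
  define \<rho> where "\<rho> = 1 / sqrt \<sigma>"
  have \<rho>: "0 < \<rho>" "1 / \<rho>\<^sup>2 \<le> \<sigma>" using assms by (auto simp: \<rho>_def power_divide)
  have 0: "mollifier \<sigma> (x - y) = 0" if "y \<notin> cball x \<rho>" for y
    using that by (intro mollifier_outside[OF \<rho>]) (auto simp: dist_norm norm_minus_commute)
  have "integrable lborel (\<lambda>y. indicator (cball x \<rho>) y *\<^sub>R mollifier \<sigma> (x - y))"
    using 0 emeasure_compact_finite[OF compact_cball[of x \<rho>]]
    by (intro integrable_mult_compact_support[where C="cball x \<rho>"] smooth_continuous smooth_reflect smooth_mollifier) auto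
  also have "(\<lambda>y. indicator (cball x \<rho>) y *\<^sub>R mollifier \<sigma> (x - y)) = (\<lambda>y. mollifier \<sigma> (x - y))"
    using 0 by (auto simp: indicator_def fun_eq_iff)
  finally show ?thesis .
qed

lemma mollifier_borel [measurable]: "mollifier \<sigma> \<in> borel_measurable borel"
  by (rule borel_measurable_continuous_onI[OF smooth_continuous[OF smooth_mollifier]])

text \<open>The mass is the convolution with the harmonic function 1, so it does not depend on the
  scale. To be integrable, 1 is cut off to the ball of radius 3; \<sigma> > 1/4 keeps the mollifier
  in the ball of radius 2, which corresponds to \<rho> = 2.\<close>

lemma integral_mollifier:
  fixes x :: "'a::euclidean_space"
  assumes "1/4 < \<sigma>" shows "(LINT y|lborel. mollifier \<sigma> (x - y)) = mollifier_mass TYPE('a)"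
proof -
  have 0: "(LINT y|lborel. mollifier \<sigma> (x - y)) = (LINT y|lborel. mollifier \<sigma> (0 - y :: 'a))" for \<sigma> and x :: 'a
  proof -
    have "(LINT y|lborel. mollifier \<sigma> (x - y)) = (LINT y|lborel. mollifier \<sigma> (- x + y))"
      by (simp add: mollifier_minus[of _ x])
    also have "\<dots> = (LINT y|distr lborel borel ((+) (- x)). mollifier \<sigma> y)"
      by (rule integral_distr[symmetric]) auto
    also have "\<dots> = (LINT y|lborel. mollifier \<sigma> (0 - y :: 'a))" by (simp add: lborel_distr_plus mollifier_uminus)
    finally show ?thesis .
  qed
  define v where "v = (indicator (cball 0 3) :: 'a \<Rightarrow> real)"
  have v: "integrable lborel v"
    unfolding v_def using emeasure_compact_finite[OF compact_cball[of 0 3]] by (intro integrable_real_indicator) auto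
  have c: "convolve v (mollifier \<sigma>) 0 = (LINT y|lborel. mollifier \<sigma> (0 - y :: 'a))" if "1/4 < \<sigma>" for \<sigma>
  proof -
    have "v y * mollifier \<sigma> (0 - y) = mollifier \<sigma> (0 - y)" for y :: 'a
    proof (cases "y \<in> cball 0 2")
      case True
      then show ?thesis by (auto simp: v_def)
    next
      case False
      then have "mollifier \<sigma> (0 - y) = 0" using that by (intro mollifier_outside[of 2]) auto
      then show ?thesis by simp
    qed
    then show ?thesis unfolding convolve_def by (simp only:)
  qed
  have "convolve v (mollifier \<sigma>) 0 = convolve v (mollifier 1) 0"
  proof (rule convolve_mollifier_const[OF v, of "ball 0 3" 2])
    fix \<phi> :: "'a \<Rightarrow> real" assume \<phi>: "test_function (ball 0 3) \<phi>"
    \<comment> \<open>Since the Laplacian of \<phi> vanishes off the ball, the cut-off is not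
      noticed, and the integral of a Laplacian of a test function is 0.\<close>
    have "laplacian \<phi> x = 0" if "x \<notin> cball 0 3" for x
    proof -
      have "laplacian \<phi> x = laplacian (\<lambda>x. 0) x"
      proof (rule laplacian_cong[of "- cball 0 3"])
        show "\<phi> y = 0" if "y \<in> - cball 0 3" for y
          using that by (intro test_function_outside[OF \<phi>]) auto
      qed (use that in auto)
      then show ?thesis by (simp add: laplacian_def)
    qed
    then have "v x * laplacian \<phi> x = laplacian \<phi> x" for x by (auto simp: v_def indicator_def)
    then show "(LINT x|lborel. v x * laplacian \<phi> x) = 0"
      using integral_laplacian_test[OF \<phi>] by (simp only:)
  qed (use assms in auto)
  then have "(LINT y|lborel. mollifier \<sigma> (0 - y :: 'a)) = (LINT y|lborel. mollifier 1 (0 - y :: 'a))"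
    using c assms by simp
  also have "\<dots> = mollifier_mass TYPE('a)" by (simp add: mollifier_mass_def mollifier_uminus)
  finally show ?thesis using 0 by metis
qed

lemma mollifier_mass_pos: "0 < mollifier_mass TYPE('a::euclidean_space)"
proof (rule ccontr)
  have i: "integrable lborel (mollifier 1 :: 'a \<Rightarrow> real)" using integrable_mollifier[of 1 "0::'a"] by (simp add: mollifier_uminus)
  assume "\<not> 0 < mollifier_mass TYPE('a)"
  moreover have "0 \<le> mollifier_mass TYPE('a)" by (simp add: mollifier_mass_def mollifier_nonneg)
  ultimately have "(LINT y|lborel. mollifier 1 (y::'a)) = 0" by (simp add: mollifier_mass_def)
  then have "AE y in lborel. mollifier 1 (y::'a) = 0"
    using integral_nonneg_eq_0_iff_AE[OF i] mollifier_nonneg by auto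
  moreover have "mollifier 1 y \<noteq> 0" if "y \<in> ball 0 1" for y :: 'a
  proof -
    have "(norm y)\<^sup>2 < 1" using that by (simp add: abs_square_less_1)
    then show ?thesis by (simp add: mollifier_def hk_1 power2_norm_eq_inner)
  qed
  ultimately have "AE y in lborel. y \<notin> ball (0::'a) 1" by (auto elim: eventually_mono)
  then have "emeasure lborel (ball (0::'a) 1) = 0"
    by (subst (asm) AE_iff_measurable[of "ball 0 1"]) auto
  then show False using unit_ball_vol_pos[of "real DIM('a)"] by (simp add: emeasure_ball)
qed

lemma mollifier_compact_support:
  assumes "0 < \<sigma>"
  obtains \<rho> where "0 < \<rho>" "\<And>z. z \<notin> cball 0 \<rho> \<Longrightarrow> mollifier \<sigma> z = 0"
  using assms mollifier_outside[of "1 / sqrt \<sigma>" \<sigma>]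
  by (intro that[of "1 / sqrt \<sigma>"]) (auto simp: power_divide simp del: mem_cball_0)

lemma integrable_mult_mollifier:
  fixes f :: "'a::euclidean_space \<Rightarrow> real"
  assumes "0 < \<sigma>" "integrable lborel f"
  shows "integrable lborel (\<lambda>y. f y * mollifier \<sigma> (x - y))"
proof -
  obtain \<rho> where "\<And>z::'a. z \<notin> cball 0 \<rho> \<Longrightarrow> mollifier \<sigma> z = 0"
    using mollifier_compact_support[OF assms(1)] by metis
  then have "mollifier \<sigma> (x - y) = 0" if "y \<notin> cball x \<rho>" for y
    using that by (metis dist_norm mem_cball mem_cball_0)
  then have "integrable lborel (\<lambda>y. f y *\<^sub>R mollifier \<sigma> (x - y))"
    by (intro integrable_mult_compact_support[where C="cball x \<rho>"] smooth_continuous smooth_reflect smooth_mollifier assms compact_cball) auto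
  then show ?thesis by simp
qed

lemma mollify_tendsto:
  fixes w :: "'a::euclidean_space \<Rightarrow> real"
  assumes w: "integrable lborel w" and cont: "isCont w x"
  shows "(\<lambda>j. convolve w (mollifier (real j)) x) \<longlonglongrightarrow> mollifier_mass TYPE('a) * w x"
proof (rule LIMSEQ_I)
  fix e :: real assume "0 < e"
  define N where "N = mollifier_mass TYPE('a)"
  have N: "0 < N" by (simp add: N_def mollifier_mass_pos)
  define e' where "e' = e / (2 * N)"
  have e': "0 < e'" "e' * N < e" using N \<open>0 < e\<close> by (auto simp: e'_def)
  obtain d where d: "0 < d" "\<And>y. norm (y - x) < d \<Longrightarrow> \<bar>w y - w x\<bar> < e'"
    using cont e'(1) unfolding isCont_def LIM_eq by (metis abs_zero diff_self norm_zero real_norm_def)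
  define \<rho> where "\<rho> = d / 2"
  have \<rho>: "0 < \<rho>" using d by (simp add: \<rho>_def)
  obtain J :: nat where J: "max 1 (1 / \<rho>\<^sup>2) \<le> J" using real_arch_simple by blast
  have "\<bar>convolve w (mollifier (real j)) x - N * w x\<bar> < e" if "j \<ge> J" for j
  proof -
    have "real J \<le> real j" using that by simp
    then have j: "1 / \<rho>\<^sup>2 \<le> real j" "1/4 < real j" "0 < real j" using J by linarith+
    have out: "mollifier (real j) (x - y) = 0" if "y \<notin> cball x \<rho>" for y
      using that by (intro mollifier_outside[OF \<rho> j(1)]) (auto simp: dist_norm norm_minus_commute)
    have i1: "integrable lborel (\<lambda>y. w y * mollifier (real j) (x - y))"
      by (rule integrable_mult_mollifier[OF j(3) w])
    have i2: "integrable lborel (\<lambda>y. mollifier (real j) (x - y))" by (rule integrable_mollifier[OF j(3)])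
    have "convolve w (mollifier (real j)) x - N * w x = (LINT y|lborel. w y * mollifier (real j) (x - y) - w x * mollifier (real j) (x - y))"
      using i1 i2 integral_mollifier[OF j(2), of x] by (simp add: convolve_def N_def)
    also have "\<bar>\<dots>\<bar> \<le> (LINT y|lborel. \<bar>w y * mollifier (real j) (x - y) - w x * mollifier (real j) (x - y)\<bar>)"
      using integral_norm_bound[of lborel "\<lambda>y. w y * mollifier (real j) (x - y) - w x * mollifier (real j) (x - y)"] by simp
    also have "\<dots> \<le> (LINT y|lborel. e' * mollifier (real j) (x - y))"
    proof (rule integral_mono)
      fix y
      show "\<bar>w y * mollifier (real j) (x - y) - w x * mollifier (real j) (x - y)\<bar> \<le> e' * mollifier (real j) (x - y)"
      proof (cases "y \<in> cball x \<rho>")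
        case True
        then have "norm (y - x) < d" using d(1) by (simp add: \<rho>_def dist_norm norm_minus_commute)
        then have "\<bar>w y - w x\<bar> * mollifier (real j) (x - y) \<le> e' * mollifier (real j) (x - y)"
          using d(2) by (intro mult_right_mono mollifier_nonneg) (auto intro: less_imp_le)
        then show ?thesis by (simp add: mollifier_nonneg abs_mult flip: left_diff_distrib)
      qed (simp add: out)
    qed (use i1 i2 in auto)
    also have "\<dots> = e' * N" using integral_mollifier[OF j(2), of x] by (simp add: N_def)
    finally show ?thesis using e'(2) by linarith
  qed
  then show "\<exists>J. \<forall>j\<ge>J. norm (convolve w (mollifier (real j)) x - mollifier_mass TYPE('a) * w x) < e"
    by (auto simp: N_def)
qed

text \<open>Tonelli's theorem. The bound is the same for all scales, which is what the limit in
  \<open>weyl\<close> requires.\<close>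

lemma mollify_L1_bound:
  fixes f :: "'a::euclidean_space \<Rightarrow> real"
  assumes f: "integrable lborel f" and \<sigma>: "1/4 < \<sigma>"
  shows "(\<integral>\<^sup>+x. ennreal \<bar>convolve f (mollifier \<sigma>) x\<bar> \<partial>lborel) \<le> ennreal (mollifier_mass TYPE('a)) * (\<integral>\<^sup>+y. ennreal \<bar>f y\<bar> \<partial>lborel)"
proof -
  have [measurable]: "f \<in> borel_measurable borel" using f by auto
  have "(\<integral>\<^sup>+x. ennreal \<bar>convolve f (mollifier \<sigma>) x\<bar> \<partial>lborel) \<le> (\<integral>\<^sup>+x. (\<integral>\<^sup>+y. ennreal (\<bar>f y\<bar> * mollifier \<sigma> (x - y)) \<partial>lborel) \<partial>lborel)"
  proof (rule nn_integral_mono)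
    fix x
    have "ennreal \<bar>convolve f (mollifier \<sigma>) x\<bar> \<le> (\<integral>\<^sup>+y. ennreal (norm (f y * mollifier \<sigma> (x - y))) \<partial>lborel)"
      using integral_norm_bound_ennreal[OF integrable_mult_mollifier[OF _ f], of \<sigma> x] \<sigma> by (simp add: convolve_def)
    then show "ennreal \<bar>convolve f (mollifier \<sigma>) x\<bar> \<le> (\<integral>\<^sup>+y. ennreal (\<bar>f y\<bar> * mollifier \<sigma> (x - y)) \<partial>lborel)"
      by (simp add: abs_mult mollifier_nonneg)
  qed
  also have "\<dots> = (\<integral>\<^sup>+y. (\<integral>\<^sup>+x. ennreal (\<bar>f y\<bar> * mollifier \<sigma> (x - y)) \<partial>lborel) \<partial>lborel)"
    by (rule lborel_pair.Fubini'[symmetric]) measurable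
  also have "\<dots> = (\<integral>\<^sup>+y. ennreal \<bar>f y\<bar> * ennreal (mollifier_mass TYPE('a)) \<partial>lborel)"
  proof (rule nn_integral_cong)
    fix y :: 'a
    have "(\<integral>\<^sup>+x. ennreal (\<bar>f y\<bar> * mollifier \<sigma> (x - y)) \<partial>lborel) = ennreal \<bar>f y\<bar> * (\<integral>\<^sup>+x. ennreal (mollifier \<sigma> (x - y)) \<partial>lborel)"
      by (simp add: ennreal_mult mollifier_nonneg nn_integral_cmult)
    also have "(\<integral>\<^sup>+x. ennreal (mollifier \<sigma> (x - y)) \<partial>lborel) = ennreal (LINT x|lborel. mollifier \<sigma> (y - x))"
      unfolding mollifier_minus[of \<sigma> _ y] using \<sigma>
      by (intro nn_integral_eq_integral integrable_mollifier AE_I2 mollifier_nonneg) auto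
    finally show "(\<integral>\<^sup>+x. ennreal (\<bar>f y\<bar> * mollifier \<sigma> (x - y)) \<partial>lborel) = ennreal \<bar>f y\<bar> * ennreal (mollifier_mass TYPE('a))"
      by (simp add: integral_mollifier[OF \<sigma>])
  qed
  also have "\<dots> = ennreal (mollifier_mass TYPE('a)) * (\<integral>\<^sup>+y. ennreal \<bar>f y\<bar> \<partial>lborel)"
    by (subst nn_integral_multc) (auto simp: mult.commute)
  finally show ?thesis .
qed

text \<open>At each point of \<Omega> the mollifications of \<open>v\<close> are eventually constant
  in the scale, and near a point one scale serves a whole neighbourhood, so \<open>V\<close> is
  locally a smooth convolution. Instead of Lebesgue points, the identification of \<open>V\<close>
  with \<open>v\<close> uses the approximation of \<open>v\<close> in L^1 by functions continuous in
  \<Omega>.\<close>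

theorem weyl:
  fixes v :: "'a::euclidean_space \<Rightarrow> real"
  assumes op: "open \<Omega>" and v: "integrable lborel v"
    and harm: "\<And>\<phi>. test_function \<Omega> \<phi> \<Longrightarrow> (LINT x|lborel. v x * laplacian \<phi> x) = 0"
    and w: "\<And>k::nat. integrable lborel (w k)" "\<And>k x. x \<in> \<Omega> \<Longrightarrow> isCont (w k) x"
    and lim: "(\<lambda>k. LINT x|lborel. \<bar>v x - w k x\<bar>) \<longlonglongrightarrow> 0"
  obtains V where "harmonic_on V \<Omega>" "AE x in lborel. x \<in> \<Omega> \<longrightarrow> V x = v x"
proof -
  define N where "N = mollifier_mass TYPE('a)"
  have N: "0 < N" by (simp add: N_def mollifier_mass_pos)
  have [measurable]: "v \<in> borel_measurable borel" "w k \<in> borel_measurable borel" for k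
    using v w(1)[of k] by auto
  have \<Omega>m [measurable]: "\<Omega> \<in> sets borel" using op by simp
  have sm: "smooth (convolve f (mollifier \<sigma>))" if pos: "0 < \<sigma>" and f: "integrable lborel f" for \<sigma> and f :: "'a \<Rightarrow> real"
  proof -
    obtain \<rho> where "\<And>z::'a. z \<notin> cball 0 \<rho> \<Longrightarrow> mollifier \<sigma> z = 0"
      using mollifier_compact_support[OF pos] by metis
    then show ?thesis by (intro convolve_smooth[OF f smooth_mollifier compact_cball])
  qed
  \<comment> \<open>Division by the mass corrects the normalisation; \<open>Suc j\<close> keeps the
    scale positive.\<close>
  define V where "V x = lim (\<lambda>j. convolve v (mollifier (real (Suc j))) x) / N" for x
  have loc: "convolve v (mollifier \<sigma>) x / N = V x" "(\<lambda>j. convolve v (mollifier (real (Suc j))) x) \<longlonglongrightarrow> N * V x"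
    if \<rho>: "0 < \<rho>" "cball x \<rho> \<subseteq> \<Omega>" "1 / \<rho>\<^sup>2 < \<sigma>" for x \<rho> \<sigma>
  proof -
    obtain J :: nat where J: "1 / \<rho>\<^sup>2 < J" using reals_Archimedean2 by blast
    have "\<forall>\<^sub>F j in sequentially. convolve v (mollifier (real (Suc j))) x = convolve v (mollifier \<sigma>) x"
      using eventually_ge_at_top[of J]
    proof eventually_elim
      case (elim j)
      then have "real J \<le> real (Suc j)" by simp
      then have "1 / \<rho>\<^sup>2 < real (Suc j)" using J by linarith
      then show ?case by (intro convolve_mollifier_const[OF v harm \<rho>(1,2) _ \<rho>(3)])
    qed
    then have *: "(\<lambda>j. convolve v (mollifier (real (Suc j))) x) \<longlonglongrightarrow> convolve v (mollifier \<sigma>) x"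
      by (rule tendsto_eventually)
    then show V: "convolve v (mollifier \<sigma>) x / N = V x" by (simp add: V_def limI)
    have "convolve v (mollifier \<sigma>) x = N * V x" using V N by (simp add: field_simps)
    with * show "(\<lambda>j. convolve v (mollifier (real (Suc j))) x) \<longlonglongrightarrow> N * V x" by simp
  qed
  have local: "\<exists>U g. open U \<and> x0 \<in> U \<and> smooth g \<and> (\<forall>x\<in>U. V x = g x) \<and> laplacian g x0 = 0" if x0: "x0 \<in> \<Omega>" for x0
  proof -
    obtain r where r: "0 < r" "cball x0 r \<subseteq> \<Omega>" using op x0 open_contains_cball by blast
    \<comment> \<open>Half the radius: the balls of radius \<rho> about all points of
      \<open>ball x0 \<rho>\<close> stay in the ball of radius r, so a single \<sigma> works
      there.\<close>
    define \<rho> where "\<rho> = r / 2"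
    define \<sigma> where "\<sigma> = 1 / \<rho>\<^sup>2 + 1"
    have \<rho>: "0 < \<rho>" "1 / \<rho>\<^sup>2 < \<sigma>" "0 < \<sigma>" using r by (auto simp: \<rho>_def \<sigma>_def add_pos_pos)
    have sub: "cball x \<rho> \<subseteq> \<Omega>" if "x \<in> ball x0 \<rho>" for x
    proof
      fix y assume "y \<in> cball x \<rho>"
      then have "dist x0 y \<le> r" using that dist_triangle[of x0 y x] by (simp add: \<rho>_def)
      then show "y \<in> \<Omega>" using r by auto
    qed
    have out: "mollifier \<sigma> z = 0" if "z \<notin> cball 0 \<rho>" for z :: 'a
      using that \<rho> by (intro mollifier_outside[of \<rho>]) auto
    define g where "g x = (1 / N) * convolve v (mollifier \<sigma>) x" for x
    have "laplacian (convolve v (mollifier \<sigma>)) x0 = 0"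
    proof -
      have "test_function \<Omega> (\<lambda>y. mollifier \<sigma> (x0 - y))"
        unfolding test_function_alt
      proof (intro conjI exI[of _ "cball x0 \<rho>"] allI impI)
        show "cball x0 \<rho> \<subseteq> \<Omega>" using sub[of x0] \<rho>(1) by simp
        show "mollifier \<sigma> (x0 - y) = 0" if "y \<notin> cball x0 \<rho>" for y
          using that by (intro out) (auto simp: dist_norm norm_minus_commute)
      qed (auto intro: smooth_reflect smooth_mollifier)
      from harm[OF this] show ?thesis
        using convolve_laplacian[OF v smooth_mollifier compact_cball out] by metis
    qed
    moreover have "laplacian g x0 = (1 / N) * laplacian (convolve v (mollifier \<sigma>)) x0"
      unfolding g_def[abs_def] by (rule laplacian_cmult[OF sm[OF \<rho>(3) v]])
    ultimately have "laplacian g x0 = 0" by simp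
    moreover have "smooth g" unfolding g_def[abs_def] by (intro smooth_cmult sm \<rho> v)
    moreover have "V x = g x" if "x \<in> ball x0 \<rho>" for x
      using loc(1)[OF \<rho>(1) sub[OF that] \<rho>(2)] by (simp add: g_def)
    ultimately show ?thesis using \<rho>(1) by (intro exI[of _ "ball x0 \<rho>"] exI[of _ g]) auto
  qed
  have "harmonic_on V \<Omega>"
    unfolding harmonic_on_def
  proof (intro conjI ballI)
    show "C_k_on 2 V \<Omega>" by (rule C_k_on_local) (use local in blast)
    fix x assume "x \<in> \<Omega>"
    then obtain U g where "open U" "x \<in> U" "\<forall>y\<in>U. V y = g y" "laplacian g x = 0" using local by blast
    then show "laplacian V x = 0" using laplacian_cong[of U V g x] by auto
  qed
  moreover have "AE x in lborel. x \<in> \<Omega> \<longrightarrow> V x = v x"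
  proof -
    have cb: "convolve f (mollifier (real (Suc j))) \<in> borel_measurable borel" if "integrable lborel f" for f :: "'a \<Rightarrow> real" and j
      by (rule borel_measurable_continuous_onI[OF smooth_continuous[OF sm[OF _ that]]]) simp
    have [measurable]: "V \<in> borel_measurable borel"
    proof -
      have [measurable]: "convolve v (mollifier (real (Suc j))) \<in> borel_measurable borel" for j by (rule cb[OF v])
      show ?thesis unfolding V_def[abs_def] by measurable
    qed
    \<comment> \<open>Mollifications of v - w k converge in \<Omega> to N (V - w k), by constancy in
      the scale and by continuity of \<open>w k\<close>. Fatou's lemma and the uniform L^1 bound,
      whose factor N cancels, give the estimate.\<close>
    have est: "(\<integral>\<^sup>+x. indicator \<Omega> x * ennreal \<bar>V x - w k x\<bar> \<partial>lborel) \<le> (\<integral>\<^sup>+x. ennreal \<bar>v x - w k x\<bar> \<partial>lborel)" for k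
    proof -
      define f where "f x = v x - w k x" for x
      have f: "integrable lborel f" unfolding f_def using v w(1) by simp
      have [measurable]: "convolve f (mollifier (real (Suc j))) \<in> borel_measurable borel" for j by (rule cb[OF f])
      have fd: "convolve f (mollifier \<sigma>) x = convolve v (mollifier \<sigma>) x - convolve (w k) (mollifier \<sigma>) x" if "0 < \<sigma>" for \<sigma> x
        using integrable_mult_mollifier[OF that v, of x] integrable_mult_mollifier[OF that w(1)[of k], of x]
        by (simp add: convolve_def f_def left_diff_distrib)
      have "(\<integral>\<^sup>+x. indicator \<Omega> x * ennreal \<bar>V x - w k x\<bar> \<partial>lborel)
         \<le> (\<integral>\<^sup>+x. liminf (\<lambda>j. ennreal (1 / N) * ennreal \<bar>convolve f (mollifier (real (Suc j))) x\<bar>) \<partial>lborel)"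
      proof (rule nn_integral_mono)
        fix x
        show "indicator \<Omega> x * ennreal \<bar>V x - w k x\<bar> \<le> liminf (\<lambda>j. ennreal (1 / N) * ennreal \<bar>convolve f (mollifier (real (Suc j))) x\<bar>)"
        proof (cases "x \<in> \<Omega>")
          case True
          obtain r where r: "0 < r" "cball x r \<subseteq> \<Omega>" using op True open_contains_cball by blast
          have "(\<lambda>j. convolve v (mollifier (real (Suc j))) x - convolve (w k) (mollifier (real (Suc j))) x) \<longlonglongrightarrow> N * V x - N * w k x"
            unfolding N_def
            by (intro tendsto_diff loc(2)[OF r, unfolded N_def, of "1 / r\<^sup>2 + 1"] LIMSEQ_Suc[OF mollify_tendsto[OF w(1) w(2)[OF True]]]) simp
          then have "(\<lambda>j. (1 / N) * \<bar>convolve f (mollifier (real (Suc j))) x\<bar>) \<longlonglongrightarrow> (1 / N) * \<bar>N * V x - N * w k x\<bar>"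
            by (intro tendsto_intros) (simp add: fd)
          moreover have "(1 / N) * \<bar>N * V x - N * w k x\<bar> = \<bar>V x - w k x\<bar>"
            using N by (simp add: abs_mult flip: right_diff_distrib)
          ultimately have "(\<lambda>j. (1 / N) * \<bar>convolve f (mollifier (real (Suc j))) x\<bar>) \<longlonglongrightarrow> \<bar>V x - w k x\<bar>" by simp
          then have "(\<lambda>j. ennreal ((1 / N) * \<bar>convolve f (mollifier (real (Suc j))) x\<bar>)) \<longlonglongrightarrow> ennreal \<bar>V x - w k x\<bar>"
            by (rule tendsto_ennrealI)
          then have L: "liminf (\<lambda>j. ennreal ((1 / N) * \<bar>convolve f (mollifier (real (Suc j))) x\<bar>)) = ennreal \<bar>V x - w k x\<bar>"
            by (intro lim_imp_Liminf) auto
          have e: "ennreal ((1 / N) * \<bar>a\<bar>) = ennreal (1 / N) * ennreal \<bar>a\<bar>" for a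
            using N by (intro ennreal_mult) auto
          have "indicator \<Omega> x * ennreal \<bar>V x - w k x\<bar> = ennreal \<bar>V x - w k x\<bar>" using True by simp
          then show ?thesis using L unfolding e by (metis order_refl)
        qed simp
      qed
      also have "\<dots> \<le> liminf (\<lambda>j. \<integral>\<^sup>+x. ennreal (1 / N) * ennreal \<bar>convolve f (mollifier (real (Suc j))) x\<bar> \<partial>lborel)"
        by (intro nn_integral_liminf) measurable
      also have "\<dots> \<le> (\<integral>\<^sup>+x. ennreal \<bar>f x\<bar> \<partial>lborel)"
      proof (rule Liminf_le)
        show "\<forall>\<^sub>F j in sequentially. (\<integral>\<^sup>+x. ennreal (1 / N) * ennreal \<bar>convolve f (mollifier (real (Suc j))) x\<bar> \<partial>lborel) \<le> (\<integral>\<^sup>+x. ennreal \<bar>f x\<bar> \<partial>lborel)"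
        proof (rule always_eventually, rule allI)
          fix j
          have "(\<integral>\<^sup>+x. ennreal (1 / N) * ennreal \<bar>convolve f (mollifier (real (Suc j))) x\<bar> \<partial>lborel)
            = ennreal (1 / N) * (\<integral>\<^sup>+x. ennreal \<bar>convolve f (mollifier (real (Suc j))) x\<bar> \<partial>lborel)"
            by (intro nn_integral_cmult) measurable
          also have "\<dots> \<le> ennreal (1 / N) * (ennreal N * (\<integral>\<^sup>+x. ennreal \<bar>f x\<bar> \<partial>lborel))"
            unfolding N_def by (intro mult_left_mono mollify_L1_bound f) auto
          also have "\<dots> = (\<integral>\<^sup>+x. ennreal \<bar>f x\<bar> \<partial>lborel)"
            using N by (simp add: mult.assoc[symmetric] flip: ennreal_mult)
          finally show "(\<integral>\<^sup>+x. ennreal (1 / N) * ennreal \<bar>convolve f (mollifier (real (Suc j))) x\<bar> \<partial>lborel) \<le> (\<integral>\<^sup>+x. ennreal \<bar>f x\<bar> \<partial>lborel)" .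
        qed
      qed simp
      finally show ?thesis by (simp add: f_def)
    qed
    have "(\<integral>\<^sup>+x. indicator \<Omega> x * ennreal \<bar>V x - v x\<bar> \<partial>lborel) \<le> 0"
    proof (rule LIMSEQ_le_const)
      show "(\<lambda>k. ennreal (2 * (LINT x|lborel. \<bar>v x - w k x\<bar>))) \<longlonglongrightarrow> 0"
        using tendsto_ennrealI[OF tendsto_mult_right_zero[OF lim, of 2]] by simp
      have "(\<integral>\<^sup>+x. indicator \<Omega> x * ennreal \<bar>V x - v x\<bar> \<partial>lborel) \<le> ennreal (2 * (LINT x|lborel. \<bar>v x - w k x\<bar>))" for k
      proof -
        have "(\<integral>\<^sup>+x. indicator \<Omega> x * ennreal \<bar>V x - v x\<bar> \<partial>lborel)
          \<le> (\<integral>\<^sup>+x. indicator \<Omega> x * ennreal \<bar>V x - w k x\<bar> + ennreal \<bar>v x - w k x\<bar> \<partial>lborel)"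
          by (intro nn_integral_mono) (auto simp: indicator_def ennreal_leI simp flip: ennreal_plus)
        also have "\<dots> = (\<integral>\<^sup>+x. indicator \<Omega> x * ennreal \<bar>V x - w k x\<bar> \<partial>lborel) + (\<integral>\<^sup>+x. ennreal \<bar>v x - w k x\<bar> \<partial>lborel)"
          by (rule nn_integral_add) measurable
        also have "\<dots> \<le> (\<integral>\<^sup>+x. ennreal \<bar>v x - w k x\<bar> \<partial>lborel) + (\<integral>\<^sup>+x. ennreal \<bar>v x - w k x\<bar> \<partial>lborel)"
          by (intro add_right_mono est)
        also have "\<dots> = ennreal (LINT x|lborel. \<bar>v x - w k x\<bar>) + ennreal (LINT x|lborel. \<bar>v x - w k x\<bar>)"
        proof -
          have "(\<integral>\<^sup>+x. ennreal \<bar>v x - w k x\<bar> \<partial>lborel) = ennreal (LINT x|lborel. \<bar>v x - w k x\<bar>)"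
            using v w(1) by (intro nn_integral_eq_integral) auto
          then show ?thesis by (simp only:)
        qed
        also have "\<dots> = ennreal (2 * (LINT x|lborel. \<bar>v x - w k x\<bar>))"
          by (subst ennreal_plus[symmetric]) auto
        finally show ?thesis .
      qed
      then show "\<exists>K. \<forall>k\<ge>K. (\<integral>\<^sup>+x. indicator \<Omega> x * ennreal \<bar>V x - v x\<bar> \<partial>lborel) \<le> ennreal (2 * (LINT x|lborel. \<bar>v x - w k x\<bar>))"
        by blast
    qed
    then have "AE x in lborel. indicator \<Omega> x * ennreal \<bar>V x - v x\<bar> = 0"
      by (subst (asm) le_zero_eq, subst (asm) nn_integral_0_iff_AE) auto
    then show ?thesis by eventually_elim (auto simp: indicator_def split: if_splits)
  qed
  ultimately show ?thesis by (rule that)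
qed

subsection \<open>The classical Dirichlet problem\<close>

lemma C_k_on_const: "C_k_on k (\<lambda>x. c) S"
  using smooth_const[of c] unfolding smooth_def by (blast intro: C_k_on_subset)

lemma C_k_on_2D:
  assumes "C_k_on 2 f S" "x \<in> S"
  shows "f differentiable (at x)" "b \<in> Basis \<Longrightarrow> partial b f differentiable (at x)"
  using assms by (auto simp: numeral_2_eq_2 C_k_on_Suc)

lemma harmonic_on_add_cmult:
  fixes f g :: "'a::euclidean_space \<Rightarrow> real"
  assumes S: "open S" and f: "harmonic_on f S" and g: "harmonic_on g S"
  shows "harmonic_on (\<lambda>x. f x + c * g x) S"
  unfolding harmonic_on_def
proof (intro conjI ballI)
  have f2: "C_k_on 2 f S" and g2: "C_k_on 2 g S" using f g by (auto simp: harmonic_on_def)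
  show "C_k_on 2 (\<lambda>x. f x + c * g x) S"
    by (intro C_k_on_add C_k_on_mult C_k_on_const f2 g2 S)
  fix x assume x: "x \<in> S"
  have p: "partial b (\<lambda>x. f x + c * g x) y = partial b f y + c * partial b g y" if "y \<in> S" for y b
    using C_k_on_2D(1)[OF f2 that] C_k_on_2D(1)[OF g2 that] by (simp add: partial_add partial_mult)
  have "partial b (partial b (\<lambda>x. f x + c * g x)) x = partial b (partial b f) x + c * partial b (partial b g) x"
    if "b \<in> Basis" for b
  proof -
    have "partial b (partial b (\<lambda>x. f x + c * g x)) x = partial b (\<lambda>y. partial b f y + c * partial b g y) x"
      by (rule partial_cong[OF S p x])
    also have "\<dots> = partial b (partial b f) x + c * partial b (partial b g) x"
      using C_k_on_2D(2)[OF f2 x that] C_k_on_2D(2)[OF g2 x that] by (simp add: partial_add partial_mult)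
    finally show ?thesis .
  qed
  then have "laplacian (\<lambda>x. f x + c * g x) x = laplacian f x + c * laplacian g x"
    by (simp add: laplacian_def sum.distrib sum_distrib_left)
  then show "laplacian (\<lambda>x. f x + c * g x) x = 0" using f g x by (simp add: harmonic_on_def)
qed

lemma partial_has_real_derivative:
  fixes f :: "'a::euclidean_space \<Rightarrow> real"
  assumes "f differentiable (at (p + t *\<^sub>R b))"
  shows "((\<lambda>t. f (p + t *\<^sub>R b)) has_real_derivative partial b f (p + t *\<^sub>R b)) (at t)"
proof -
  have D: "(f has_derivative frechet_derivative f (at (p + t *\<^sub>R b))) (at (p + t *\<^sub>R b))"
    using assms frechet_derivative_works by blast
  have "((\<lambda>t. f (p + t *\<^sub>R b)) has_derivative (\<lambda>h. frechet_derivative f (at (p + t *\<^sub>R b)) (h *\<^sub>R b))) (at t)"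
    by (rule has_derivative_compose[where g=f and f="\<lambda>t. p + t *\<^sub>R b", OF _ D]) (auto intro!: derivative_eq_intros)
  moreover have "frechet_derivative f (at (p + t *\<^sub>R b)) (h *\<^sub>R b) = partial b f (p + t *\<^sub>R b) * h" for h
    using linear_scale[OF has_derivative_linear[OF D], of h b] by (simp add: partial_def mult.commute)
  ultimately show ?thesis by (simp add: has_field_derivative_def)
qed

text \<open>Along the line through p the first derivative vanishes at the maximum. Were the second
  one positive, the first would be positive just to the right, and the mean value theorem would give
  a larger value.\<close>

lemma second_partial_nonpos_at_max:
  fixes f :: "'a::euclidean_space \<Rightarrow> real"
  assumes S: "open S" "p \<in> S" and d: "\<And>x. x \<in> S \<Longrightarrow> f differentiable (at x)" and d2: "partial b f differentiable (at p)"
    and b: "b \<in> Basis" and max: "\<And>x. x \<in> S \<Longrightarrow> f x \<le> f p"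
  shows "partial b (partial b f) p \<le> 0"
proof (rule ccontr)
  assume pos: "\<not> partial b (partial b f) p \<le> 0"
  obtain r where r: "0 < r" "ball p r \<subseteq> S" using S openE by blast
  define g g' where "g t = f (p + t *\<^sub>R b)" and "g' t = partial b f (p + t *\<^sub>R b)" for t
  have inS: "p + t *\<^sub>R b \<in> S" if "\<bar>t\<bar> < r" for t using that b r by (auto simp: dist_norm subset_iff)
  have D: "(g has_real_derivative g' t) (at t)" if "\<bar>t\<bar> < r" for t
    unfolding g_def g'_def by (rule partial_has_real_derivative[OF d[OF inS[OF that]]])
  have D2: "(g' has_real_derivative partial b (partial b f) p) (at 0)"
    using partial_has_real_derivative[of "partial b f" p 0 b] d2 by (simp add: g'_def[abs_def])
  have le: "g t \<le> g 0" if "\<bar>t\<bar> < r" for t using max[OF inS[OF that]] by (simp add: g_def)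
  have g0: "g' 0 = 0"
    by (rule DERIV_local_max[OF D[of 0] r(1)]) (use le r in auto)
  obtain e where e: "0 < e" "\<And>s. 0 < s \<Longrightarrow> s < e \<Longrightarrow> g' 0 < g' (0 + s)"
    using DERIV_pos_inc_right[OF D2] pos by auto
  define s where "s = min e r / 2"
  have s: "0 < s" "s < e" "s < r" using e r by (auto simp: s_def)
  obtain z where z: "0 < z" "z < s" "g s - g 0 = (s - 0) * g' z"
    using MVT2[of 0 s g g'] D s by auto
  have "0 < g' z" using e(2)[of z] z s g0 by simp
  then have "0 < (s - 0) * g' z" using s by simp
  then have "g 0 < g s" using z(3) by linarith
  then show False using le[of s] s by simp
qed

text \<open>Adding e |y|^2 raises the Laplacian to 2 n e > 0, which excludes a maximum inside
  \<Omega>. So the maximum is attained on the frontier, and e tends to 0.\<close>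

lemma harmonic_maximum:
  fixes w :: "'a::euclidean_space \<Rightarrow> real"
  assumes \<Omega>: "open \<Omega>" "bounded \<Omega>" and w: "continuous_on (closure \<Omega>) w" "harmonic_on w \<Omega>"
    and M: "\<And>x. x \<in> frontier \<Omega> \<Longrightarrow> w x \<le> M" and x: "x \<in> closure \<Omega>"
  shows "w x \<le> M"
proof -
  have comp: "compact (closure \<Omega>)" using \<Omega> by simp
  have "bounded ((\<lambda>y::'a. y \<bullet> y) ` closure \<Omega>)"
    by (intro compact_imp_bounded compact_continuous_image comp continuous_intros)
  then obtain B where B: "\<And>y. y \<in> closure \<Omega> \<Longrightarrow> y \<bullet> y \<le> B" unfolding bounded_iff by fastforce
  have B0: "0 \<le> B" using B[OF x] inner_ge_zero[of x] by linarith
  have w2: "C_k_on 2 w \<Omega>" using w by (simp add: harmonic_on_def)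
  have key: "w x \<le> M + e * B" if e: "0 < e" for e
  proof -
    define h where "h y = w y + e * (y \<bullet> y)" for y
    have hc: "continuous_on (closure \<Omega>) h" unfolding h_def by (intro continuous_intros w)
    have "closure \<Omega> \<noteq> {}" using x by auto
    from continuous_attains_sup[OF comp this hc]
    obtain p where p: "p \<in> closure \<Omega>" "\<And>y. y \<in> closure \<Omega> \<Longrightarrow> h y \<le> h p" by blast
    have "p \<notin> \<Omega>"
    proof
      assume p\<Omega>: "p \<in> \<Omega>"
      have sq: "smooth (\<lambda>y::'a. e * (y \<bullet> y))" by (intro smooth_cmult smooth_inner_self)
      have ph: "partial b h y = partial b w y + (2 * e) * (y \<bullet> b)" if "y \<in> \<Omega>" for y b
        unfolding h_def using C_k_on_2D(1)[OF w2 that] smooth_differentiable[OF sq]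
        by (simp add: partial_add partial_cmult smooth_inner_self partial_inner_self)
      have hd: "h differentiable (at y)" if "y \<in> \<Omega>" for y
        unfolding h_def using C_k_on_2D(1)[OF w2 that] smooth_differentiable[OF sq] by simp
      have dp: "(\<lambda>y. partial b w y + (2 * e) * (y \<bullet> b)) differentiable (at p)" if "b \<in> Basis" for b
        using C_k_on_2D(2)[OF w2 p\<Omega> that] smooth_differentiable[OF smooth_cmult[OF smooth_inner]] by simp
      have ph2: "partial b h differentiable (at p)" if "b \<in> Basis" for b
        by (rule differentiable_cong_open[where g="\<lambda>y. partial b w y + (2 * e) * (y \<bullet> b)", OF \<Omega>(1) _ p\<Omega> dp[OF that]]) (rule ph)
      have "partial b (partial b h) p \<le> 0" if "b \<in> Basis" for b
        by (rule second_partial_nonpos_at_max[OF \<Omega>(1) p\<Omega> hd ph2[OF that] that])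
           (use p(2) closure_subset in auto)
      moreover have "partial b (partial b h) p = partial b (partial b w) p + 2 * e" if b: "b \<in> Basis" for b
      proof -
        have "partial b (partial b h) p = partial b (\<lambda>y. partial b w y + (2 * e) * (y \<bullet> b)) p"
          by (rule partial_cong[OF \<Omega>(1) _ p\<Omega>]) (rule ph)
        also have "\<dots> = partial b (partial b w) p + 2 * e"
          using C_k_on_2D(2)[OF w2 p\<Omega> b] smooth_differentiable[OF smooth_cmult[OF smooth_inner]] b
          by (simp add: partial_add partial_cmult smooth_inner)
        finally show ?thesis .
      qed
      ultimately have "(\<Sum>b\<in>Basis. partial b (partial b w) p + 2 * e) \<le> 0" by (intro sum_nonpos) metis
      then have "laplacian w p + 2 * e * DIM('a) \<le> 0" by (simp add: laplacian_def sum.distrib mult.commute)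
      moreover have "laplacian w p = 0" using w(2) p\<Omega> by (simp add: harmonic_on_def)
      moreover have "0 < 2 * e * DIM('a)" using e by simp
      ultimately show False by linarith
    qed
    then have "p \<in> frontier \<Omega>" using p \<Omega> by (simp add: frontier_def interior_open)
    have "w x \<le> h x" using e by (simp add: h_def)
    also have "\<dots> \<le> h p" by (rule p(2)[OF x])
    also have "\<dots> \<le> M + e * B"
      unfolding h_def using M[OF \<open>p \<in> frontier \<Omega>\<close>] B[OF p(1)] e by (intro add_mono mult_left_mono) auto
    finally show ?thesis .
  qed
  show ?thesis
  proof (rule field_le_epsilon)
    fix e :: real assume "0 < e"
    \<comment> \<open>B + 1 avoids a division by zero if the closure lies at the origin or the bound
      \<open>B\<close> is 0.\<close>
    then have "w x \<le> M + e / (B + 1) * B" using B0 by (intro key) auto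
    also have "\<dots> \<le> M + e" using B0 \<open>0 < e\<close> by (simp add: field_simps)
    finally show "w x \<le> M + e" .
  qed
qed

lemma harmonic_diff_bound:
  fixes v w :: "'a::euclidean_space \<Rightarrow> real"
  assumes \<Omega>: "open \<Omega>" "bounded \<Omega>" and v: "continuous_on (closure \<Omega>) v" "harmonic_on v \<Omega>"
    and w: "continuous_on (closure \<Omega>) w" "harmonic_on w \<Omega>"
    and M: "\<And>x. x \<in> frontier \<Omega> \<Longrightarrow> \<bar>v x - w x\<bar> \<le> M" and x: "x \<in> closure \<Omega>"
  shows "\<bar>v x - w x\<bar> \<le> M"
proof -
  have "v x + (-1) * w x \<le> M"
  proof (rule harmonic_maximum[OF \<Omega> _ harmonic_on_add_cmult[OF \<Omega>(1) v(2) w(2)] _ x])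
    show "v y + (-1) * w y \<le> M" if "y \<in> frontier \<Omega>" for y using M[OF that] by simp
  qed (intro continuous_intros v w)
  moreover have "w x + (-1) * v x \<le> M"
  proof (rule harmonic_maximum[OF \<Omega> _ harmonic_on_add_cmult[OF \<Omega>(1) w(2) v(2)] _ x])
    show "w y + (-1) * v y \<le> M" if "y \<in> frontier \<Omega>" for y using M[OF that] by simp
  qed (intro continuous_intros v w)
  ultimately show ?thesis by auto
qed

lemma harmonic_on_cong:
  fixes f g :: "'a::euclidean_space \<Rightarrow> real"
  assumes "open S" "\<And>x. x \<in> S \<Longrightarrow> f x = g x" "harmonic_on g S"
  shows "harmonic_on f S"
  using assms(3) C_k_on_cong[OF assms(1,2)] laplacian_cong[OF assms(1,2)] by (simp add: harmonic_on_def)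

context bounded_open
begin

lemma AE_mu_iff: "(AE x in \<mu>. P x) \<longleftrightarrow> (AE x in lebesgue. x \<in> \<Omega> \<longrightarrow> P x)"
  using lmeasurable_domain by (subst AE_restrict_space_iff) (auto simp: fmeasurable_def)

text \<open>The set where a continuous function is negative is open, and a nonempty open set is not
  negligible. This turns estimates almost everywhere into pointwise ones.\<close>

lemma AE_mu_nonneg_imp:
  fixes f :: "'a \<Rightarrow> real"
  assumes f: "continuous_on \<Omega> f" and ae: "AE x in \<mu>. 0 \<le> f x" and x: "x \<in> \<Omega>"
  shows "0 \<le> f x"
proof (rule ccontr)
  assume neg: "\<not> 0 \<le> f x"
  define U where "U = \<Omega> \<inter> f -` {..<0}"
  have "open U" unfolding U_def using continuous_open_preimage[OF f open_domain, of "{..<0}"] by simp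
  moreover have "x \<in> U" using x neg by (simp add: U_def)
  ultimately have "\<not> negligible U" using open_not_negligible by blast
  have "\<exists>N\<in>null_sets lebesgue. {x \<in> space lebesgue. \<not> (x \<in> \<Omega> \<longrightarrow> 0 \<le> f x)} \<subseteq> N"
    using ae[unfolded AE_mu_iff] unfolding eventually_ae_filter .
  then obtain N where N: "N \<in> null_sets lebesgue" "{x \<in> space lebesgue. \<not> (x \<in> \<Omega> \<longrightarrow> 0 \<le> f x)} \<subseteq> N"
    by (elim bexE)
  then have "U \<subseteq> N" by (auto simp: U_def)
  then have "negligible U" using N(1) negligible_subset[of N U] by (simp add: negligible_iff_null_sets)
  then show False using \<open>\<not> negligible U\<close> by blast
qed

lemma integrable_lborel_iff:
  fixes f :: "'a \<Rightarrow> real"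
  assumes "f \<in> borel_measurable borel" "\<And>x. x \<notin> \<Omega> \<Longrightarrow> f x = 0"
  shows "integrable lborel f \<longleftrightarrow> integrable \<mu> f"
proof -
  have "integrable \<mu> f \<longleftrightarrow> integrable lebesgue (\<lambda>x. indicator \<Omega> x *\<^sub>R f x)"
    using lmeasurable_domain by (intro integrable_restrict_space) (auto simp: fmeasurable_def)
  also have "(\<lambda>x. indicator \<Omega> x *\<^sub>R f x) = f" using assms(2) by (auto simp: indicator_def fun_eq_iff)
  also have "integrable lebesgue f \<longleftrightarrow> integrable lborel f"
    using assms(1) by (intro integrable_completion) simp
  finally show ?thesis by simp
qed

lemma continuous_on_mu_measurable: "continuous_on \<Omega> f \<Longrightarrow> f \<in> borel_measurable \<mu>" for f :: "'a \<Rightarrow> real"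
  using lmeasurable_domain by (intro continuous_imp_measurable_on_sets_lebesgue) (auto simp: fmeasurable_def)

text \<open>A function integrable over \<Omega> is only Lebesgue measurable and arbitrary elsewhere,
  while \<open>weyl\<close> wants a Borel function on the whole space. So \<open>v\<close> is
  replaced by a Borel version that vanishes off \<Omega>.\<close>

lemma weyl_mu:
  fixes v :: "'a \<Rightarrow> real"
  assumes v: "integrable \<mu> v" and harm: "\<And>\<phi>. test_function \<Omega> \<phi> \<Longrightarrow> (LINT x|\<mu>. v x * laplacian \<phi> x) = 0"
    and w: "\<And>k::nat. continuous_on \<Omega> (w k)" "\<And>k. integrable \<mu> (w k)" and lim: "(\<lambda>k. LINT x|\<mu>. \<bar>v x - w k x\<bar>) \<longlonglongrightarrow> 0"
  obtains V where "harmonic_on V \<Omega>" "AE x in \<mu>. V x = v x"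
proof -
  have \<Omega>s: "\<Omega> \<in> sets lebesgue" using lmeasurable_domain by (simp add: fmeasurable_def)
  have "(\<lambda>x. indicator \<Omega> x *\<^sub>R v x) \<in> borel_measurable lebesgue"
    using v \<Omega>s by (subst borel_measurable_restrict_space_iff[symmetric]) auto
  then obtain v' where v': "v' \<in> borel_measurable lborel" "AE x in lborel. indicator \<Omega> x *\<^sub>R v x = v' x"
    using completion_ex_borel_measurable_real by blast
  define v1 where "v1 x = indicator \<Omega> x * v' x" for x
  have \<Omega>b [measurable]: "\<Omega> \<in> sets borel" using open_domain by simp
  have [measurable]: "v' \<in> borel_measurable borel" using v' by simp
  have v1m [measurable]: "v1 \<in> borel_measurable borel" unfolding v1_def by measurable
  have v10: "v1 x = 0" if "x \<notin> \<Omega>" for x using that by (simp add: v1_def)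
  have ae: "AE x in \<mu>. v1 x = v x"
    unfolding AE_mu_iff using AE_completion[OF v'(2)] by eventually_elim (auto simp: v1_def)
  have v1\<mu>: "v1 \<in> borel_measurable \<mu>"
    using v1m by (intro measurable_restrict_space1) (simp add: measurable_completion)
  define w1 where "w1 k x = indicator \<Omega> x * w k x" for k x
  have w1m [measurable]: "w1 k \<in> borel_measurable borel" for k
    unfolding w1_def[abs_def]
    using borel_measurable_continuous_on_indicator[OF \<Omega>b w(1)[of k]] by (simp add: scaleR_conv_of_real)
  have w10: "w1 k x = 0" if "x \<notin> \<Omega>" for k x using that by (simp add: w1_def)
  have w1\<mu>: "w1 k x = w k x" if "x \<in> \<Omega>" for k x using that by (simp add: w1_def)
  obtain V where V: "harmonic_on V \<Omega>" "AE x in lborel. x \<in> \<Omega> \<longrightarrow> V x = v1 x"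
  proof (rule weyl[OF open_domain, of v1 w1])
    have "integrable \<mu> v1"
      using v ae v1\<mu> by (subst integrable_cong_AE[of _ _ v]) auto
    then show "integrable lborel v1" using integrable_lborel_iff[OF v1m v10] by simp
    show "integrable lborel (w1 k)" for k
    proof -
      have "integrable \<mu> (w1 k) \<longleftrightarrow> integrable \<mu> (w k)"
        by (rule Bochner_Integration.integrable_cong) (auto simp: w1\<mu>)
      then show ?thesis using w(2) integrable_lborel_iff[OF w1m w10, of k] by blast
    qed
    show "isCont (w1 k) x" if "x \<in> \<Omega>" for k x
    proof -
      have "continuous_on \<Omega> (w1 k)" using w(1)[of k] w1\<mu> by (simp cong: continuous_on_cong)
      then show ?thesis using continuous_on_eq_continuous_at[OF open_domain] that by blast
    qed
    show "(LINT x|lborel. v1 x * laplacian \<phi> x) = 0" if \<phi>: "test_function \<Omega> \<phi>" for \<phi>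
    proof -
      have lm: "laplacian \<phi> \<in> borel_measurable borel"
        by (rule borel_measurable_continuous_onI[OF smooth_continuous[OF smooth_laplacian[OF test_function_smooth[OF \<phi>]]]])
      then have "(LINT x|lborel. v1 x * laplacian \<phi> x) = (LINT x|\<mu>. v1 x * laplacian \<phi> x)"
        using v10 by (intro integral_mu_eq_lborel[symmetric]) auto
      also have "\<dots> = (LINT x|\<mu>. v x * laplacian \<phi> x)"
        using ae v v1\<mu> continuous_borel_measurable[OF smooth_continuous[OF smooth_laplacian[OF test_function_smooth[OF \<phi>]]]]
        by (intro integral_cong_AE) (auto elim: eventually_mono)
      finally show ?thesis using harm[OF \<phi>] by simp
    qed
    have "(LINT x|lborel. \<bar>v1 x - w1 k x\<bar>) = (LINT x|\<mu>. \<bar>v x - w k x\<bar>)" for k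
    proof -
      have "(LINT x|lborel. \<bar>v1 x - w1 k x\<bar>) = (LINT x|\<mu>. \<bar>v1 x - w1 k x\<bar>)"
        using v10 w10 by (intro integral_mu_eq_lborel[symmetric]) auto
      also have "\<dots> = (LINT x|\<mu>. \<bar>v1 x - w k x\<bar>)"
        by (intro Bochner_Integration.integral_cong) (auto simp: w1\<mu>)
      also have "\<dots> = (LINT x|\<mu>. \<bar>v x - w k x\<bar>)"
        using ae v v1\<mu> continuous_on_mu_measurable[OF w(1)]
        by (intro integral_cong_AE) (auto elim: eventually_mono)
      finally show ?thesis .
    qed
    then show "(\<lambda>k. LINT x|lborel. \<bar>v1 x - w1 k x\<bar>) \<longlonglongrightarrow> 0" using lim by simp
  qed auto
  have "AE x in \<mu>. V x = v1 x" unfolding AE_mu_iff using AE_completion[OF V(2)] .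
  with ae have "AE x in \<mu>. V x = v x" by eventually_elim simp
  with V(1) show ?thesis by (rule that)
qed

text \<open>The weak equation is part of the conclusion because it survives uniform limits, whereas
  second derivatives do not obviously converge.\<close>

lemma dirichlet_smooth_data:
  fixes f W :: "'a \<Rightarrow> real"
  assumes W: "smooth W" "\<And>x. x \<in> \<Omega> \<Longrightarrow> laplacian W x \<le> -1" "\<And>x. x \<in> \<Omega> \<Longrightarrow> 0 \<le> W x" "\<And>x. x \<in> frontier \<Omega> \<Longrightarrow> W x = 0"
    and f: "smooth f"
  obtains v where "solves_dirichlet \<Omega> f v" "\<And>\<phi>. test_function \<Omega> \<phi> \<Longrightarrow> (LINT x|\<mu>. v x * laplacian \<phi> x) = 0"
proof -
  have cF: "continuous_on UNIV (laplacian f)" by (rule smooth_continuous[OF smooth_laplacian[OF f]])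
  obtain z g \<phi> where P: "poisson (laplacian f) z g \<phi>" using poisson_exists[OF cF] by blast
  note p = poissonD[OF P]
  \<comment> \<open>\<open>M\<close> bounds the right-hand side, so \<open>M * W\<close> is a
    supersolution for both z and -z.\<close>
  obtain M where M: "0 \<le> M" "\<And>x. x \<in> \<Omega> \<Longrightarrow> norm (laplacian f x) \<le> M" using continuous_bounded_on[OF cF] by blast
  have MW: "smooth (\<lambda>x. M * W x)" by (intro smooth_cmult W)
  have lMW: "laplacian (\<lambda>x. M * W x) x \<le> - M" if "x \<in> \<Omega>" for x
    using mult_left_mono[OF W(2)[OF that] M(1)] by (simp add: laplacian_cmult[OF W(1)])
  have "AE x in \<mu>. z x \<le> M * W x"
  proof (rule comparison[OF P cF MW, of "{}"])
    show "laplacian (\<lambda>x. M * W x) x + laplacian f x \<le> 0" if "x \<in> \<Omega>" for x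
      using lMW[OF that] M(2)[OF that] by simp
  qed (use W M in auto)
  moreover have "AE x in \<mu>. - z x \<le> M * W x"
  proof (rule comparison[OF poisson_uminus[OF P cF] _ MW, of "{}"])
    show "laplacian (\<lambda>x. M * W x) x + - laplacian f x \<le> 0" if "x \<in> \<Omega>" for x
      using lMW[OF that] M(2)[OF that] by simp
  qed (use W M cF in \<open>auto intro: continuous_intros\<close>)
  ultimately have zb: "AE x in \<mu>. \<bar>z x\<bar> \<le> M * W x" by eventually_elim simp
  have iz: "integrable \<mu> z" by (rule sqi_integrable(1)[OF p(1)])
  have harm: "(LINT x|\<mu>. (f x + z x) * laplacian \<psi> x) = 0" if \<psi>: "test_function \<Omega> \<psi>" for \<psi>
  proof -
    have s: "smooth (laplacian \<psi>)" by (rule smooth_laplacian[OF test_function_smooth[OF \<psi>]])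
    have "integrable \<mu> (\<lambda>x. z x * laplacian \<psi> x)"
      using sqi_integrable_inner[OF p(1) smooth_sqi[OF s]] by simp
    then have "(LINT x|\<mu>. (f x + z x) * laplacian \<psi> x) = (LINT x|\<mu>. f x * laplacian \<psi> x) + (LINT x|\<mu>. z x * laplacian \<psi> x)"
      using smooth_integrable[OF smooth_mult[OF f s]] by (simp add: distrib_right)
    also have "(LINT x|\<mu>. f x * laplacian \<psi> x) = (LINT x|\<mu>. laplacian f x * \<psi> x)"
      using integral_gradient_laplacian[OF \<psi> f] by simp
    finally show ?thesis using poisson_laplacian[OF P \<psi>] by simp
  qed
  obtain V where V: "harmonic_on V \<Omega>" "AE x in \<mu>. V x = f x + z x"
  proof (rule weyl_mu[of "\<lambda>x. f x + z x" "\<lambda>k x. f x + \<phi> k x"])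
    show "integrable \<mu> (\<lambda>x. f x + z x)" using iz smooth_integrable[OF f] by simp
    show "continuous_on \<Omega> (\<lambda>x. f x + \<phi> k x)" for k
      by (intro smooth_continuous smooth_add f p)
    show "integrable \<mu> (\<lambda>x. f x + \<phi> k x)" for k
      by (intro smooth_integrable smooth_add f p)
    show "(\<lambda>k. LINT x|\<mu>. \<bar>f x + z x - (f x + \<phi> k x)\<bar>) \<longlonglongrightarrow> 0"
    proof (rule Lim_null_comparison[OF always_eventually])
      show "(\<lambda>k. l2 \<mu> (\<lambda>x. \<phi> k x - z x) * sqrt (measure \<mu> (space \<mu>))) \<longlonglongrightarrow> 0"
        using tendsto_mult_right[OF p(5), of "sqrt (measure \<mu> (space \<mu>))"] by simp
      show "\<forall>k. norm (LINT x|\<mu>. \<bar>f x + z x - (f x + \<phi> k x)\<bar>) \<le> l2 \<mu> (\<lambda>x. \<phi> k x - z x) * sqrt (measure \<mu> (space \<mu>))"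
        using sqi_integrable(2)[OF sqi_diff[OF smooth_sqi[OF p(4)] p(1)]] by (auto simp: abs_minus_commute)
    qed
  qed (use harm in auto)
  have cV: "continuous_on \<Omega> V"
    using V(1) by (auto simp: harmonic_on_def numeral_2_eq_2 C_k_on_Suc)
  have Vb: "\<bar>V x - f x\<bar> \<le> M * W x" if "x \<in> \<Omega>" for x
  proof -
    have "0 \<le> M * W x - \<bar>V x - f x\<bar>"
    proof (rule AE_mu_nonneg_imp[OF _ _ that])
      show "continuous_on \<Omega> (\<lambda>x. M * W x - \<bar>V x - f x\<bar>)"
        by (intro continuous_intros cV smooth_continuous f W)
      show "AE x in \<mu>. 0 \<le> M * W x - \<bar>V x - f x\<bar>" using zb V(2) by eventually_elim simp
    qed
    then show ?thesis by simp
  qed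
  \<comment> \<open>Nothing is known about \<open>V\<close> outside \<Omega>, so there it is
    replaced by the data; the bound by \<open>M * W\<close> makes the two parts fit
    continuously.\<close>
  define v where "v x = (if x \<in> \<Omega> then V x else f x)" for x
  have vb: "\<bar>v x - f x\<bar> \<le> M * W x" if "x \<in> closure \<Omega>" for x
    using Vb[of x] W(4)[of x] that open_domain by (auto simp: v_def frontier_def interior_open)
  have "continuous_on (closure \<Omega>) v"
    unfolding continuous_on_eq_continuous_within
  proof
    fix x assume x: "x \<in> closure \<Omega>"
    show "continuous (at x within closure \<Omega>) v"
    proof (cases "x \<in> \<Omega>")
      case True
      have "continuous_on \<Omega> v" using cV by (simp add: v_def cong: continuous_on_cong)
      then show ?thesis
        using True continuous_on_eq_continuous_at[OF open_domain] continuous_at_imp_continuous_at_within by blast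
    next
      case False
      then have fr: "x \<in> frontier \<Omega>" using x open_domain by (simp add: frontier_def interior_open)
      have "((\<lambda>y. v y - f y) \<longlongrightarrow> 0) (at x within closure \<Omega>)"
      proof (rule Lim_null_comparison)
        show "\<forall>\<^sub>F y in at x within closure \<Omega>. norm (v y - f y) \<le> M * W y"
          using vb by (auto simp: eventually_at_filter)
        have "continuous_on UNIV (\<lambda>y. M * W y)" by (rule smooth_continuous[OF MW])
        then have "isCont (\<lambda>y. M * W y) x" by (simp add: continuous_on_eq_continuous_at)
        then have "((\<lambda>y. M * W y) \<longlongrightarrow> M * W x) (at x within closure \<Omega>)"
          using continuous_at_imp_continuous_at_within continuous_within by blast
        then show "((\<lambda>y. M * W y) \<longlongrightarrow> 0) (at x within closure \<Omega>)" using W(4)[OF fr] by simp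
      qed
      moreover have "(f \<longlongrightarrow> f x) (at x within closure \<Omega>)"
        using smooth_continuous[OF f, of UNIV]
        by (simp add: continuous_on_eq_continuous_at continuous_at_imp_continuous_at_within flip: continuous_within)
      ultimately have "((\<lambda>y. (v y - f y) + f y) \<longlongrightarrow> 0 + f x) (at x within closure \<Omega>)" by (rule tendsto_add)
      then show ?thesis using False by (simp add: continuous_within v_def[abs_def])
    qed
  qed
  moreover have "harmonic_on v \<Omega>" by (rule harmonic_on_cong[OF open_domain _ V(1)]) (simp add: v_def)
  moreover have "v x = f x" if "x \<in> frontier \<Omega>" for x
    using that open_domain by (simp add: v_def frontier_def interior_open)
  ultimately have "solves_dirichlet \<Omega> f v" by (simp add: solves_dirichlet_def)
  moreover have "(LINT x|\<mu>. v x * laplacian \<psi> x) = 0" if \<psi>: "test_function \<Omega> \<psi>" for \<psi>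
  proof -
    have [measurable]: "laplacian \<psi> \<in> borel_measurable \<mu>"
      by (rule continuous_borel_measurable[OF smooth_continuous[OF smooth_laplacian[OF test_function_smooth[OF \<psi>]]]])
    have [measurable]: "v \<in> borel_measurable \<mu>"
      using cV by (intro continuous_on_mu_measurable) (simp add: v_def cong: continuous_on_cong)
    have [measurable]: "z \<in> borel_measurable \<mu>" "f \<in> borel_measurable \<mu>"
      using iz smooth_integrable[OF f] by auto
    have "AE x in \<mu>. x \<in> \<Omega>" by (rule AE_I2) simp
    with V(2) have "AE x in \<mu>. v x * laplacian \<psi> x = (f x + z x) * laplacian \<psi> x"
      by eventually_elim (simp add: v_def)
    then have "(LINT x|\<mu>. v x * laplacian \<psi> x) = (LINT x|\<mu>. (f x + z x) * laplacian \<psi> x)"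
      by (intro integral_cong_AE) auto
    then show ?thesis using harm[OF \<psi>] by simp
  qed
  ultimately show ?thesis by (rule that)
qed

end

lemma real_polynomial_function_smooth:
  fixes f :: "'a::euclidean_space \<Rightarrow> real"
  assumes "real_polynomial_function f"
  shows "smooth f"
  using assms
proof (induction f rule: real_polynomial_function.induct)
  case (linear f)
  have "f x = (\<Sum>b\<in>Basis. (x \<bullet> b) * f b)" for x
  proof -
    interpret bounded_linear f by fact
    have "f x = f (\<Sum>b\<in>Basis. (x \<bullet> b) *\<^sub>R b)" by (simp add: euclidean_representation)
    then show ?thesis by (simp add: sum scaleR)
  qed
  then have "f = (\<lambda>x. \<Sum>b\<in>Basis. (x \<bullet> b) * f b)" by blast
  moreover have "smooth (\<lambda>x. \<Sum>b\<in>Basis. (x \<bullet> b) * f b)"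
    by (intro smooth_sum smooth_mult smooth_inner smooth_const)
  ultimately show ?case by simp
qed (auto intro: smooth_add smooth_mult)

context bounded_open
begin

theorem dirichlet_regular_if_barrier:
  fixes W :: "'a \<Rightarrow> real"
  assumes W: "smooth W" "\<And>x. x \<in> \<Omega> \<Longrightarrow> laplacian W x \<le> -1" "\<And>x. x \<in> \<Omega> \<Longrightarrow> 0 \<le> W x" "\<And>x. x \<in> frontier \<Omega> \<Longrightarrow> W x = 0"
  shows "dirichlet_regular \<Omega>"
  unfolding dirichlet_regular_def
proof (intro allI impI)
  fix f :: "'a \<Rightarrow> real" assume f: "continuous_on (frontier \<Omega>) f"
  have "\<exists>q. smooth q \<and> (\<forall>x\<in>frontier \<Omega>. \<bar>f x - q x\<bar> \<le> 1 / Suc k)" for k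
  proof -
    obtain q where q: "polynomial_function q" "\<And>x. x \<in> frontier \<Omega> \<Longrightarrow> norm (f x - q x) < 1 / Suc k"
      using Stone_Weierstrass_polynomial_function[OF compact_frontier f, of "1 / Suc k"] by auto
    then have "smooth q" by (simp add: real_polynomial_function_eq real_polynomial_function_smooth)
    then show ?thesis using q(2) by (intro exI[of _ q]) (auto intro: less_imp_le)
  qed
  then obtain q where q: "\<And>k. smooth (q k)" "\<And>k x. x \<in> frontier \<Omega> \<Longrightarrow> \<bar>f x - q k x\<bar> \<le> 1 / Suc k" by metis
  have "\<exists>v. solves_dirichlet \<Omega> (q k) v \<and> (\<forall>\<phi>. test_function \<Omega> \<phi> \<longrightarrow> (LINT x|\<mu>. v x * laplacian \<phi> x) = 0)" for k
    using dirichlet_smooth_data[OF W q(1)[of k]] by metis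
  then obtain v where v: "\<And>k. solves_dirichlet \<Omega> (q k) (v k)"
    "\<And>k \<phi>. test_function \<Omega> \<phi> \<Longrightarrow> (LINT x|\<mu>. v k x * laplacian \<phi> x) = 0" by metis
  have vc: "continuous_on (closure \<Omega>) (v k)" and vh: "harmonic_on (v k) \<Omega>" and vf: "x \<in> frontier \<Omega> \<Longrightarrow> v k x = q k x" for k x
    using v(1)[of k] by (auto simp: solves_dirichlet_def)
  \<comment> \<open>On the frontier both functions are close to f; the maximum principle extends
    this to the closure, so the solutions form a uniform Cauchy sequence.\<close>
  have dist: "\<bar>v j x - v k x\<bar> \<le> 1 / Suc j + 1 / Suc k" if x: "x \<in> closure \<Omega>" for j k x
  proof (rule harmonic_diff_bound[OF open_domain bounded_domain vc vh vc vh _ x])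
    fix y assume y: "y \<in> frontier \<Omega>"
    show "\<bar>v j y - v k y\<bar> \<le> 1 / Suc j + 1 / Suc k"
      using q(2)[OF y, of j] q(2)[OF y, of k] vf[OF y, of j] vf[OF y, of k] by linarith
  qed
  have inv0: "(\<lambda>k. 1 / real (Suc k)) \<longlonglongrightarrow> 0" by (rule LIMSEQ_Suc[OF lim_1_over_n])
  define u where "u x = lim (\<lambda>k. v k x)" for x
  have conv: "(\<lambda>k. v k x) \<longlonglongrightarrow> u x" if x: "x \<in> closure \<Omega>" for x
  proof -
    have "Cauchy (\<lambda>k. v k x)"
    proof (rule metric_CauchyI)
      fix e :: real assume "0 < e"
      then obtain N where N: "1 / real (Suc N) < e / 2"
        using reals_Archimedean[of "e / 2"] by (auto simp: inverse_eq_divide)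
      have "dist (v m x) (v n x) < e" if "m \<ge> N" "n \<ge> N" for m n
      proof -
        have "1 / real (Suc m) \<le> 1 / real (Suc N)" "1 / real (Suc n) \<le> 1 / real (Suc N)"
          using that by (auto simp: field_simps)
        then have "1 / real (Suc m) + 1 / real (Suc n) < e" using N by argo
        then show ?thesis using dist[OF x, of m n] by (simp add: dist_real_def)
      qed
      then show "\<exists>N. \<forall>m\<ge>N. \<forall>n\<ge>N. dist (v m x) (v n x) < e" by blast
    qed
    then show ?thesis unfolding u_def by (simp add: Cauchy_convergent_iff convergent_LIMSEQ_iff)
  qed
  have near: "\<bar>v k x - u x\<bar> \<le> 1 / Suc k" if x: "x \<in> closure \<Omega>" for k x
  proof -
    have "(\<lambda>j. 1 / Suc j + 1 / Suc k - \<bar>v j x - v k x\<bar>) \<longlonglongrightarrow> 0 + 1 / Suc k - \<bar>u x - v k x\<bar>"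
      by (intro tendsto_intros inv0 conv x)
    then have "0 \<le> 0 + 1 / Suc k - \<bar>u x - v k x\<bar>"
      by (rule LIMSEQ_le_const) (use dist[OF x] in auto)
    then show ?thesis by (simp add: abs_minus_commute)
  qed
  have unif: "uniform_limit (closure \<Omega>) v u sequentially"
    unfolding uniform_limit_iff
  proof (intro allI impI)
    fix e :: real assume "0 < e"
    then have "\<forall>\<^sub>F k in sequentially. 1 / real (Suc k) < e" using order_tendstoD(2)[OF inv0] by blast
    then show "\<forall>\<^sub>F k in sequentially. \<forall>x\<in>closure \<Omega>. dist (v k x) (u x) < e"
      by eventually_elim (use near in \<open>auto simp: dist_real_def intro: le_less_trans\<close>)
  qed
  have uc: "continuous_on (closure \<Omega>) u"
    by (rule uniform_limit_theorem[OF _ unif]) (auto intro!: always_eventually vc)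
  have uc': "continuous_on \<Omega> u" using uc closure_subset continuous_on_subset by blast
  have uf: "u x = f x" if x: "x \<in> frontier \<Omega>" for x
  proof (rule LIMSEQ_unique)
    show "(\<lambda>k. v k x) \<longlonglongrightarrow> u x" using x by (intro conv) (simp add: frontier_def)
    have "(\<lambda>k. v k x - f x) \<longlonglongrightarrow> 0"
      by (rule Lim_null_comparison[OF _ inv0]) (use q(2)[OF x] vf[OF x] in \<open>auto simp: abs_minus_commute\<close>)
    then show "(\<lambda>k. v k x) \<longlonglongrightarrow> f x" by (simp add: LIM_zero_iff)
  qed
  have "compact (u ` closure \<Omega>)" using bounded_domain uc by (intro compact_continuous_image) auto
  from compact_imp_bounded[OF this] obtain B where "\<forall>y\<in>u ` closure \<Omega>. norm y \<le> B"
    unfolding bounded_iff by blast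
  then have B: "\<And>x. x \<in> closure \<Omega> \<Longrightarrow> \<bar>u x\<bar> \<le> B" by simp
  have um: "u \<in> borel_measurable \<mu>" by (rule continuous_on_mu_measurable[OF uc'])
  have ui: "integrable \<mu> u"
    using B closure_subset[of \<Omega>] um by (intro integrable_const_bound[of _ B]) (auto intro!: AE_I2)
  have harm: "(LINT x|\<mu>. u x * laplacian \<phi> x) = 0" if \<phi>: "test_function \<Omega> \<phi>" for \<phi>
  proof -
    have s: "smooth (laplacian \<phi>)" by (rule smooth_laplacian[OF test_function_smooth[OF \<phi>]])
    have iv: "integrable \<mu> (\<lambda>x. h x * laplacian \<phi> x)" if "h \<in> borel_measurable \<mu>" "\<And>x. x \<in> \<Omega> \<Longrightarrow> \<bar>h x\<bar> \<le> B" for h B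
    proof (rule Bochner_Integration.integrable_bound)
      show "integrable \<mu> (\<lambda>x. B * laplacian \<phi> x)" using smooth_integrable[OF s] by simp
      show "(\<lambda>x. h x * laplacian \<phi> x) \<in> borel_measurable \<mu>"
        using that(1) smooth_integrable[OF s] by auto
      show "AE x in \<mu>. norm (h x * laplacian \<phi> x) \<le> norm (B * laplacian \<phi> x)"
        using that(2) by (intro AE_I2) (force simp: abs_mult intro!: mult_right_mono)
    qed
    define I where "I = (LINT x|\<mu>. \<bar>laplacian \<phi> x\<bar>)"
    have "\<bar>LINT x|\<mu>. u x * laplacian \<phi> x\<bar> \<le> 1 / Suc k * I" for k
    proof -
      have um': "(\<lambda>x. u x - v k x) \<in> borel_measurable \<mu>"
        using um continuous_on_mu_measurable[OF continuous_on_subset[OF vc closure_subset]] by simp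
      have ub: "\<bar>u x - v k x\<bar> \<le> 1 / Suc k" if "x \<in> \<Omega>" for x
        using near[of x k] that closure_subset by (auto simp: abs_minus_commute)
      have i1: "integrable \<mu> (\<lambda>x. (u x - v k x) * laplacian \<phi> x)" by (rule iv[OF um' ub])
      have i2: "integrable \<mu> (\<lambda>x. u x * laplacian \<phi> x)"
        using B closure_subset by (intro iv[OF um, of B]) auto
      have "(LINT x|\<mu>. u x * laplacian \<phi> x) - (LINT x|\<mu>. (u x - v k x) * laplacian \<phi> x)
          = (LINT x|\<mu>. u x * laplacian \<phi> x - (u x - v k x) * laplacian \<phi> x)"
        using i1 i2 by simp
      also have "\<dots> = (LINT x|\<mu>. v k x * laplacian \<phi> x)" by (simp add: algebra_simps)
      also have "\<dots> = 0" by (rule v(2)[OF \<phi>])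
      finally have "(LINT x|\<mu>. u x * laplacian \<phi> x) = (LINT x|\<mu>. (u x - v k x) * laplacian \<phi> x)" by simp
      also have "\<bar>\<dots>\<bar> \<le> (LINT x|\<mu>. \<bar>(u x - v k x) * laplacian \<phi> x\<bar>)"
        by (rule integral_abs_bound)
      also have "\<dots> \<le> (LINT x|\<mu>. 1 / Suc k * \<bar>laplacian \<phi> x\<bar>)"
      proof (rule integral_mono)
        show "\<bar>(u x - v k x) * laplacian \<phi> x\<bar> \<le> 1 / Suc k * \<bar>laplacian \<phi> x\<bar>" if "x \<in> space \<mu>" for x
          unfolding abs_mult using ub that by (intro mult_right_mono) auto
      qed (use i1 smooth_integrable[OF s] in auto)
      also have "\<dots> = 1 / Suc k * I" unfolding I_def by (rule integral_mult_right_zero)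
      finally show ?thesis .
    qed
    moreover have "(\<lambda>k. 1 / Suc k * I) \<longlonglongrightarrow> 0" using tendsto_mult_right[OF inv0, of I] by simp
    ultimately have "\<bar>LINT x|\<mu>. u x * laplacian \<phi> x\<bar> \<le> 0" by (intro LIMSEQ_le_const) auto
    then show ?thesis by simp
  qed
  \<comment> \<open>The limit is continuous already, so the constant sequence is an admissible
    approximation. Both functions being continuous, equality almost everywhere becomes equality on
    \<Omega>.\<close>
  obtain V where V: "harmonic_on V \<Omega>" "AE x in \<mu>. V x = u x"
    by (rule weyl_mu[of u "\<lambda>k. u"]) (use ui harm uc' in auto)
  have cV: "continuous_on \<Omega> V"
    using V(1) by (auto simp: harmonic_on_def numeral_2_eq_2 C_k_on_Suc)
  have "u x = V x" if x: "x \<in> \<Omega>" for x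
  proof -
    have "0 \<le> u x - V x"
      by (rule AE_mu_nonneg_imp[OF _ _ x]) (use V(2) in \<open>auto intro!: continuous_intros uc' cV elim: eventually_mono\<close>)
    moreover have "0 \<le> V x - u x"
      by (rule AE_mu_nonneg_imp[OF _ _ x]) (use V(2) in \<open>auto intro!: continuous_intros uc' cV elim: eventually_mono\<close>)
    ultimately show ?thesis by simp
  qed
  then have "harmonic_on u \<Omega>" by (rule harmonic_on_cong[OF open_domain _ V(1)])
  then have sol: "solves_dirichlet \<Omega> f u" using uc uf by (simp add: solves_dirichlet_def)
  show "\<exists>v. solves_dirichlet \<Omega> f v \<and> (\<forall>w. solves_dirichlet \<Omega> f w \<longrightarrow> (\<forall>x\<in>closure \<Omega>. w x = v x))"
  proof (intro exI[of _ u] conjI sol allI impI ballI)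
    fix w x assume w: "solves_dirichlet \<Omega> f w" and x: "x \<in> closure \<Omega>"
    have "\<bar>w x - u x\<bar> \<le> 0"
      by (rule harmonic_diff_bound[OF open_domain bounded_domain _ _ _ _ _ x])
         (use w sol in \<open>auto simp: solves_dirichlet_def\<close>)
    then show "w x = u x" by simp
  qed
qed

end

subsection \<open>A planar domain with a cusp\<close>

definition pt :: "real \<Rightarrow> real \<Rightarrow> real^2" where
  "pt s t = (\<chi> i. if i = 1 then s else t)"

lemma pt_nth [simp]: "pt s t $ 1 = s" "pt s t $ 2 = t"
  by (simp_all add: pt_def)

lemma pt_eta: "pt (p $ 1) (p $ 2) = p"
  by (simp add: vec_eq_iff forall_2)

lemma continuous_on_pt [continuous_intros]:
  assumes "continuous_on S f" "continuous_on S g"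
  shows "continuous_on S (\<lambda>x. pt (f x) (g x))"
  unfolding pt_def
proof (intro continuous_on_vec_lambda)
  show "continuous_on S (\<lambda>x. if i = 1 then f x else g x)" for i :: 2
    using assms by (cases "i = 1") auto
qed

lemma Basis_2: "(Basis :: (real^2) set) = {axis 1 1, axis 2 1}"
  by (auto simp: Basis_vec_def) (metis exhaust_2)

lemma inner_axis_1: "p \<bullet> axis i (1::real) = p $ i"
  by (simp add: inner_axis)

locale cusp =
  fixes l :: nat
  assumes l: "2 \<le> l"
begin

text \<open>With this factor c l (l - 1) \<le> 1, so that g'' and g are at most 1 on the unit
  interval whatever \<open>l\<close> is.\<close>

definition c :: real where "c = 1 / (real l)\<^sup>2"

definition g :: "real \<Rightarrow> real" where "g x = c * (x ^ l - x ^ Suc l)"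
definition g' :: "real \<Rightarrow> real" where "g' x = c * (real l * x ^ (l - 1) - real (Suc l) * x ^ l)"
definition g'' :: "real \<Rightarrow> real" where "g'' x = c * (real l * (real (l - 1) * x ^ (l - 2)) - real (Suc l) * (real l * x ^ (l - 1)))"

definition \<Omega> :: "(real^2) set" where
  "\<Omega> = {p. 0 < p $ 1 \<and> p $ 1 < 1 \<and> 0 < p $ 2 \<and> p $ 2 < g (p $ 1)}"

definition W :: "real^2 \<Rightarrow> real" where "W p = p $ 2 * (g (p $ 1) - p $ 2)"

lemma c_bounds: "0 < c" "c \<le> 1" "c * (real l)\<^sup>2 = 1"
  using l by (auto simp: c_def field_simps one_le_power)

lemma g_eq: "g x = c * x ^ l * (1 - x)"
  by (simp add: g_def algebra_simps)

lemma g_derivs: "(g has_real_derivative g' x) (at x)" "(g' has_real_derivative g'' x) (at x)"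
proof -
  show "(g has_real_derivative g' x) (at x)"
  proof -
    have "((\<lambda>x. c * (x ^ l - x ^ Suc l)) has_real_derivative c * (real l * x ^ (l - Suc 0) - real (Suc l) * x ^ l)) (at x)"
      using DERIV_pow[of l x] DERIV_pow[of "Suc l" x] by (intro DERIV_cmult DERIV_diff) simp_all
    then show ?thesis unfolding g_def[abs_def] g'_def by simp
  qed
  have "l - Suc (Suc 0) = l - 2" by simp
  then show "(g' has_real_derivative g'' x) (at x)"
    unfolding g'_def[abs_def] g''_def by (auto intro!: derivative_eq_intros)
qed

lemma g_bounds:
  assumes "0 \<le> x" "x \<le> 1"
  shows "0 \<le> g x" "g x \<le> c" "g x \<le> x ^ l" "g'' x \<le> 1" "\<bar>g' x\<bar> \<le> 3"
proof -
  have p: "0 \<le> x ^ k" "x ^ k \<le> 1" for k using assms by (auto simp: power_le_one)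
  show "0 \<le> g x" unfolding g_eq using assms c_bounds by simp
  have "c * (x ^ l * (1 - x)) \<le> c * (1 * 1)"
    using assms c_bounds p by (intro mult_left_mono mult_mono) auto
  then show "g x \<le> c" by (simp add: g_eq mult.assoc)
  have "c * x ^ l * (1 - x) \<le> 1 * x ^ l * 1"
    using assms c_bounds p by (intro mult_mono) auto
  then show "g x \<le> x ^ l" by (simp add: g_eq)
  have ll: "real (l - 1) \<le> real l" "real (Suc l) \<le> 2 * real l" "real l \<le> (real l)\<^sup>2" using l by (auto simp: power2_eq_square)
  have "real l * (real (l - 1) * x ^ (l - 2)) \<le> real l * (real l * 1)"
    using p ll by (intro mult_left_mono mult_mono) auto
  moreover have "0 \<le> real (Suc l) * (real l * x ^ (l - 1))" using p by simp
  ultimately have "g'' x \<le> c * (real l)\<^sup>2"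
    unfolding g''_def using c_bounds by (intro mult_left_mono) (auto simp: power2_eq_square)
  then show "g'' x \<le> 1" using c_bounds by simp
  have "\<bar>real l * x ^ (l - 1) - real (Suc l) * x ^ l\<bar> \<le> real l * x ^ (l - 1) + real (Suc l) * x ^ l"
    using p by (auto simp: abs_le_iff)
  also have "\<dots> \<le> real l * 1 + real (Suc l) * 1"
    using p by (intro add_mono mult_left_mono) auto
  also have "\<dots> \<le> 3 * real l" using ll(2) by simp
  also have "\<dots> \<le> 3 * (real l)\<^sup>2" using ll(3) by (intro mult_left_mono) auto
  finally have "c * \<bar>real l * x ^ (l - 1) - real (Suc l) * x ^ l\<bar> \<le> c * (3 * (real l)\<^sup>2)"
    using c_bounds by (intro mult_left_mono) auto
  also have "c * (3 * (real l)\<^sup>2) = 3" using c_bounds(3) by (simp add: mult.left_commute)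
  finally show "\<bar>g' x\<bar> \<le> 3" using c_bounds(1) by (simp add: g'_def abs_mult)
qed

lemma g_pos: "0 < x \<Longrightarrow> x < 1 \<Longrightarrow> 0 < g x"
  unfolding g_eq using c_bounds by simp

lemma continuous_on_g: "continuous_on S g"
  unfolding g_def[abs_def] by (intro continuous_intros)

lemma g_ends: "g 0 = 0" "g 1 = 0"
  using l by (auto simp: g_eq)

lemma W_eq: "W p = (p \<bullet> axis 2 1) * (g (p \<bullet> axis 1 1) - (p \<bullet> axis 2 1))"
  by (simp add: W_def inner_axis_1)

lemma smooth_g: "smooth (\<lambda>p::real^2. g (p \<bullet> axis 1 1))"
  unfolding g_def by (intro smooth_cmult smooth_diff smooth_power smooth_inner)

lemma smooth_W: "smooth W"
  unfolding W_eq[abs_def] by (intro smooth_mult smooth_diff smooth_g smooth_inner)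

lemma laplacian_W: "laplacian W p = p $ 2 * g'' (p $ 1) - 2"
proof -
  define e1 e2 :: "real^2" where "e1 = axis 1 1" and "e2 = axis 2 1"
  have e: "e1 \<bullet> e1 = 1" "e1 \<bullet> e2 = 0" "e2 \<bullet> e1 = 0" "e2 \<bullet> e2 = 1" "e1 \<noteq> e2"
    by (simp_all add: e1_def e2_def inner_axis_axis axis_eq_axis)
  have i: "((\<lambda>p::real^2. p \<bullet> v) has_derivative (\<lambda>h. h \<bullet> v)) (at p)" for v p by (auto intro!: derivative_eq_intros)
  have gd: "((\<lambda>p. g (p \<bullet> e1)) has_derivative (\<lambda>h. g' (p \<bullet> e1) * (h \<bullet> e1))) (at p)" for p
    using has_derivative_compose[OF i g_derivs(1)[unfolded has_field_derivative_def], of e1] .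
  have D: "(W has_derivative (\<lambda>h. (p \<bullet> e2) * (g' (p \<bullet> e1) * (h \<bullet> e1) - h \<bullet> e2) + (h \<bullet> e2) * (g (p \<bullet> e1) - p \<bullet> e2))) (at p)" for p
  proof -
    from has_derivative_mult[OF i has_derivative_diff[OF gd i]] show ?thesis
      unfolding W_eq[abs_def] e1_def[symmetric] e2_def[symmetric] .
  qed
  have p1: "partial e1 W = (\<lambda>p. (p \<bullet> e2) * g' (p \<bullet> e1))"
    using partial_eqI[OF D, of e1] e by (auto simp: fun_eq_iff)
  have p2: "partial e2 W = (\<lambda>p. g (p \<bullet> e1) - 2 * (p \<bullet> e2))"
    using partial_eqI[OF D, of e2] e by (auto simp: fun_eq_iff)
  have "((\<lambda>p. (p \<bullet> e2) * g' (p \<bullet> e1)) has_derivative (\<lambda>h. (p \<bullet> e2) * (g'' (p \<bullet> e1) * (h \<bullet> e1)) + (h \<bullet> e2) * g' (p \<bullet> e1))) (at p)" for p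
  proof -
    have "((\<lambda>p. g' (p \<bullet> e1)) has_derivative (\<lambda>h. g'' (p \<bullet> e1) * (h \<bullet> e1))) (at p)"
      using has_derivative_compose[OF i g_derivs(2)[unfolded has_field_derivative_def], of e1] .
    from has_derivative_mult[OF i this] show ?thesis .
  qed
  from partial_eqI[OF this, of e1] have pp1: "partial e1 (partial e1 W) p = (p \<bullet> e2) * g'' (p \<bullet> e1)"
    unfolding p1 by (simp add: e)
  have "((\<lambda>p. g (p \<bullet> e1) - 2 * (p \<bullet> e2)) has_derivative (\<lambda>h. g' (p \<bullet> e1) * (h \<bullet> e1) - 2 * (h \<bullet> e2))) (at p)" for p
  proof -
    from has_derivative_diff[OF gd has_derivative_mult_right[OF i]] show ?thesis .
  qed
  from partial_eqI[OF this, of e2] have pp2: "partial e2 (partial e2 W) p = - 2"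
    unfolding p2 by (simp add: e)
  have "laplacian W p = partial e1 (partial e1 W) p + partial e2 (partial e2 W) p"
    unfolding laplacian_def Basis_2 e1_def[symmetric] e2_def[symmetric] using e(5) by simp
  then show ?thesis unfolding pp1 pp2 by (simp add: e1_def e2_def inner_axis_1)
qed

text \<open>On the domain 0 < y < g \<le> 1 and g'' \<le> 1, so y g'' - 2 is at most -1.\<close>

lemma laplacian_W_le: "p \<in> \<Omega> \<Longrightarrow> laplacian W p \<le> -1"
proof -
  assume p: "p \<in> \<Omega>"
  then have b: "0 \<le> p $ 1" "p $ 1 \<le> 1" "0 \<le> p $ 2" "p $ 2 \<le> g (p $ 1)" by (auto simp: \<Omega>_def)
  have "p $ 2 * g'' (p $ 1) \<le> p $ 2 * 1" using b g_bounds(4)[OF b(1,2)] by (intro mult_left_mono) auto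
  then show ?thesis using b g_bounds(2)[OF b(1,2)] c_bounds by (simp add: laplacian_W)
qed

lemma W_pos: "p \<in> \<Omega> \<Longrightarrow> 0 < W p"
  by (auto simp: \<Omega>_def W_def)

lemma open_cusp: "open \<Omega>"
proof -
  have "continuous_on UNIV (\<lambda>p::real^2. g (p $ 1))"
    by (rule continuous_on_compose2[OF continuous_on_g[of UNIV]]) (auto intro!: continuous_intros)
  then show ?thesis
    unfolding \<Omega>_def by (intro open_Collect_conj open_Collect_less continuous_intros)
qed

text \<open>Straightens the cusp to a unit square; connectedness, boundedness and the boundary
  points are then read off from the square.\<close>

definition \<Phi> :: "real \<times> real \<Rightarrow> real^2" where "\<Phi> q = pt (fst q) (snd q * g (fst q))"

lemma continuous_on_\<Phi>: "continuous_on S \<Phi>"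
  unfolding \<Phi>_def[abs_def]
  by (intro continuous_intros continuous_on_compose2[OF continuous_on_g[of UNIV]]) auto

lemma cusp_eq_image: "\<Omega> = \<Phi> ` ({0<..<1} \<times> {0<..<1})"
proof (intro set_eqI iffI)
  fix p assume p: "p \<in> \<Omega>"
  then have b: "0 < p $ 1" "p $ 1 < 1" "0 < p $ 2" "p $ 2 < g (p $ 1)" by (auto simp: \<Omega>_def)
  then have "p = \<Phi> (p $ 1, p $ 2 / g (p $ 1))" by (simp add: \<Phi>_def pt_eta)
  moreover have "(p $ 1, p $ 2 / g (p $ 1)) \<in> {0<..<1} \<times> {0<..<1}"
    using b by simp
  ultimately show "p \<in> \<Phi> ` ({0<..<1} \<times> {0<..<1})" by blast
next
  fix p assume "p \<in> \<Phi> ` ({0<..<1} \<times> {0<..<1})"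
  then show "p \<in> \<Omega>" using g_pos by (auto simp: \<Phi>_def \<Omega>_def)
qed

lemma bounded_domain_cusp: "bounded_domain \<Omega>"
  unfolding bounded_domain_def
proof (intro conjI open_cusp)
  show "connected \<Omega>"
    unfolding cusp_eq_image
    by (intro connected_continuous_image continuous_on_\<Phi> connected_Times connected_Ioo)
  have "\<Omega> \<subseteq> \<Phi> ` ({0..1} \<times> {0..1})" unfolding cusp_eq_image by (intro image_mono) auto
  moreover have "compact (\<Phi> ` ({0..1} \<times> {0..1}))"
    by (intro compact_continuous_image continuous_on_\<Phi> compact_Times) auto
  ultimately show "bounded \<Omega>" using bounded_subset compact_imp_bounded by blast
  have "((1/2::real), (1/2::real)) \<in> {0<..<1} \<times> {0<..<1}" by simp
  then show "\<Omega> \<noteq> {}" unfolding cusp_eq_image by blast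
qed

definition curve :: "bool \<Rightarrow> real \<Rightarrow> real^2" where
  "curve b s = pt s (if b then g s else 0)"

text \<open>Because g vanishes at 0 and 1, the vertical sides of the square collapse to points of
  the two arcs. The arcs lie in the closure as images of the horizontal sides of the closed
  square.\<close>

lemma frontier_cusp: "frontier \<Omega> = curve True ` {0..1} \<union> curve False ` {0..1}"
proof
  define D :: "(real^2) set" where "D = {p. 0 \<le> p $ 1 \<and> p $ 1 \<le> 1 \<and> 0 \<le> p $ 2 \<and> p $ 2 \<le> g (p $ 1)}"
  have "continuous_on UNIV (\<lambda>p::real^2. g (p $ 1))"
    by (rule continuous_on_compose2[OF continuous_on_g[of UNIV]]) (auto intro!: continuous_intros)
  then have "closed D" unfolding D_def by (intro closed_Collect_conj closed_Collect_le continuous_intros)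
  then have cl: "closure \<Omega> \<subseteq> D" by (intro closure_minimal) (auto simp: \<Omega>_def D_def)
  show "frontier \<Omega> \<subseteq> curve True ` {0..1} \<union> curve False ` {0..1}"
  proof
    fix p assume "p \<in> frontier \<Omega>"
    then have "p \<in> D" "p \<notin> \<Omega>" using cl open_cusp by (auto simp: frontier_def interior_open)
    then have "p $ 1 \<in> {0..1}" "p $ 2 = 0 \<or> p $ 2 = g (p $ 1)"
      using g_ends by (auto simp: D_def \<Omega>_def not_less)
    moreover from this have "p = curve True (p $ 1) \<or> p = curve False (p $ 1)"
      using pt_eta[of p] by (auto simp: curve_def)
    ultimately show "p \<in> curve True ` {0..1} \<union> curve False ` {0..1}" by blast
  qed
  have sub: "\<Phi> ` ({0..1} \<times> {0..1}) \<subseteq> closure \<Omega>"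
  proof -
    have "\<Phi> ` closure ({0<..<1} \<times> {0<..<1}) \<subseteq> closure (\<Phi> ` ({0<..<1} \<times> {0<..<1}))"
      by (intro image_closure_subset continuous_on_\<Phi> closure_subset) auto
    then show ?thesis by (simp add: closure_Times flip: cusp_eq_image)
  qed
  have "curve b s \<in> frontier \<Omega>" if "s \<in> {0..1}" for b s
  proof -
    have "curve b s = \<Phi> (s, if b then 1 else 0)" by (simp add: curve_def \<Phi>_def)
    then have "curve b s \<in> closure \<Omega>" using sub that by auto
    moreover have "curve b s \<notin> \<Omega>" by (auto simp: curve_def \<Omega>_def)
    ultimately show ?thesis using open_cusp by (simp add: frontier_def interior_open)
  qed
  then show "curve True ` {0..1} \<union> curve False ` {0..1} \<subseteq> frontier \<Omega>" by blast
qed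

lemma W_frontier: "p \<in> frontier \<Omega> \<Longrightarrow> W p = 0"
  unfolding frontier_cusp by (auto simp: curve_def W_def)

sublocale dom: bounded_open \<Omega>
  using bounded_domain_cusp by unfold_locales (auto simp: bounded_domain_def)

lemma dirichlet_regular_cusp: "dirichlet_regular \<Omega>"
  by (rule dom.dirichlet_regular_if_barrier[OF smooth_W laplacian_W_le _ W_frontier]) (auto dest: W_pos)

text \<open>The abscissa contributes 1 and |g'| \<le> 3 contributes 3 to the constant 4, by way of
  the sum norm.\<close>

lemma curve_lipschitz:
  assumes "s \<in> {0..1}" "t \<in> {0..1}"
  shows "dist (curve b s) (curve b t) \<le> 4 * \<bar>s - t\<bar>"
proof -
  have "norm (g s - g t) \<le> 3 * norm (s - t)"
  proof (rule differentiable_bound[of "{0..1}" g "\<lambda>x. (*) (g' x)"])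
    show "(g has_derivative (*) (g' x)) (at x within {0..1})" for x
      using g_derivs(1)[of x] by (auto simp: has_field_derivative_def intro: has_derivative_at_withinI)
    show "onorm ((*) (g' x)) \<le> 3" if "x \<in> {0..1}" for x
      using g_bounds(5)[of x] that by (intro onorm_bound) (auto simp: abs_mult intro!: mult_right_mono)
  qed (use assms in auto)
  then have "\<bar>(curve b s - curve b t) $ 1\<bar> + \<bar>(curve b s - curve b t) $ 2\<bar> \<le> 4 * \<bar>s - t\<bar>"
    by (auto simp: curve_def)
  then show ?thesis
    using norm_le_l1_cart[of "curve b s - curve b t"] by (simp add: dist_norm sum_2)
qed

text \<open>Upper bound: over an interval of length at most 2 r each 4-Lipschitz arc has measure at
  most 8 r, and there are two arcs. Lower bound: the part of an arc over an interval of length r/8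
  stays within 4 r/8 < r of p, and projection to the abscissa loses a factor 2.\<close>

lemma ahlfors_regular_cusp: "ahlfors_regular (frontier \<Omega>)"
  unfolding ahlfors_regular_def
proof (intro exI)
  show "has_ahlfors_character (1/16) 16 1 (frontier \<Omega>)"
    unfolding has_ahlfors_character_def
  proof (intro conjI ballI)
    fix p r assume p: "p \<in> frontier \<Omega>" and r: "r \<in> {0<..<1::real}"
    have d: "DIM(real^2) - 1 = Suc 0" by simp
    define I where "I = {max 0 (p $ 1 - r)..min 1 (p $ 1 + r)}"
    have len: "hausdorff_measure (Suc 0) (curve b ` I) \<le> ennreal (8 * r)" for b
    proof -
      have "hausdorff_measure (Suc 0) (curve b ` I) \<le> ennreal (4 * (min 1 (p $ 1 + r) - max 0 (p $ 1 - r)))"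
        unfolding I_def by (rule hausdorff_measure_lipschitz_curve) (auto intro!: curve_lipschitz)
      also have "\<dots> \<le> ennreal (8 * r)" by (intro ennreal_leI) (auto simp: min_def max_def)
      finally show ?thesis .
    qed
    have "ball p r \<inter> frontier \<Omega> \<subseteq> curve True ` I \<union> curve False ` I"
    proof
      fix q assume q: "q \<in> ball p r \<inter> frontier \<Omega>"
      then obtain b s where s: "q = curve b s" "s \<in> {0..1}" unfolding frontier_cusp by auto
      have "\<bar>(p - q) $ 1\<bar> < r" using component_le_norm_cart[of "p - q" 1] q by (simp add: dist_norm)
      then have "s \<in> I" using s by (auto simp: I_def curve_def)
      then show "q \<in> curve True ` I \<union> curve False ` I" using s(1) by (cases b) auto
    qed
    then have "hausdorff_measure (Suc 0) (ball p r \<inter> frontier \<Omega>) \<le> hausdorff_measure (Suc 0) (curve True ` I) + hausdorff_measure (Suc 0) (curve False ` I)"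
      using hausdorff_measure_mono hausdorff_measure_Un order.trans by blast
    also have "\<dots> \<le> ennreal (8 * r) + ennreal (8 * r)" by (intro add_mono len)
    also have "\<dots> = ennreal (16 * r)" using r by (simp flip: ennreal_plus)
    finally show "hausdorff_measure (DIM(real^2) - 1) (ball p r \<inter> frontier \<Omega>) \<le> ennreal (16 * r ^ (DIM(real^2) - 1))"
      by (simp add: d)
    obtain b s where s: "p = curve b s" "s \<in> {0..1}" using p unfolding frontier_cusp by auto
    \<comment> \<open>The interval goes to the right or to the left of s, whichever keeps it inside
      the unit interval.\<close>
    define a where "a = (if s \<le> 1/2 then s else s - r / 8)"
    have a: "{a..a + r / 8} \<subseteq> {0..1}" "\<And>t. t \<in> {a..a + r / 8} \<Longrightarrow> \<bar>s - t\<bar> \<le> r / 8"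
      using s(2) r by (auto simp: a_def abs_le_iff split: if_splits)
    have "{a..a + r / 8} \<subseteq> (\<lambda>q. q $ 1) ` (ball p r \<inter> frontier \<Omega>)"
    proof
      fix t assume t: "t \<in> {a..a + r / 8}"
      have "dist p (curve b t) \<le> 4 * \<bar>s - t\<bar>" using curve_lipschitz[OF s(2), of t b] t a(1) s(1) by auto
      also have "\<dots> < r" using a(2)[OF t] r by auto
      finally have "curve b t \<in> ball p r" by simp
      moreover have "curve b t \<in> frontier \<Omega>" using t a(1) unfolding frontier_cusp by (cases b) auto
      moreover have "t = curve b t $ 1" by (simp add: curve_def)
      ultimately show "t \<in> (\<lambda>q. q $ 1) ` (ball p r \<inter> frontier \<Omega>)" by blast
    qed
    then have "ennreal (a + r / 8 - a) \<le> 2 * hausdorff_measure (Suc 0) (ball p r \<inter> frontier \<Omega>)"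
    proof (rule interval_le_hausdorff_measure[rotated])
      show "\<bar>x $ 1 - y $ 1\<bar> \<le> dist x y" for x y :: "real^2"
        using component_le_norm_cart[of "x - y" 1] by (simp add: dist_norm)
    qed
    then have "ennreal (r / 16) \<le> hausdorff_measure (Suc 0) (ball p r \<inter> frontier \<Omega>)"
    proof (cases "hausdorff_measure (Suc 0) (ball p r \<inter> frontier \<Omega>)")
      case (real x)
      then have "ennreal (r / 8) \<le> ennreal (2 * x)"
        using \<open>ennreal (a + r / 8 - a) \<le> _\<close> by (simp add: ennreal_mult')
      then show ?thesis using real by (simp add: ennreal_le_iff)
    qed simp
    then show "ennreal (1/16 * r ^ (DIM(real^2) - 1)) \<le> hausdorff_measure (DIM(real^2) - 1) (ball p r \<inter> frontier \<Omega>)"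
      by (simp add: d)
  qed auto
qed

text \<open>On the k-th rectangle u is at most g^2 \<le> 2^(-2 k l), and the area is a fixed
  multiple of 2^(-k - (k + 1) l). The contribution is thus at least a constant times 2^(k (l (2
  \<beta> - 1) - 1)), and the hypothesis says that this exponent is not negative.\<close>

lemma neg_power_integral_cusp:
  assumes u: "torsion_function \<Omega> u" and \<beta>: "0 < \<beta>" "1 \<le> real l * (2 * \<beta> - 1)"
  shows "neg_power_integral \<Omega> u \<beta> = \<infinity>"
proof -
  define x where "x k = 2 powr (- real k)" for k :: nat
  \<comment> \<open>A lower bound for g between x (k + 1) and x k: there x^l \<ge> 2^(-(k + 1) l),
    and 1 - x \<ge> 1/2 since k \<ge> 1.\<close>
  define h where "h k = c / 2 * 2 powr (- (real k + 1) * real l)" for k :: nat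
  \<comment> \<open>disjoint rectangles in the cusp, each contributing at least a fixed amount to the integral\<close>
  define R where "R k = cbox (pt (3/4 * x k) (h k / 2)) (pt (x k) (3/4 * h k))" for k
  have hp: "0 < h k" for k using c_bounds by (simp add: h_def)
  have xp: "0 < x k" for k by (simp add: x_def)
  have mem: "p \<in> R k \<longleftrightarrow> 3/4 * x k \<le> p $ 1 \<and> p $ 1 \<le> x k \<and> h k / 2 \<le> p $ 2 \<and> p $ 2 \<le> 3/4 * h k" for p k
    by (auto simp: R_def mem_box_cart forall_2)
  have xk: "x k \<le> 1/2" if "1 \<le> k" for k
    using powr_mono[of "- real k" "- 1" 2] that by (simp add: x_def powr_minus)
  have inR: "p \<in> \<Omega> \<and> W p \<le> 2 powr (- 2 * real k * real l)" if k: "1 \<le> k" and p: "p \<in> R k" for p k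
  proof -
    have b: "0 < p $ 1" "p $ 1 \<le> 1/2" "0 < p $ 2" using p mem xp[of k] hp[of k] xk[OF k] by (auto intro: less_le_trans)
    have "x (Suc k) \<le> p $ 1"
    proof -
      have "- real (Suc k) = - real k - 1" by simp
      then have "x (Suc k) = 1/2 * x k" unfolding x_def by (simp only: powr_diff) simp
      then show ?thesis using p mem xp[of k] by auto
    qed
    then have "x (Suc k) ^ l \<le> (p $ 1) ^ l" using xp by (intro power_mono) (auto intro: less_imp_le)
    moreover have "x (Suc k) ^ l = 2 powr (- (real k + 1) * real l)"
      by (simp add: x_def powr_power algebra_simps)
    ultimately have "c * (2 powr (- (real k + 1) * real l)) * (1/2) \<le> c * (p $ 1) ^ l * (1 - p $ 1)"
      using b c_bounds by (intro mult_mono mult_left_mono) auto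
    then have hg: "h k \<le> g (p $ 1)" by (simp add: h_def g_eq)
    have "p $ 2 < g (p $ 1)" using p mem hp[of k] hg by auto
    then have \<Omega>: "p \<in> \<Omega>" using b by (auto simp: \<Omega>_def)
    have "g (p $ 1) \<le> (p $ 1) ^ l" using b by (intro g_bounds) auto
    also have "\<dots> \<le> x k ^ l" using p mem b by (intro power_mono) auto
    also have "x k ^ l = 2 powr (- real k * real l)" by (simp add: x_def powr_power mult.commute)
    finally have gx: "g (p $ 1) \<le> 2 powr (- real k * real l)" .
    have "W p \<le> g (p $ 1) * g (p $ 1)"
      unfolding W_def using \<open>p $ 2 < g (p $ 1)\<close> b by (intro mult_mono) auto
    also have "\<dots> \<le> 2 powr (- real k * real l) * 2 powr (- real k * real l)"
      using gx g_pos[of "p $ 1"] b by (intro mult_mono) auto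
    also have "\<dots> = 2 powr (- 2 * real k * real l)" by (simp add: mult.assoc flip: powr_add)
    finally show ?thesis using \<Omega> by blast
  qed
  define a where "a k = 2 powr (2 * real k * real l * \<beta>)" for k :: nat
  define F where "F p = (if 0 < u p then ennreal (u p powr (- \<beta>)) else \<infinity>)" for p
  have "AE p in lebesgue_on \<Omega>. u p \<le> W p"
    by (rule dom.torsion_le_supersolution[OF u smooth_W laplacian_W_le]) (auto dest: W_pos)
  moreover have "AE p in lebesgue_on \<Omega>. p \<in> \<Omega>" by (rule AE_I2) simp
  ultimately have low: "AE p in lebesgue_on \<Omega>. (\<Sum>k\<in>{1..n}. ennreal (a k) * indicator (R k) p) \<le> F p" for n
  proof eventually_elim
    case (elim p)
    have Fk: "ennreal (a k) \<le> F p" if k: "1 \<le> k" "p \<in> R k" for k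
    proof (cases "0 < u p")
      case True
      have "(2 powr (- 2 * real k * real l)) powr (- \<beta>) \<le> u p powr (- \<beta>)"
        using inR[OF k] elim(1) True \<beta> by (intro powr_mono2') auto
      moreover have "(2 powr (- 2 * real k * real l)) powr (- \<beta>) = a k"
        by (simp add: a_def powr_powr)
      ultimately show ?thesis using True by (simp add: F_def ennreal_leI)
    qed (simp add: F_def)
    show ?case
    proof (cases "\<exists>k\<in>{1..n}. p \<in> R k")
      case True
      then obtain k where k: "k \<in> {1..n}" "p \<in> R k" by blast
      \<comment> \<open>The abscissae in \<open>R k\<close> lie between 3/4 x k and x k, while the
        next point is x k / 2, so the rectangles have disjoint projections.\<close>
      have "p \<notin> R j" if "j \<noteq> k" for j
      proof
        assume j: "p \<in> R j"
        have half: "x i \<le> x m / 2" if "m < i" for m i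
        proof -
          have "x i \<le> 2 powr (- real m - 1)" unfolding x_def using that by (intro powr_mono) auto
          then show ?thesis by (simp add: x_def powr_diff)
        qed
        have "\<not> j < k" "\<not> k < j"
          using half[of j k] half[of k j] j k(2) mem xp[of j] xp[of k] by auto
        then show False using that by simp
      qed
      then have "(\<Sum>j\<in>{1..n}. ennreal (a j) * indicator (R j) p) = (\<Sum>j\<in>{k}. ennreal (a j) * indicator (R j) p)"
        using k by (intro sum.mono_neutral_right) auto
      then show ?thesis using Fk[of k] k by simp
    next
      case False
      then have "(\<Sum>k\<in>{1..n}. ennreal (a k) * indicator (R k) p) = 0" by (intro sum.neutral) auto
      then show ?thesis by simp
    qed
  qed
  \<comment> \<open>The area of \<open>R k\<close> is x k / 4 times h k / 4; the factor 1/16 times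
    the c / 2 in \<open>h\<close> gives c / 32.\<close>
  define m where "m = c / 32 * 2 powr (- real l)"
  have m: "0 < m" using c_bounds by (simp add: m_def)
  have area: "ennreal m \<le> ennreal (a k) * emeasure (lebesgue_on \<Omega>) (R k)" if k: "k \<in> {1..n}" for k n
  proof -
    have sub: "R k \<subseteq> \<Omega>" using inR k by auto
    have ne: "R k \<noteq> {}" using mem[of "pt (x k) (h k / 2)" k] xp[of k] hp[of k] by auto
    have "emeasure (lebesgue_on \<Omega>) (R k) = emeasure lebesgue (R k)"
      using sub dom.lmeasurable_domain by (intro emeasure_restrict_space) (auto simp: fmeasurable_def)
    also have "\<dots> = ennreal (measure lborel (R k))"
      by (simp add: R_def emeasure_eq_measure2)
    also have "measure lborel (R k) = (x k - 3/4 * x k) * (3/4 * h k - h k / 2)"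
      using ne unfolding R_def by (subst content_cbox_cart) (auto simp: prod_2 UNIV_2)
    also have "\<dots> = x k * h k / 16" by simp
    finally have e: "emeasure (lebesgue_on \<Omega>) (R k) = ennreal (x k * h k / 16)" .
    have "m = c / 32 * 2 powr (- real l) * 1" by (simp add: m_def)
    also have "\<dots> \<le> c / 32 * 2 powr (- real l) * 2 powr (real k * (real l * (2 * \<beta> - 1) - 1))"
      using \<beta> c_bounds by (intro mult_left_mono ge_one_powr_ge_zero) auto
    also have "\<dots> = a k * (x k * h k / 16)"
    proof -
      have "2 powr (- real l) * 2 powr (real k * (real l * (2 * \<beta> - 1) - 1))
          = 2 powr (2 * real k * real l * \<beta>) * (2 powr (- real k) * 2 powr (- (real k + 1) * real l))"
        by (simp add: algebra_simps flip: powr_add)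
      then show ?thesis by (simp add: a_def x_def h_def)
    qed
    finally have "ennreal m \<le> ennreal (a k * (x k * h k / 16))" by (rule ennreal_leI)
    moreover have "ennreal (a k * (x k * h k / 16)) = ennreal (a k) * ennreal (x k * h k / 16)"
      using xp[of k] hp[of k] by (intro ennreal_mult) (auto simp: a_def)
    ultimately show ?thesis unfolding e by simp
  qed
  have big: "ennreal (real n * m) \<le> neg_power_integral \<Omega> u \<beta>" for n
  proof -
    have Rm: "R k \<in> sets (lebesgue_on \<Omega>)" if "1 \<le> k" for k
      using inR[OF that] dom.lmeasurable_domain by (subst sets_restrict_space_iff) (auto simp: fmeasurable_def R_def)
    have "ennreal (real n * m) = (\<Sum>k\<in>{1..n}. ennreal m)"
      using m by (simp add: ennreal_mult' ennreal_of_nat_eq_real_of_nat)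
    also have "\<dots> \<le> (\<Sum>k\<in>{1..n}. ennreal (a k) * emeasure (lebesgue_on \<Omega>) (R k))"
      by (intro sum_mono area)
    also have "\<dots> = (\<Sum>k\<in>{1..n}. \<integral>\<^sup>+p. ennreal (a k) * indicator (R k) p \<partial>lebesgue_on \<Omega>)"
      using Rm by (intro sum.cong refl nn_integral_cmult_indicator[symmetric]) auto
    also have "\<dots> = (\<integral>\<^sup>+p. (\<Sum>k\<in>{1..n}. ennreal (a k) * indicator (R k) p) \<partial>lebesgue_on \<Omega>)"
      using Rm by (intro nn_integral_sum[symmetric]) auto
    also have "\<dots> \<le> (\<integral>\<^sup>+p. F p \<partial>lebesgue_on \<Omega>)"
      by (rule nn_integral_mono_AE[OF low])
    finally show ?thesis by (simp add: neg_power_integral_def F_def)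
  qed
  show ?thesis
  proof (cases "neg_power_integral \<Omega> u \<beta>")
    case (real r)
    obtain n :: nat where "r / m < n" using reals_Archimedean2 by blast
    then have "r < real n * m" using m by (simp add: field_simps)
    moreover have "real n * m \<le> r" using big[of n] real by (simp add: ennreal_le_iff)
    ultimately show ?thesis by simp
  qed simp
qed

end

lemma exists_cusp_domain:
  assumes "1/2 < \<beta>"
  shows "\<exists>\<Omega> :: (real^2) set. bounded_domain \<Omega> \<and> dirichlet_regular \<Omega> \<and> ahlfors_regular (frontier \<Omega>) \<and>
       (\<forall>u. torsion_function \<Omega> u \<longrightarrow> neg_power_integral \<Omega> u \<beta> = \<infinity>)"
proof -
  obtain l0 :: nat where l0: "1 / (2 * \<beta> - 1) < l0" using reals_Archimedean2 by blast
  \<comment> \<open>The summand 2 meets the hypothesis of the locale and only increases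
    \<open>l\<close>.\<close>
  define l where "l = l0 + 2"
  have "1 / (2 * \<beta> - 1) \<le> real l" using l0 by (simp add: l_def)
  then have ll: "1 \<le> real l * (2 * \<beta> - 1)" using assms by (simp add: field_simps)
  interpret cusp l by unfold_locales (simp add: l_def)
  show ?thesis
    using bounded_domain_cusp dirichlet_regular_cusp ahlfors_regular_cusp neg_power_integral_cusp[OF _ _ ll] assms
    by (intro exI[of _ "cusp.\<Omega> l"]) auto
qed

theorem proposition2p15:
  shows
    "(\<forall>\<Omega> :: (real^'n) set. bounded_domain \<Omega> \<longrightarrow>
       (\<exists>u. torsion_function \<Omega> u \<and>
            (\<forall>v. torsion_function \<Omega> v \<longrightarrow> (AE x in lebesgue_on \<Omega>. v x = u x))))
     \<and>
     (\<forall>(\<Omega> :: (real^'n) set) \<gamma> u \<beta>.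
       bounded_domain \<Omega> \<and> \<gamma> < real CARD('n) \<and> upper_minkowski_content \<gamma> \<Omega> < \<infinity> \<and>
       torsion_function \<Omega> u \<and> \<beta> \<in> {0<..<(real CARD('n) - \<gamma>) / 2} \<longrightarrow>
       neg_power_integral \<Omega> u \<beta> < \<infinity>)
     \<and>
     (\<forall>(\<Omega> :: (real^'n) set) u \<beta>.
       bounded_domain \<Omega> \<and> ahlfors_regular (frontier \<Omega>) \<and>
       torsion_function \<Omega> u \<and> \<beta> \<in> {0<..<1/2} \<longrightarrow>
       neg_power_integral \<Omega> u \<beta> < \<infinity>)
     \<and>
     (\<forall>C0 C1 K. \<forall>\<beta>\<in>{0<..<1/2::real}. \<exists>C C'. C > 0 \<and> C' > 0 \<and>
       (\<forall>R (\<Omega> :: (real^'n) set) u.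
          bounded_domain \<Omega> \<and> has_ahlfors_character C0 C1 R (frontier \<Omega>) \<and>
          diameter \<Omega> \<le> K * R \<and> torsion_function \<Omega> u \<longrightarrow>
          hausdorff_measure (CARD('n) - 1) (frontier \<Omega>) < \<infinity> \<and>
          (let A = measure lebesgue \<Omega> powr (1 - 2 * \<beta>) *
                   enn2real (hausdorff_measure (CARD('n) - 1) (frontier \<Omega>)) powr (2 * \<beta>)
           in neg_power_integral \<Omega> u \<beta> \<le> ennreal (C * A) \<and>
              C * A \<le> C' * diameter \<Omega> powr (real CARD('n) - 2 * \<beta>))))
     \<and>
     (\<forall>\<beta>\<in>{1/2<..<1::real}. \<exists>\<Omega> :: (real^2) set.
       bounded_domain \<Omega> \<and> dirichlet_regular \<Omega> \<and> ahlfors_regular (frontier \<Omega>) \<and>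
       (\<forall>u. torsion_function \<Omega> u \<longrightarrow> neg_power_integral \<Omega> u \<beta> = \<infinity>))"
proof (intro conjI allI impI ballI)
  fix \<Omega> :: "(real^'n) set" assume \<Omega>: "bounded_domain \<Omega>"
  then interpret bounded_open \<Omega> by unfold_locales (auto simp: bounded_domain_def)
  show "\<exists>u. torsion_function \<Omega> u \<and> (\<forall>v. torsion_function \<Omega> v \<longrightarrow> (AE x in lebesgue_on \<Omega>. v x = u x))"
    by (rule torsion_exists_unique)
next
  fix \<Omega> :: "(real^'n) set" and \<gamma> u \<beta>
  assume A: "bounded_domain \<Omega> \<and> \<gamma> < real CARD('n) \<and> upper_minkowski_content \<gamma> \<Omega> < \<infinity> \<and>
       torsion_function \<Omega> u \<and> \<beta> \<in> {0<..<(real CARD('n) - \<gamma>) / 2}"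
  then interpret bounded_open \<Omega> by unfold_locales (auto simp: bounded_domain_def)
  show "neg_power_integral \<Omega> u \<beta> < \<infinity>"
    using A by (intro neg_power_integral_minkowski[of u \<gamma>]) auto
next
  fix \<Omega> :: "(real^'n) set" and u \<beta>
  assume A: "bounded_domain \<Omega> \<and> ahlfors_regular (frontier \<Omega>) \<and> torsion_function \<Omega> u \<and> \<beta> \<in> {0<..<1/2::real}"
  then obtain C0 C1 R where ah: "has_ahlfors_character C0 C1 R (frontier \<Omega>)" by (auto simp: ahlfors_regular_def)
  \<comment> \<open>For one fixed domain K = diam \<Omega> / R always serves, so finiteness follows
    from the quantitative bound.\<close>
  then have "diameter \<Omega> \<le> diameter \<Omega> / R * R" by (simp add: has_ahlfors_character_def)
  moreover have \<beta>: "0 < \<beta>" "\<beta> < 1/2" using A by auto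
  ultimately obtain C where "neg_power_integral \<Omega> u \<beta> \<le> ennreal C"
    using neg_power_integral_ahlfors_bound[OF \<beta>, where 'a="real^'n", of C0 C1 "diameter \<Omega> / R"] A ah
    unfolding Let_def by blast
  then show "neg_power_integral \<Omega> u \<beta> < \<infinity>" by (rule le_less_trans) simp
next
  fix C0 C1 K \<beta> :: real assume "\<beta> \<in> {0<..<1/2}"
  then show "\<exists>C C'. C > 0 \<and> C' > 0 \<and>
       (\<forall>R (\<Omega> :: (real^'n) set) u.
          bounded_domain \<Omega> \<and> has_ahlfors_character C0 C1 R (frontier \<Omega>) \<and>
          diameter \<Omega> \<le> K * R \<and> torsion_function \<Omega> u \<longrightarrow>
          hausdorff_measure (CARD('n) - 1) (frontier \<Omega>) < \<infinity> \<and>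
          (let A = measure lebesgue \<Omega> powr (1 - 2 * \<beta>) *
                   enn2real (hausdorff_measure (CARD('n) - 1) (frontier \<Omega>)) powr (2 * \<beta>)
           in neg_power_integral \<Omega> u \<beta> \<le> ennreal (C * A) \<and>
              C * A \<le> C' * diameter \<Omega> powr (real CARD('n) - 2 * \<beta>)))"
    using neg_power_integral_ahlfors_bound[of \<beta> C0 C1 K, where 'a="real^'n"] by simp
next
  fix \<beta> :: real assume "\<beta> \<in> {1/2<..<1}"
  then show "\<exists>\<Omega> :: (real^2) set. bounded_domain \<Omega> \<and> dirichlet_regular \<Omega> \<and> ahlfors_regular (frontier \<Omega>) \<and>
       (\<forall>u. torsion_function \<Omega> u \<longrightarrow> neg_power_integral \<Omega> u \<beta> = \<infinity>)"
    by (intro exists_cusp_domain) auto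
qed

end
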